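(* Let $\beta,\delta\in(0,1)$, let $d\in\{1,2,3\}$, and let $\Lambda=\Lambda^{\rm HC}_{n-1}\subset\mathbb{N}_0^d$ be the $d$-dimensional hyperbolic cross of order $n$, where $n\in\mathbb{N}$ if $d=1,2$, and $n\ge 26$ if $d=3$. For $\mathsf{w}\ge 1$, let $\mathcal{S}_\Lambda$ be the linear span of $\{\varphi_{\mathsf{w},\vec\nu}\}_{\vec\nu\in\Lambda}$, and let $\vec y_1,\dots,\vec y_m$ be random sample points drawn independently from the uniform measure ${\bf u}$ on $[-1,1]^d$. If $$ m\ \ge\ \big((1-\delta)\log(1-\delta)+\delta\big)^{-1}\,(2\,\#\Lambda)^{2\gamma(\mathsf{w})}\,\log(\#\Lambda/\beta), $$ then, with probability at least $1-\beta$, the following holds: for every $f\in\mathcal{C}([-1,1]^d)$ and every noise vector $\vec e=\frac{1}{\sqrt m}(\eta_j)_{j=1}^m\in\mathbb{C}^m$, the least squares problem $$ f^{\natural}\in\operatorname*{arg\,min}_{g\in\mathcal{S}_\Lambda}\ \frac1m\sum_{j=1}^m |g(\vec y_j)-f(\vec y_j)-\eta_j|^2 $$ has a unique solution $f^\natural\in\mathcal{S}_\Lambda$, and it satisfies $$ \|f-f^\natural\|_{L^2_{\bf u}([-1,1]^d)}\ \le\ \Big(1+\frac{1}{\sqrt{1-\delta}}\Big)\inf_{g\in\mathcal{S}_\Lambda}\|f-g\|_{L^\infty([-1,1]^d)}+\frac{1}{\sqrt{1-\delta}}\|\vec e\|_2 . $$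
   Context: Notation: $\mathbb{N}_0=\mathbb{N}\cup\{0\}$; $\#\Lambda$ is the cardinality of $\Lambda$; $\log$ is the natural logarithm; $\|\cdot\|_2$ is the Euclidean norm on $\mathbb{C}^m$. Functions are complex-valued and linear spans are over $\mathbb{C}$. ${\bf u}$ is the uniform probability measure on $[-1,1]^d$ and $L^2_{\bf u}([-1,1]^d)$ the corresponding $L^2$ space. For $\mathsf{w}\ge 1$, $\gamma(\mathsf{w}):=\lceil\log_2(24\mathsf{w})\rceil$. Hyperbolic cross: $\Lambda^{\rm HC}_{n-1}:=\{\vec\nu\in\mathbb{N}_0^d:\prod_{k=1}^d(\nu_k+1)\le n\}$. Slepian basis (prolate spheroidal wave functions): let ${\rm PW}_{\mathsf{w}}=\{f\in L^2(\mathbb{R}):\mathrm{supp}(\hat f)\subset[-\mathsf{w},\mathsf{w}]\}$, with $\hat f(v)=\int_{\mathbb{R}}f(x)e^{-ivx}\,dx$. The operator $$\mathcal{Q}_{\mathsf{w}}f(x)=\int_{-1}^1 f(t)\,\frac{\sin \mathsf{w}(x-t)}{\pi(x-t)}\,dt,\qquad x\in\mathbb{R},$$ on ${\rm PW}_{\mathsf{w}}$ is compact with simple eigenvalues $1>\mu_{\mathsf{w},0}>\mu_{\mathsf{w},1}>\cdots>0$ tending to $0$. For $j\in\mathbb{N}_0$, $\varphi_{\mathsf{w},j}\in{\rm PW}_{\mathsf{w}}$ is the (real-valued) eigenfunction with $\mathcal{Q}_{\mathsf{w}}\varphi_{\mathsf{w},j}=\mu_{\mathsf{w},j}\varphi_{\mathsf{w},j}$,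 normalized so that $\|\varphi_{\mathsf{w},j}\|_{L^2_{\bf u}([-1,1])}=1$, i.e. $\frac12\int_{-1}^1|\varphi_{\mathsf{w},j}|^2dx=1$. The family $\{\varphi_{\mathsf{w},j}\}_{j\in\mathbb{N}_0}$ is an orthonormal basis of $L^2_{\bf u}([-1,1])$. For $\vec\nu\in\mathbb{N}_0^d$, $\varphi_{\mathsf{w},\vec\nu}:=\varphi_{\mathsf{w},\nu_1}\otimes\cdots\otimes\varphi_{\mathsf{w},\nu_d}$. *)

theory Defs
  imports "HOL-Probability.Probability"
begin

definition square_integrable :: "(real \<Rightarrow> complex) \<Rightarrow> bool" where
  "square_integrable f \<longleftrightarrow>
     f \<in> borel_measurable lborel \<and> integrable lborel (\<lambda>x. (cmod (f x))\<^sup>2)"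

text \<open>\<open>g\<close> is the \<open>L\<^sup>2\<close> (Plancherel) Fourier transform of \<open>f\<close>, i.e. the \<open>L\<^sup>2\<close> limit of the
  transforms of the truncations of \<open>f\<close>. A limit is unavoidable: functions in \<open>PW\<close> (the
  prolate functions among them) need not be absolutely integrable.\<close>

definition is_fourier_transform :: "(real \<Rightarrow> complex) \<Rightarrow> (real \<Rightarrow> complex) \<Rightarrow> bool" where
  "is_fourier_transform f g \<longleftrightarrow> square_integrable g \<and>
     ((\<lambda>R. \<integral>\<^sup>+v. ennreal ((cmod ((LINT x:{-R..R}|lborel.
          f x * exp (- (\<i> * complex_of_real v * complex_of_real x))) - g v))\<^sup>2) \<partial>lborel)
        \<longlongrightarrow> 0) at_top"

definition PW :: "real \<Rightarrow> (real \<Rightarrow> complex) set" where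
  "PW w = {f. square_integrable f \<and>
     (\<exists>g. is_fourier_transform f g \<and> (AE v in lborel. v \<notin> {-w..w} \<longrightarrow> g v = 0))}"

text \<open>The integrand at the single point \<open>t = x\<close> (where HOL division gives 0) is immaterial.\<close>

definition slepian_op :: "real \<Rightarrow> (real \<Rightarrow> complex) \<Rightarrow> real \<Rightarrow> complex" where
  "slepian_op w f x = (LINT t:{-1..1}|lborel.
      f t * complex_of_real (sin (w * (x - t)) / (pi * (x - t))))"

text \<open>The eigenvalue equation is required at every point, which selects the continuous
  representative of the \<open>L\<^sup>2\<close> class.\<close>

definition slepian_eigenfunction :: "real \<Rightarrow> complex \<Rightarrow> (real \<Rightarrow> complex) \<Rightarrow> bool" where
  "slepian_eigenfunction w l f \<longleftrightarrow> f \<in> PW w \<and> \<not> (AE x in lborel. f x = 0) \<and>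
     (\<forall>x. slepian_op w f x = l * f x)"

text \<open>Orthonormal basis of the complex space \<open>L\<^sup>2([-1,1])\<close> with respect to the uniform probability
  measure \<open>dx/2\<close>, for a real-valued family.\<close>

definition orthonormal_basis_u :: "(nat \<Rightarrow> real \<Rightarrow> real) \<Rightarrow> bool" where
  "orthonormal_basis_u \<phi> \<longleftrightarrow>
     (\<forall>i j. (1/2) * (LINT x:{-1..1}|lborel. \<phi> i x * \<phi> j x) = (if i = j then 1 else 0)) \<and>
     (\<forall>f :: real \<Rightarrow> complex. set_borel_measurable lborel {-1..1} f \<longrightarrow>
        set_integrable lborel {-1..1} (\<lambda>x. (cmod (f x))\<^sup>2) \<longrightarrow>
        (\<lambda>N. LINT x:{-1..1}|lborel. (cmod (f x - (\<Sum>j<N.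
             (1/2) * (LINT t:{-1..1}|lborel. f t * complex_of_real (\<phi> j t))
               * complex_of_real (\<phi> j x))))\<^sup>2)
          \<longlonglongrightarrow> 0)"

text \<open>\<open>\<mu> 0 > \<mu> 1 > \<dots>\<close> are all the eigenvalues of \<open>slepian_op w\<close> on \<open>PW w\<close>, each of them simple, and
  \<open>\<phi> j\<close> is a normalised real eigenfunction for \<open>\<mu> j\<close>. For \<open>w > 0\<close> this determines \<open>\<mu>\<close>, and each
  \<open>\<phi> j\<close> up to sign. The classical facts \<open>0 < \<mu> j < 1\<close>, \<open>\<mu> \<longlonglongrightarrow> 0\<close>, simplicity and the basis property
  are recorded as part of the notion.\<close>

definition slepian_basis :: "real \<Rightarrow> (nat \<Rightarrow> real) \<Rightarrow> (nat \<Rightarrow> real \<Rightarrow> real) \<Rightarrow> bool" where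
  "slepian_basis w \<mu> \<phi> \<longleftrightarrow>
     {l. \<exists>f. slepian_eigenfunction w l f} = range (\<lambda>j. complex_of_real (\<mu> j)) \<and>
     (\<forall>i j. i < j \<longrightarrow> \<mu> j < \<mu> i) \<and> (\<forall>j. 0 < \<mu> j \<and> \<mu> j < 1) \<and> \<mu> \<longlonglongrightarrow> 0 \<and>
     (\<forall>j f. slepian_eigenfunction w (complex_of_real (\<mu> j)) f \<longrightarrow>
        (\<exists>c. f = (\<lambda>x. c * complex_of_real (\<phi> j x)))) \<and>
     (\<forall>j. slepian_eigenfunction w (complex_of_real (\<mu> j)) (\<lambda>x. complex_of_real (\<phi> j x))) \<and>
     (\<forall>j. (1/2) * (LINT x:{-1..1}|lborel. (\<phi> j x)\<^sup>2) = 1) \<and>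
     orthonormal_basis_u \<phi>"

definition cube :: "(real ^ 'd) set" where
  "cube = cbox (\<chi> i. -1) (\<chi> i. 1)"

definition unif :: "(real ^ 'd) measure" where
  "unif = uniform_measure lborel cube"

definition hyperbolic_cross :: "nat \<Rightarrow> ('d::finite \<Rightarrow> nat) set" where
  "hyperbolic_cross n = {\<nu>. (\<Prod>k\<in>UNIV. \<nu> k + 1) \<le> n}"

definition tensor_fun :: "(nat \<Rightarrow> real \<Rightarrow> real) \<Rightarrow> ('d::finite \<Rightarrow> nat) \<Rightarrow> real ^ 'd \<Rightarrow> complex" where
  "tensor_fun \<phi> \<nu> x = (\<Prod>k\<in>UNIV. complex_of_real (\<phi> (\<nu> k) (x $ k)))"

text \<open>The complex linear span of the \<open>tensor_fun \<phi> \<nu>\<close>, \<open>\<nu> \<in> L\<close>, for a finite index set \<open>L\<close>.\<close>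

definition span_fun ::
    "(nat \<Rightarrow> real \<Rightarrow> real) \<Rightarrow> ('d::finite \<Rightarrow> nat) set \<Rightarrow> (real ^ 'd \<Rightarrow> complex) set" where
  "span_fun \<phi> L = {g. \<exists>c. g = (\<lambda>x. \<Sum>\<nu>\<in>L. c \<nu> * tensor_fun \<phi> \<nu> x)}"

text \<open>The norms below ignore the values of the function outside the cube, so that a continuous
  function on the cube may be given by an arbitrary total function.\<close>

definition L2_norm_u :: "(real ^ 'd \<Rightarrow> complex) \<Rightarrow> real" where
  "L2_norm_u f = sqrt (LINT x:cube|unif. (cmod (f x))\<^sup>2)"

definition Linf_norm_u :: "(real ^ 'd \<Rightarrow> complex) \<Rightarrow> real" where
  "Linf_norm_u f = Inf {C. 0 \<le> C \<and> (AE x in lborel. x \<in> cube \<longrightarrow> cmod (f x) \<le> C)}"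

definition gamma_w :: "real \<Rightarrow> nat" where
  "gamma_w w = nat \<lceil>log 2 (24 * w)\<rceil>"

definition ls_objective ::
    "nat \<Rightarrow> (nat \<Rightarrow> real ^ 'd) \<Rightarrow> (real ^ 'd \<Rightarrow> complex) \<Rightarrow> (nat \<Rightarrow> complex)
      \<Rightarrow> (real ^ 'd \<Rightarrow> complex) \<Rightarrow> real" where
  "ls_objective m y f \<eta> g = (1 / real m) * (\<Sum>j<m. (cmod (g (y j) - f (y j) - \<eta> j))\<^sup>2)"

end

theory Submission
  imports Defs "HOL-Computational_Algebra.Polynomial"
begin

text \<open>The plan is to bound \<open>|\<phi>\<^sub>\<nu>|\<^sup>2 \<le> b\<close> on the cube so well that entrywise concentration of the
  sampled Gram matrix \<open>G\<close> suffices: Bernstein's inequality for each product \<open>\<phi>\<^sub>\<nu> \<phi>\<^sub>\<nu>'\<close> at level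
  \<open>\<delta> / #\<Lambda>\<close> and a union bound over \<open>(#\<Lambda>)\<^sup>2\<close> events give \<open>G \<ge> (1 - \<delta>) I\<close> with probability at least
  \<open>1 - \<beta>\<close> as soon as \<open>8 b (#\<Lambda>)\<^sup>2 \<le> (2 #\<Lambda>)\<^bsup>2\<gamma>\<^esup>\<close>, because \<open>(1 - \<delta>) log (1 - \<delta>) + \<delta> \<le> \<delta>\<^sup>2\<close>. The loss
  against a matrix Chernoff bound is affordable since \<open>2\<gamma> \<ge> 10\<close>.

  The sup norms are controlled by \<open>\<phi>\<^sub>j\<^sup>2 \<le> 4w (j+1)\<^bsup>2\<gamma>-2\<^esup>\<close>, without the prolate differential equation. A step
  function with \<open>j + 1\<close> pieces, orthogonal to \<open>\<phi>\<^sub>0, \<dots>, \<phi>\<^sub>j\<^sub>-\<^sub>1\<close>, has as transform an exponential sum whose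
  coefficients Lagrange interpolation recovers from its values at \<open>j + 1\<close> points of the band, so
  the min-max principle gives \<open>\<mu>\<^sub>j \<ge> (c/(j+1))\<^bsup>2j+2\<^esup>\<close> for some \<open>c > 0\<close>. Being band-limited
  with energy \<open>2/\<mu>\<^sub>j\<close>, \<open>\<phi>\<^sub>j\<close> is then within \<open>1/10\<close> of a Taylor polynomial of degree about \<open>4w(j+1)\<close>, to which a Nikolskii
  inequality (sup norm against \<open>L\<^sup>2\<close> norm) applies.

  On the good event the sampled norm dominates \<open>sqrt (1 - \<delta>)\<close> times the \<open>L\<^sup>2\<close> norm on the span, and the error
  bound follows from orthogonality of the least squares residual.\<close>

section \<open>Polynomials on an interval and on the unit circle\<close>

text \<open>The tensor product dictates the shape of the bound on \<open>\<phi> j\<close>: a bound c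
  (j+1)^p passes to \<open>hyperbolic_cross n\<close> as c^d n^p, because the product of all
  \<open>\<nu> k + 1\<close> is at most n. So w may survive only in c, and powers of w beyond the
  first are traded for powers of j+1 \<ge> 2 by means of 2^\<gamma> \<ge> 24w; at j = 0 no such
  trade exists, hence a separate estimate there. The cube in the raw bound 72 (w(j+1))^3 is the
  price of \<open>poly_Nikolskii\<close> at degree about 4w(j+1): the squared sup norm costs the
  cube of the degree. The obstacle is the division by \<open>\<mu> j\<close> when the eigenvalue
  equation is solved for \<open>\<phi> j\<close>. A lower bound of type (c/(j+1))^(2j+2) suffices
  even with a poor c, since Taylor remainders of degree D are at most of size (3w/D)^D, and a degree
  of four times w(j+1) beats it. Of the remaining constants, (4w)^d is covered by (2^\<gamma>)^2 for
  d \<le> 2; for d = 3 the cross has at least 2n elements, which releases a further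
  2^(2\<gamma>-2).\<close>

lemma integral_sin_sin:
  fixes k l :: nat
  assumes "k \<ge> 1" "l \<ge> 1"
  shows "((\<lambda>t. sin (real k * t) * sin (real l * t)) has_integral (if k = l then pi/2 else 0)) {0..pi}"
proof (cases "k = l")
  case True
  have "((\<lambda>t. sin (real k * t) * sin (real k * t)) has_integral
     ((pi/2 - sin (2*real k*pi)/(4*real k)) - (0/2 - sin (2*real k*0)/(4*real k)))) {0..pi}"
  proof (rule fundamental_theorem_of_calculus)
    fix x :: real
    have "((\<lambda>t. t/2 - sin (2*real k*t)/(4*real k)) has_real_derivative
        (1/2 - cos (2*real k*x) * (2*real k)/(4*real k))) (at x within {0..pi})"
      using assms by (auto intro!: derivative_eq_intros)
    moreover have "1/2 - cos (2*real k*x) * (2*real k)/(4*real k) = sin (real k * x) * sin (real k * x)"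
      using assms cos_double_sin[of "real k * x"] by (simp add: field_simps power2_eq_square)
    ultimately show "((\<lambda>t. t/2 - sin (2*real k*t)/(4*real k)) has_vector_derivative sin (real k * x) * sin (real k * x)) (at x within {0..pi})"
      by (simp add: has_real_derivative_iff_has_vector_derivative)
  qed simp
  moreover have "sin (2*real k*pi) = 0"
    using sin_npi[of "2*k"] by simp
  ultimately show ?thesis using True by simp
next
  case False
  define a b where "a = real k - real l" and "b = real k + real l"
  have ab: "a \<noteq> 0" "b \<noteq> 0" using False assms by (auto simp: a_def b_def)
  have "((\<lambda>t. sin (real k * t) * sin (real l * t)) has_integral
     ((sin (a*pi)/(2*a) - sin (b*pi)/(2*b)) - (sin (a*0)/(2*a) - sin (b*0)/(2*b)))) {0..pi}"
  proof (rule fundamental_theorem_of_calculus)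
    fix x :: real
    have "((\<lambda>t. sin (a*t)/(2*a) - sin (b*t)/(2*b)) has_real_derivative
        (cos (a*x)*a/(2*a) - cos (b*x)*b/(2*b))) (at x within {0..pi})"
      using ab by (auto intro!: derivative_eq_intros)
    moreover have "cos (a*x)*a/(2*a) - cos (b*x)*b/(2*b) = sin (real k * x) * sin (real l * x)"
    proof -
      have "real k * x - real l * x = a * x" "real k * x + real l * x = b * x"
        by (simp_all add: a_def b_def algebra_simps)
      then show ?thesis using ab by (simp add: sin_times_sin diff_divide_distrib)
    qed
    ultimately show "((\<lambda>t. sin (a*t)/(2*a) - sin (b*t)/(2*b)) has_vector_derivative sin (real k * x) * sin (real l * x)) (at x within {0..pi})"
      by (simp add: has_real_derivative_iff_has_vector_derivative)
  qed simp
  moreover have "sin (a*pi) = 0" "sin (b*pi) = 0"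
    using sin_npi_int[of "int k - int l"] sin_npi_int[of "int k + int l"]
    by (simp_all add: a_def b_def mult.commute)
  ultimately show ?thesis using False by simp
qed

lemma abs_sin_mult_le: "\<bar>sin (real k * t)\<bar> \<le> real k * \<bar>sin t\<bar>"
proof (induction k)
  case (Suc k)
  have "\<bar>sin (real (Suc k) * t)\<bar> = \<bar>sin (real k * t) * cos t + cos (real k * t) * sin t\<bar>"
    by (simp add: sin_add algebra_simps)
  also have "\<dots> \<le> \<bar>sin (real k * t)\<bar> * \<bar>cos t\<bar> + \<bar>cos (real k * t)\<bar> * \<bar>sin t\<bar>"
    by (metis abs_mult abs_triangle_ineq)
  also have "\<dots> \<le> \<bar>sin (real k * t)\<bar> * 1 + 1 * \<bar>sin t\<bar>"
    by (intro add_mono mult_mono) auto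
  finally show ?case using Suc by (simp add: algebra_simps)
qed simp

text \<open>Horner's scheme in cos t: multiplication by cos t turns sin((k+1)t) into half the sum of
  its neighbours sin((k+2)t) and sin(kt). Equivalently, polynomials expand in Chebyshev polynomials
  of the second kind.\<close>

lemma poly_cos_mult_sin:
  fixes a :: "nat \<Rightarrow> real"
  shows "\<exists>b. \<forall>t. (\<Sum>k<D. a k * cos t ^ k) * sin t = (\<Sum>k<D. b k * sin (real (Suc k) * t))"
proof (induction D arbitrary: a)
  case (Suc D)
  obtain b where b: "\<And>t. (\<Sum>k<D. a (Suc k) * cos t ^ k) * sin t = (\<Sum>k<D. b k * sin (real (Suc k) * t))"
    using Suc[of "\<lambda>k. a (Suc k)"] by blast
  define c where "c k = (if k = 0 then a 0 else 0) + (if 1 \<le> k then b (k-1) / 2 else 0)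
     + (if k + 1 < D then b (k+1) / 2 else 0)" for k
  have "(\<Sum>k<Suc D. a k * cos t ^ k) * sin t = (\<Sum>k<Suc D. c k * sin (real (Suc k) * t))" for t
  proof -
    have "(\<Sum>k<Suc D. a k * cos t ^ k) * sin t
       = a 0 * sin t + cos t * ((\<Sum>k<D. a (Suc k) * cos t ^ k) * sin t)"
      by (simp only: sum.lessThan_Suc_shift) (simp add: algebra_simps sum_distrib_left)
    also have "cos t * ((\<Sum>k<D. a (Suc k) * cos t ^ k) * sin t)
       = (\<Sum>k<D. b k/2 * sin (real (Suc (Suc k)) * t) + b k/2 * sin (real k * t))"
      unfolding b sum_distrib_left
    proof (rule sum.cong[OF refl])
      fix k
      have "real (Suc (Suc k)) * t = real (Suc k) * t + t" "real k * t = real (Suc k) * t - t"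
        by (simp_all add: algebra_simps)
      then show "cos t * (b k * sin (real (Suc k) * t))
          = b k/2 * sin (real (Suc (Suc k)) * t) + b k/2 * sin (real k * t)"
        by (simp only: sin_add sin_diff) (simp add: field_simps)
    qed
    also have "\<dots> = (\<Sum>k<D. b k/2 * sin (real (Suc (Suc k)) * t)) + (\<Sum>k<D. b k/2 * sin (real k * t))"
      by (rule sum.distrib)
    also have "(\<Sum>k<D. b k/2 * sin (real (Suc (Suc k)) * t))
        = (\<Sum>k<Suc D. (if 1 \<le> k then b (k-1) / 2 else 0) * sin (real (Suc k) * t))"
      by (simp only: sum.lessThan_Suc_shift) simp
    also have "(\<Sum>k<D. b k/2 * sin (real k * t))
        = (\<Sum>k<Suc D. (if k + 1 < D then b (k+1) / 2 else 0) * sin (real (Suc k) * t))"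
    proof (cases D)
      case (Suc E)
      have "(\<Sum>k<D. b k/2 * sin (real k * t)) = (\<Sum>k<E. b (Suc k)/2 * sin (real (Suc k) * t))"
        unfolding Suc by (simp only: sum.lessThan_Suc_shift) simp
      then show ?thesis using Suc by simp
    qed simp
    also have "a 0 * sin t = (\<Sum>k<Suc D. (if k = 0 then a 0 else 0) * sin (real (Suc k) * t))"
      by (simp only: sum.lessThan_Suc_shift) simp
    finally show ?thesis unfolding c_def by (simp only: sum.distrib[symmetric] distrib_right) (simp add: algebra_simps)
  qed
  then show ?case by blast
qed simp

text \<open>Put x = cos t. The weight sin t of the substitution dominates sin^2 t, so the sine
  coefficients b of p(cos t) sin t have a sum of squares of at most 2/pi times the integral of p^2.
  Conversely |sin((k+1)t)| \<le> (k+1) sin t lets sin t be divided out pointwise, and Cauchy-Schwarz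
  leaves the sum of (k+1)^2, of order D^3.\<close>

lemma poly_Nikolskii:
  fixes a :: "nat \<Rightarrow> real" and D :: nat
  defines "p \<equiv> \<lambda>x. \<Sum>k<D. a k * x ^ k"
  assumes x: "x \<in> {-1..1}"
  shows "(p x)\<^sup>2 \<le> 2 / pi * (\<Sum>k<D. (real (Suc k))\<^sup>2) * integral {-1..1} (\<lambda>x. (p x)\<^sup>2)"
proof -
  obtain b where b: "\<And>t. p (cos t) * sin t = (\<Sum>k<D. b k * sin (real (Suc k) * t))"
    using poly_cos_mult_sin[where D = D and a = a] unfolding p_def by blast
  have cp [continuous_intros]: "continuous_on S p" for S unfolding p_def by (intro continuous_intros)
  have i1: "((\<lambda>t. (p (cos t))\<^sup>2 * sin t) has_integral integral {-1..1} (\<lambda>x. (p x)\<^sup>2)) {0..pi}"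
  proof -
    have "((\<lambda>t. (- sin t) *\<^sub>R (p (cos t))\<^sup>2) has_integral
          integral {cos 0..cos pi} (\<lambda>x. (p x)\<^sup>2) - integral {cos pi..cos 0} (\<lambda>x. (p x)\<^sup>2)) {0..pi}"
    proof (rule has_integral_substitution_general[of "{}" 0 pi cos "-1" 1])
      show "continuous_on {-1..1} (\<lambda>x. (p x)\<^sup>2)" by (intro continuous_intros)
    qed (auto intro!: derivative_eq_intros continuous_intros simp: has_real_derivative_iff_has_vector_derivative[symmetric])
    then have "((\<lambda>t. - ((- sin t) *\<^sub>R (p (cos t))\<^sup>2)) has_integral - (0 - integral {-1..1} (\<lambda>x. (p x)\<^sup>2))) {0..pi}"
      by (intro has_integral_neg) simp
    then show ?thesis by (simp add: mult.commute)
  qed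
  have i2: "((\<lambda>t. (p (cos t) * sin t)\<^sup>2) has_integral (pi/2 * (\<Sum>k<D. (b k)\<^sup>2))) {0..pi}"
  proof -
    have "((\<lambda>t. \<Sum>k<D. \<Sum>l<D. b k * b l * (sin (real (Suc k) * t) * sin (real (Suc l) * t)))
       has_integral (\<Sum>k<D. \<Sum>l<D. b k * b l * (if Suc k = Suc l then pi/2 else 0))) {0..pi}"
      by (intro has_integral_sum has_integral_mult_right integral_sin_sin) auto
    also have "(\<Sum>k<D. \<Sum>l<D. b k * b l * (if Suc k = Suc l then pi/2 else 0)) = pi/2 * (\<Sum>k<D. (b k)\<^sup>2)"
      by (simp add: sum_distrib_left power2_eq_square if_distrib cong: if_cong)
         (simp add: algebra_simps)
    finally show ?thesis
      unfolding b power2_eq_square sum_product by (simp add: algebra_simps)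
  qed
  have bs: "pi/2 * (\<Sum>k<D. (b k)\<^sup>2) \<le> integral {-1..1} (\<lambda>x. (p x)\<^sup>2)"
  proof (rule has_integral_le[OF i2 i1])
    fix t assume t: "t \<in> {0..pi}"
    then have "0 \<le> sin t" by (auto simp: sin_ge_zero)
    then have "(sin t)\<^sup>2 \<le> sin t" by (simp add: power2_eq_square mult_left_le_one_le)
    then show "(p (cos t) * sin t)\<^sup>2 \<le> (p (cos t))\<^sup>2 * sin t"
      by (simp add: power_mult_distrib mult_left_mono)
  qed
  define S where "S = (\<Sum>k<D. \<bar>b k\<bar> * real (Suc k))"
  have inner: "\<bar>p y\<bar> \<le> S" if y: "y \<in> {-1<..<1}" for y
  proof -
    define t where "t = arccos y"
    have t: "0 < t" "t < pi" "cos t = y"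
      using y arccos_lt_bounded[of y] by (auto simp: t_def)
    have s: "0 < sin t" using t by (simp add: sin_gt_zero)
    have "\<bar>p y\<bar> * sin t = \<bar>\<Sum>k<D. b k * sin (real (Suc k) * t)\<bar>"
      using s t(3) b[of t] by (metis abs_mult abs_of_pos)
    also have "\<dots> \<le> (\<Sum>k<D. \<bar>b k\<bar> * (real (Suc k) * sin t))"
    proof (rule sum_abs[THEN order_trans], rule sum_mono)
      fix k show "\<bar>b k * sin (real (Suc k) * t)\<bar> \<le> \<bar>b k\<bar> * (real (Suc k) * sin t)"
        using abs_sin_mult_le[of "Suc k" t] s by (simp add: abs_mult mult_left_mono del: of_nat_Suc)
    qed
    also have "\<dots> = S * sin t" by (simp add: S_def sum_distrib_left sum_distrib_right algebra_simps)
    finally show ?thesis using s by simp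
  qed
  \<comment> \<open>Division by sin t fails at the endpoints, which are reached by
    continuity.\<close>
  have "\<bar>p x\<bar> \<le> S"
  proof -
    have "x \<in> closure {-1<..<1::real}" using x by simp
    then show ?thesis
      by (rule continuous_le_on_closure[where f = "\<lambda>y. \<bar>p y\<bar>", rotated])
         (auto intro!: continuous_intros inner)
  qed
  then have "(p x)\<^sup>2 \<le> S\<^sup>2" by (metis abs_le_square_iff abs_of_nonneg abs_ge_zero order_trans)
  also have "\<dots> \<le> (\<Sum>k<D. (b k)\<^sup>2) * (\<Sum>k<D. (real (Suc k))\<^sup>2)"
    unfolding S_def using Cauchy_Schwarz_ineq_sum[of "\<lambda>k. \<bar>b k\<bar>" "\<lambda>k. real (Suc k)" "{..<D}"] by simp
  also have "\<dots> \<le> (2/pi * integral {-1..1} (\<lambda>x. (p x)\<^sup>2)) * (\<Sum>k<D. (real (Suc k))\<^sup>2)"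
    using bs by (intro mult_right_mono sum_nonneg) (auto simp: field_simps)
  finally show ?thesis by (simp add: algebra_simps)
qed

section \<open>Interpolation at points of the unit circle\<close>

lemma sum_norm_coeff_prod_linear_le:
  fixes z :: "'a \<Rightarrow> complex"
  assumes "finite B" "\<And>m. m \<in> B \<Longrightarrow> cmod (z m) = 1"
  shows "degree (\<Prod>m\<in>B. [:- z m, 1:]) = card B \<and>
         (\<Sum>k\<le>card B. cmod (coeff (\<Prod>m\<in>B. [:- z m, 1:]) k)) \<le> 2 ^ card B"
  using assms
proof (induction B)
  case (insert b B)
  define p where "p = (\<Prod>m\<in>B. [:- z m, 1:])"
  define n where "n = card B"
  have IH: "degree p = n" "(\<Sum>k\<le>n. cmod (coeff p k)) \<le> 2 ^ n"
    using insert unfolding p_def n_def by auto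
  have eq: "(\<Prod>m\<in>insert b B. [:- z m, 1:]) = [:- z b, 1:] * p"
    using insert by (simp add: p_def)
  have p0: "p \<noteq> 0" unfolding p_def using insert(1) by (simp add: prod_zero_iff)
  have co: "coeff ([:- z b, 1:] * p) k = (if k = 0 then 0 else coeff p (k-1)) - z b * coeff p k" for k
    by (cases k) auto
  have "(\<Sum>k\<le>Suc n. cmod (coeff ([:- z b, 1:] * p) k))
      \<le> (\<Sum>k\<le>Suc n. (if k = 0 then 0 else cmod (coeff p (k-1))) + cmod (coeff p k))"
  proof (rule sum_mono)
    fix k
    show "cmod (coeff ([:- z b, 1:] * p) k) \<le> (if k = 0 then 0 else cmod (coeff p (k-1))) + cmod (coeff p k)"
      unfolding co using norm_triangle_ineq4[of "if k = 0 then 0 else coeff p (k-1)" "z b * coeff p k"]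
        insert(4)[of b] by (auto simp: norm_mult)
  qed
  also have "\<dots> = (\<Sum>k\<le>n. cmod (coeff p k)) + (\<Sum>k\<le>Suc n. cmod (coeff p k))"
    unfolding sum.distrib by (simp only: sum.atMost_Suc_shift) simp
  also have "(\<Sum>k\<le>Suc n. cmod (coeff p k)) = (\<Sum>k\<le>n. cmod (coeff p k))"
    using IH(1) by (simp add: coeff_eq_0)
  finally have "(\<Sum>k\<le>Suc n. cmod (coeff ([:- z b, 1:] * p) k)) \<le> 2 ^ Suc n" using IH(2) by simp
  moreover have "degree ([:- z b, 1:] * p) = Suc n"
    using p0 IH(1) by (subst degree_mult_eq) auto
  ultimately show ?case using insert eq by (simp add: n_def)
qed simp

text \<open>Lagrange interpolation: \<open>P\<close> and \<open>Q\<close> have degree at most j and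
  agree at j + 1 distinct nodes. Each basis polynomial \<open>L l\<close> is a product of j factors
  X - z with |z| = 1, and each factor at most doubles the coefficient sum, whence 2^j.\<close>

lemma sum_norm_coeff_le_values:
  fixes c :: "nat \<Rightarrow> complex" and z :: "nat \<Rightarrow> complex"
  assumes z1: "\<And>l. l \<le> j \<Longrightarrow> cmod (z l) = 1" and inj: "inj_on z {..j}"
  shows "(\<Sum>k\<le>j. cmod (c k)) \<le>
     (\<Sum>l\<le>j. cmod (\<Sum>k\<le>j. c k * z l ^ k) * (2 ^ j / (\<Prod>m\<in>{..j}-{l}. cmod (z l - z m))))"
proof -
  define P where "P = (\<Sum>k\<le>j. monom (c k) k)"
  define L where "L l = (\<Prod>m\<in>{..j}-{l}. [:- z m, 1:])" for l
  define w where "w l = (\<Prod>m\<in>{..j}-{l}. z l - z m)" for l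
  define v where "v l = (\<Sum>k\<le>j. c k * z l ^ k)" for l
  define Q where "Q = (\<Sum>l\<le>j. smult (v l / w l) (L l))"
  have w0: "w l \<noteq> 0" if "l \<le> j" for l
    using inj that unfolding w_def by (auto simp: inj_on_def)
  have Pz: "poly P (z l) = v l" for l
    by (simp add: P_def v_def poly_sum poly_monom)
  have card: "card ({..j}-{l}) = j" if "l \<le> j" for l using that by simp
  have L: "degree (L l) = j" "(\<Sum>k\<le>j. cmod (coeff (L l) k)) \<le> 2 ^ j" if "l \<le> j" for l
    using sum_norm_coeff_prod_linear_le[of "{..j}-{l}" z] z1 that card[OF that]
    unfolding L_def by auto
  have Lz: "poly (L l) (z i) = (if l = i then w l else 0)" if "l \<le> j" "i \<le> j" for l i
    using that unfolding L_def w_def by (auto simp: poly_prod)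
  have Qz: "poly Q (z i) = v i" if "i \<le> j" for i
  proof -
    have "poly Q (z i) = (\<Sum>l\<le>j. v l / w l * (if l = i then w l else 0))"
      unfolding Q_def poly_sum using Lz that by (intro sum.cong) auto
    also have "\<dots> = (\<Sum>l\<le>j. if l = i then v l else 0)"
      by (intro sum.cong) (use w0 in auto)
    finally show ?thesis using that by simp
  qed
  have "P = Q"
  proof (rule ccontr)
    assume ne: "P \<noteq> Q"
    have dP: "degree P \<le> j"
      unfolding P_def by (intro degree_sum_le) (auto intro: order_trans[OF degree_monom_le])
    have dQ: "degree Q \<le> j" unfolding Q_def using L by (intro degree_sum_le) auto
    have "z ` {..j} \<subseteq> {x. poly (P - Q) x = 0}" using Pz Qz by auto
    then have "card (z ` {..j}) \<le> card {x. poly (P - Q) x = 0}"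
      using ne by (intro card_mono poly_roots_finite) auto
    also have "\<dots> \<le> degree (P - Q)" using ne by (intro card_poly_roots_bound) auto
    also have "\<dots> \<le> j" using dP dQ by (rule degree_diff_le)
    finally show False using card_image[OF inj] by simp
  qed
  have ck: "c k = (\<Sum>l\<le>j. v l / w l * coeff (L l) k)" if "k \<le> j" for k
  proof -
    have "coeff P k = c k" using that by (simp add: P_def coeff_sum)
    then show ?thesis unfolding \<open>P = Q\<close> Q_def by (simp add: coeff_sum)
  qed
  have "(\<Sum>k\<le>j. cmod (c k)) \<le> (\<Sum>k\<le>j. \<Sum>l\<le>j. cmod (v l) / cmod (w l) * cmod (coeff (L l) k))"
  proof (rule sum_mono)
    fix k assume "k \<in> {..j}"
    then show "cmod (c k) \<le> (\<Sum>l\<le>j. cmod (v l) / cmod (w l) * cmod (coeff (L l) k))"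
      using ck[of k] norm_sum[of "\<lambda>l. v l / w l * coeff (L l) k" "{..j}"]
      by (simp add: norm_mult norm_divide)
  qed
  also have "\<dots> = (\<Sum>l\<le>j. cmod (v l) / cmod (w l) * (\<Sum>k\<le>j. cmod (coeff (L l) k)))"
    unfolding sum_distrib_left by (rule sum.swap)
  also have "\<dots> \<le> (\<Sum>l\<le>j. cmod (v l) / cmod (w l) * 2 ^ j)"
    by (intro sum_mono mult_left_mono L) auto
  finally show ?thesis unfolding v_def w_def by (simp add: prod_norm)
qed

text \<open>Gaussian elimination: an unknown p with nonzero coefficient in equation e is eliminated
  from the others, and back substitution gives its value. It later supplies a step function
  orthogonal to finitely many eigenfunctions.\<close>

lemma homogeneous_system_nontrivial:
  fixes a :: "'e \<Rightarrow> 'k \<Rightarrow> 'a::field"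
  assumes "finite E" "finite A" "card E < card A"
  shows "\<exists>c. (\<exists>k\<in>A. c k \<noteq> 0) \<and> (\<forall>i\<in>E. (\<Sum>k\<in>A. c k * a i k) = 0)"
  using assms
proof (induction E arbitrary: A a)
  case empty
  then have "A \<noteq> {}" by auto
  then show ?case by (auto intro!: exI[of _ "\<lambda>_. 1"])
next
  case (insert e E)
  show ?case
  proof (cases "\<forall>k\<in>A. a e k = 0")
    case True
    have "card E < card A" using insert.hyps insert.prems by simp
    from insert.IH[OF insert.prems(1) this, of a] obtain c
      where c: "\<exists>k\<in>A. c k \<noteq> 0" "\<forall>i\<in>E. (\<Sum>k\<in>A. c k * a i k) = 0" by blast
    have "(\<Sum>k\<in>A. c k * a e k) = 0" using True by (intro sum.neutral) simp
    with c show ?thesis by blast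
  next
    case False
    then obtain p where p: "p \<in> A" "a e p \<noteq> 0" by blast
    define A' where "A' = A - {p}"
    have "finite A'" "card E < card A'" using insert.hyps insert.prems p by (simp_all add: A'_def)
    from insert.IH[OF this, of "\<lambda>i k. a i k - a e k * a i p / a e p"]
    obtain c where c: "\<exists>k\<in>A'. c k \<noteq> 0" "\<And>i. i \<in> E \<Longrightarrow> (\<Sum>k\<in>A'. c k * (a i k - a e k * a i p / a e p)) = 0"
      by blast
    define s where "s = (\<Sum>k\<in>A'. c k * a e k)"
    define d where "d = c(p := - s / a e p)"
    have split: "(\<Sum>k\<in>A. d k * a i k) = (\<Sum>k\<in>A'. c k * a i k) - s / a e p * a i p" for i
    proof -
      have "(\<Sum>k\<in>A. d k * a i k) = d p * a i p + (\<Sum>k\<in>A'. d k * a i k)"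
        unfolding A'_def using p insert.prems by (intro sum.remove) auto
      also have "(\<Sum>k\<in>A'. d k * a i k) = (\<Sum>k\<in>A'. c k * a i k)"
        by (intro sum.cong) (auto simp: d_def A'_def)
      finally show ?thesis by (simp add: d_def)
    qed
    have "(\<Sum>k\<in>A. d k * a e k) = 0" using p unfolding split by (simp add: s_def)
    moreover have "(\<Sum>k\<in>A. d k * a i k) = 0" if "i \<in> E" for i
    proof -
      have "(\<Sum>k\<in>A'. c k * (a i k - a e k * a i p / a e p)) = (\<Sum>k\<in>A'. c k * a i k) - s * (a i p / a e p)"
        unfolding s_def by (simp add: right_diff_distrib sum_subtractf sum_distrib_right sum_divide_distrib mult.assoc)
      then show ?thesis using c(2)[OF that] unfolding split by simp
    qed
    moreover have "\<exists>k\<in>A. d k \<noteq> 0" using c(1) by (auto simp: d_def A'_def)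
    ultimately show ?thesis by blast
  qed
qed

text \<open>Folds the interval onto its first piece, so that an inequality for the values of F at
  equidistant points, valid for every offset t, can be integrated over t.\<close>

lemma integral_split_equidistant:
  fixes F :: "real \<Rightarrow> real"
  assumes F: "continuous_on UNIV F" and d: "d \<ge> 0"
  shows "integral {a..a + real n * d} F = integral {0..d} (\<lambda>t. \<Sum>l<n. F (a + real l * d + t))"
proof -
  have cF: "continuous_on S F" for S using F continuous_on_subset by blast
  have "integral {a..a + real n * d} F = (\<Sum>l<n. integral {0..d} (\<lambda>t. F (a + real l * d + t)))"
  proof (induction n)
    case (Suc n)
    have "integral {a..a + real (Suc n) * d} F
        = integral {a..a + real n * d} F + integral {a + real n * d..a + real (Suc n) * d} F"
      using d by (intro Henstock_Kurzweil_Integration.integral_combine[symmetric] integrable_continuous_real cF)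
        (auto simp: algebra_simps)
    also have "integral {a + real n * d..a + real (Suc n) * d} F
        = integral {0..d} (\<lambda>t. F (t + (a + real n * d)))"
      using integral_shift_real_ivl[of "a + real n * d" "a + real n * d" "a + real (Suc n) * d" F]
      by (simp add: algebra_simps)
    finally show ?case using Suc by (simp add: algebra_simps)
  qed simp
  also have "\<dots> = integral {0..d} (\<lambda>t. \<Sum>l<n. F (a + real l * d + t))"
    by (intro integral_sum[symmetric] integrable_continuous_real continuous_on_compose2[OF cF] continuous_intros) auto
  finally show ?thesis .
qed

lemma prod_abs_diff_eq_fact:
  assumes "l \<le> j"
  shows "(\<Prod>m\<in>{..j}-{l}. \<bar>real l - real m\<bar>) = fact l * fact (j - l)"
proof -
  have "{..j} - {l} = {..<l} \<union> {l<..j}" using assms by auto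
  then have "(\<Prod>m\<in>{..j}-{l}. \<bar>real l - real m\<bar>)
      = (\<Prod>m<l. \<bar>real l - real m\<bar>) * (\<Prod>m\<in>{l<..j}. \<bar>real l - real m\<bar>)"
    by (simp add: prod.union_disjoint Int_def)
  also have "(\<Prod>m<l. \<bar>real l - real m\<bar>) = (\<Prod>i\<in>{1..l}. real i)"
    by (rule prod.reindex_bij_witness[of _ "\<lambda>i. l - i" "\<lambda>m. l - m"]) auto
  also have "(\<Prod>m\<in>{l<..j}. \<bar>real l - real m\<bar>) = (\<Prod>i\<in>{1..j - l}. real i)"
    by (rule prod.reindex_bij_witness[of _ "\<lambda>i. l + i" "\<lambda>m. m - l"]) auto
  finally show ?thesis by (simp add: fact_prod)
qed

lemma cos_ge_half:
  fixes x :: real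
  assumes "\<bar>x\<bar> \<le> 1"
  shows "1 / 2 \<le> cos x"
proof -
  have "cos (pi / 3) \<le> cos \<bar>x\<bar>"
    using assms pi_gt3 by (intro cos_monotone_0_pi_le) auto
  then show ?thesis by (simp add: cos_60)
qed

lemma abs_sin_ge_half:
  fixes x :: real
  assumes "\<bar>x\<bar> \<le> 1"
  shows "\<bar>x\<bar> / 2 \<le> \<bar>sin x\<bar>"
proof -
  have *: "y / 2 \<le> sin y" if "0 \<le> y" "y \<le> 1" for y :: real
  proof -
    have "sin 0 - 0 / 2 \<le> sin y - y / 2"
    proof (rule DERIV_nonneg_imp_nondecreasing[OF that(1)])
      fix x assume x: "0 \<le> x" "x \<le> y"
      have "0 \<le> cos x - 1/2" using cos_ge_half[of x] x that by simp
      then show "\<exists>y. ((\<lambda>a. sin a - a / 2) has_real_derivative y) (at x) \<and> 0 \<le> y"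
        by (intro exI[of _ "cos x - 1/2"]) (auto intro!: derivative_eq_intros)
    qed
    then show ?thesis by simp
  qed
  show ?thesis using *[of "\<bar>x\<bar>"] assms by (cases "x \<ge> 0") auto
qed

lemma norm_cis_diff: "cmod (cis a - cis b) = 2 * \<bar>sin ((a - b) / 2)\<bar>"
proof -
  have "(cmod (cis a - cis b))\<^sup>2 = (cos a - cos b)\<^sup>2 + (sin a - sin b)\<^sup>2"
    by (simp add: cmod_power2)
  also have "\<dots> = (cos a)\<^sup>2 + (sin a)\<^sup>2 + ((cos b)\<^sup>2 + (sin b)\<^sup>2) - 2 * (cos a * cos b + sin a * sin b)"
    by (simp add: power2_eq_square algebra_simps)
  also have "\<dots> = 2 - 2 * cos (a - b)"
    by (simp only: sin_cos_squared_add2 cos_diff)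
  also have "cos (a - b) = cos (2 * ((a - b) / 2))" by (rule arg_cong[where f = cos]) simp
  also have "2 - 2 * cos (2 * ((a - b) / 2)) = 4 * (sin ((a - b) / 2))\<^sup>2"
    by (simp only: cos_double_sin) simp
  also have "\<dots> = (2 * \<bar>sin ((a - b) / 2)\<bar>)\<^sup>2"
    by (simp add: power_mult_distrib)
  finally show ?thesis by (rule power2_eq_imp_eq) auto
qed

lemma sum_binomial_sq_le: "(\<Sum>l\<le>j. (real (j choose l))\<^sup>2) \<le> 4 ^ j"
proof -
  have "real (j choose l) \<le> 2 ^ j" for l
    using of_nat_mono[OF binomial_le_pow2[of j l], where 'a = real] by simp
  then have "(\<Sum>l\<le>j. (real (j choose l))\<^sup>2) \<le> (\<Sum>l\<le>j. real (j choose l) * 2 ^ j)"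
    unfolding power2_eq_square by (intro sum_mono mult_left_mono) auto
  also have "\<dots> = real (\<Sum>l\<le>j. j choose l) * 2 ^ j"
    unfolding of_nat_sum sum_distrib_right ..
  also have "\<dots> = 2 ^ j * 2 ^ j" by (simp only: choose_row_sum) simp
  also have "\<dots> = 4 ^ j" by (simp flip: power_mult_distrib)
  finally show ?thesis .
qed

text \<open>All node angles lie on an arc where the sine of the half angle is bounded below
  linearly, so chords are at least 2/(j+1)^2 times the index distance. The node products are then
  controlled by l! (j-l)!, that is j! over a binomial coefficient, and the squared binomials sum to
  at most 4^j, which turns J^j into (2J)^j. In the application the spacing 4/(j+1)^2 is h^2 with h =
  2/(j+1), the pulse width times the frequency step.\<close>

lemma sum_norm_sq_le_values_equidistant:
  fixes c :: "nat \<Rightarrow> complex" and a :: real and j :: nat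
  defines "z \<equiv> \<lambda>l. cis (a + real l * 4 / (real (Suc j))\<^sup>2)"
  shows "(\<Sum>k\<le>j. (cmod (c k))\<^sup>2) \<le>
     ((2 * (real (Suc j))\<^sup>2) ^ j / fact j)\<^sup>2 * (\<Sum>l\<le>j. (cmod (\<Sum>k\<le>j. c k * z l ^ k))\<^sup>2)"
proof -
  define J where "J = (real (Suc j))\<^sup>2"
  define v where "v l = cmod (\<Sum>k\<le>j. c k * z l ^ k)" for l
  have J0: "J > 0" by (simp add: J_def)
  have jJ: "2 * real j \<le> J"
    unfolding J_def by (simp add: power2_eq_square algebra_simps)
  have dist: "2 / J * \<bar>real l - real m\<bar> \<le> cmod (z l - z m)" if "l \<le> j" "m \<le> j" for l m
  proof -
    have "cmod (z l - z m) = 2 * \<bar>sin (2 * (real l - real m) / J)\<bar>"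
      unfolding z_def norm_cis_diff J_def[symmetric] by (simp add: field_simps diff_divide_distrib)
    moreover have "\<bar>2 * (real l - real m) / J\<bar> \<le> 1"
      using that jJ J0 by (auto simp: abs_le_iff field_simps)
    from abs_sin_ge_half[OF this] have "\<bar>2 * (real l - real m) / J\<bar> / 2 \<le> \<bar>sin (2 * (real l - real m) / J)\<bar>" .
    moreover have "2 / J * \<bar>real l - real m\<bar> = 2 * (\<bar>2 * (real l - real m) / J\<bar> / 2)"
      unfolding abs_mult abs_divide using J0 by simp
    ultimately show ?thesis by linarith
  qed
  have inj: "inj_on z {..j}"
  proof (rule inj_onI)
    fix l m assume "l \<in> {..j}" "m \<in> {..j}" "z l = z m"
    with dist[of l m] have "2 / J * \<bar>real l - real m\<bar> \<le> 0" by simp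
    moreover have "0 < 2 / J * \<bar>real l - real m\<bar>" if "l \<noteq> m" using that J0 by simp
    ultimately show "l = m" by (metis not_le)
  qed
  have pr: "2 ^ j / (\<Prod>m\<in>{..j}-{l}. cmod (z l - z m)) \<le> J ^ j / fact j * real (j choose l)" if l: "l \<le> j" for l
  proof -
    have "(2 / J) ^ j * (fact l * fact (j - l)) = (\<Prod>m\<in>{..j}-{l}. 2 / J * \<bar>real l - real m\<bar>)"
      unfolding prod.distrib prod_abs_diff_eq_fact[OF l] using l by simp
    also have "\<dots> \<le> (\<Prod>m\<in>{..j}-{l}. cmod (z l - z m))"
      by (intro prod_mono conjI dist) (use l J0 in auto)
    finally have le: "(2 / J) ^ j * (fact l * fact (j - l)) \<le> (\<Prod>m\<in>{..j}-{l}. cmod (z l - z m))" .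
    have "0 < (2 / J) ^ j * (fact l * fact (j - l) :: real)" using J0 by simp
    from frac_le[OF _ order_refl this le]
    have "2 ^ j / (\<Prod>m\<in>{..j}-{l}. cmod (z l - z m)) \<le> 2 ^ j / ((2 / J) ^ j * (fact l * fact (j - l)))"
      by simp
    also have "\<dots> = J ^ j / fact j * real (j choose l)"
      using J0 l by (simp add: binomial_fact power_divide)
    finally show ?thesis .
  qed
  have "(\<Sum>k\<le>j. cmod (c k)) \<le> (\<Sum>l\<le>j. v l * (2 ^ j / (\<Prod>m\<in>{..j}-{l}. cmod (z l - z m))))"
    unfolding v_def using sum_norm_coeff_le_values[of j z c] inj by (simp add: z_def)
  also have "\<dots> \<le> (\<Sum>l\<le>j. v l * (J ^ j / fact j * real (j choose l)))"
    by (intro sum_mono mult_left_mono pr) (auto simp: v_def)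
  also have "\<dots> = J ^ j / fact j * (\<Sum>l\<le>j. v l * real (j choose l))"
    by (simp add: sum_distrib_left algebra_simps)
  finally have 1: "(\<Sum>k\<le>j. cmod (c k)) \<le> J ^ j / fact j * (\<Sum>l\<le>j. v l * real (j choose l))" .
  have "(\<Sum>k\<le>j. (cmod (c k))\<^sup>2) \<le> (\<Sum>k\<le>j. cmod (c k))\<^sup>2"
    unfolding power2_eq_square sum_distrib_right
    by (intro sum_mono mult_left_mono member_le_sum) auto
  also have "\<dots> \<le> (J ^ j / fact j * (\<Sum>l\<le>j. v l * real (j choose l)))\<^sup>2"
    by (intro power_mono 1 sum_nonneg) auto
  also have "\<dots> = (J ^ j / fact j)\<^sup>2 * (\<Sum>l\<le>j. v l * real (j choose l))\<^sup>2"
    by (rule power_mult_distrib)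
  also have "\<dots> \<le> (J ^ j / fact j)\<^sup>2 * ((\<Sum>l\<le>j. (v l)\<^sup>2) * (\<Sum>l\<le>j. (real (j choose l))\<^sup>2))"
    by (intro mult_left_mono Cauchy_Schwarz_ineq_sum) auto
  also have "\<dots> \<le> (J ^ j / fact j)\<^sup>2 * ((\<Sum>l\<le>j. (v l)\<^sup>2) * 4 ^ j)"
    by (intro mult_left_mono sum_binomial_sq_le sum_nonneg) auto
  also have "\<dots> = ((2 * J) ^ j / fact j)\<^sup>2 * (\<Sum>l\<le>j. (v l)\<^sup>2)"
  proof -
    have "(4::real) ^ j = (2 ^ j)\<^sup>2" by (simp add: power2_eq_square flip: power_mult_distrib)
    then show ?thesis unfolding power_mult_distrib[of 2 J j]
      by (simp add: power_divide power_mult_distrib)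
  qed
  finally show ?thesis unfolding v_def J_def .
qed

section \<open>The time-band limiting form\<close>

text \<open>The Fourier transform of f cut off to [-1,1]. Its energy on [-w,w] is 2 pi times the
  quadratic form of \<open>slepian_op w\<close> on [-1,1], so that eigenvalue questions become
  estimates of transforms.\<close>

definition band_transform :: "(real \<Rightarrow> real) \<Rightarrow> real \<Rightarrow> complex" where
  "band_transform f v = (LINT t:{-1..1}|lborel. complex_of_real (f t) * cis (- (v * t)))"

lemma norm_band_transform_le:
  assumes "set_integrable lborel {-1..1} f"
  shows "cmod (band_transform f v) \<le> (LINT t:{-1..1}|lborel. \<bar>f t\<bar>)"
proof -
  have "cmod (band_transform f v) \<le> (LINT t|lborel. cmod (indicator {-1..1} t *\<^sub>R (complex_of_real (f t) * cis (- (v * t)))))"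
    unfolding band_transform_def set_lebesgue_integral_def by (rule integral_norm_bound)
  also have "\<dots> = (LINT t:{-1..1}|lborel. \<bar>f t\<bar>)"
    unfolding set_lebesgue_integral_def by (intro Bochner_Integration.integral_cong) (auto simp: norm_mult indicator_def)
  finally show ?thesis .
qed

lemma cis_measurable [measurable]: "cis \<in> borel_measurable borel"
  by (intro borel_measurable_continuous_onI continuous_intros)

lemma band_transform_measurable [measurable]:
  assumes "set_integrable lborel {-1..1} f"
  shows "band_transform f \<in> borel_measurable borel"
proof -
  have [measurable]: "(\<lambda>t. indicator {-1..1} t *\<^sub>R f t) \<in> borel_measurable lborel"
    using assms unfolding set_integrable_def by auto
  have "band_transform f = (\<lambda>v. LINT t|lborel. complex_of_real (indicator {-1..1} t *\<^sub>R f t) * cis (- (v * t)))"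
    unfolding band_transform_def set_lebesgue_integral_def
    by (intro ext Bochner_Integration.integral_cong) (auto simp: indicator_def)
  also have "\<dots> \<in> borel_measurable borel" by measurable
  finally show ?thesis .
qed

lemma integrable_pair_mult_bounded:
  fixes f g :: "real \<Rightarrow> complex" and k :: "real \<times> real \<Rightarrow> complex"
  assumes f: "integrable lborel f" and g: "integrable lborel g"
    and k[measurable]: "k \<in> borel_measurable (lborel \<Otimes>\<^sub>M lborel)" and k1: "\<And>z. cmod (k z) \<le> 1"
  shows "integrable (lborel \<Otimes>\<^sub>M lborel) (\<lambda>(x,y). f x * g y * k (x,y))"
proof (rule Bochner_Integration.integrable_bound[where f = "\<lambda>(x,y). f x * g y"])
  have [measurable]: "f \<in> borel_measurable lborel" "g \<in> borel_measurable lborel" using f g by auto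
  show "integrable (lborel \<Otimes>\<^sub>M lborel) (\<lambda>(x,y). f x * g y)"
  proof (rule lborel_pair.Fubini_integrable)
    show "integrable lborel (\<lambda>x. LINT y|lborel. cmod (case (x, y) of (x, y) \<Rightarrow> f x * g y))"
      using f by (simp add: norm_mult)
    show "AE x in lborel. integrable lborel (\<lambda>y. case (x, y) of (x, y) \<Rightarrow> f x * g y)"
      using g by simp
  qed measurable
  show "(\<lambda>(x,y). f x * g y * k (x,y)) \<in> borel_measurable (lborel \<Otimes>\<^sub>M lborel)" by measurable
  show "AE x in lborel \<Otimes>\<^sub>M lborel. cmod (case x of (x, y) \<Rightarrow> f x * g y * k (x, y))
      \<le> cmod (case x of (x, y) \<Rightarrow> f x * g y)"
    using k1 by (auto simp: norm_mult mult_left_le)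
qed

lemma integrable_set_complex_of_real:
  assumes "set_integrable lborel {-1..1} f"
  shows "integrable lborel (\<lambda>t. indicator {-1..1} t *\<^sub>R complex_of_real (f t))"
proof -
  have "integrable lborel (\<lambda>t. complex_of_real (indicator {-1..1} t *\<^sub>R f t))"
    using assms unfolding set_integrable_def by (rule integrable_of_real)
  then show ?thesis by (simp add: scaleR_conv_of_real)
qed

lemma integrable_indicator_interval: "integrable lborel (\<lambda>v. indicator {a..b::real} v *\<^sub>R (c::'b::euclidean_space))"
  by (intro integrable_scaleR_left integrable_real_indicator) (auto simp: emeasure_lborel_Icc_eq)

lemma band_integral_cis:
  assumes "w \<ge> 0" "u \<noteq> 0"
  shows "(LINT v:{-w..w}|lborel. cis (v * u)) = complex_of_real (2 * sin (w * u) / u)"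
proof -
  have "((\<lambda>v. cis (v * u)) has_integral (cis (w * u) / (\<i> * u) - cis (- w * u) / (\<i> * u))) {-w..w}"
  proof (rule fundamental_theorem_of_calculus)
    fix x
    have "((\<lambda>v. exp (\<i> * of_real u * v) / (\<i> * u)) has_field_derivative exp (\<i> * of_real u * of_real x)) (at (of_real x))"
      using assms by (auto intro!: derivative_eq_intros)
    then have "((\<lambda>v. exp (\<i> * of_real u * of_real v) / (\<i> * u)) has_vector_derivative exp (\<i> * of_real u * of_real x)) (at x within {-w..w})"
      by (rule has_vector_derivative_real_field[THEN has_vector_derivative_at_within])
    then show "((\<lambda>v. cis (v * u) / (\<i> * u)) has_vector_derivative cis (x * u)) (at x within {-w..w})"
      by (simp add: cis_conv_exp mult_ac)
  qed (use assms in auto)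
  moreover have "set_integrable lborel {-w..w} (\<lambda>v. cis (v * u))"
    by (intro borel_integrable_atLeastAtMost') (intro continuous_intros)
  ultimately have "(LINT v:{-w..w}|lborel. cis (v * u)) = (cis (w * u) / (\<i> * u) - cis (- w * u) / (\<i> * u))"
    using set_borel_integral_eq_integral(2) integral_unique by metis
  also have "\<dots> = complex_of_real (2 * sin (w * u) / u)"
    using assms by (simp add: cis.ctr complex_eq_iff Re_divide Im_divide power2_eq_square)
  finally show ?thesis .
qed

text \<open>The kernel is the inverse Fourier transform of the indicator of the band. Writing it as
  an integral of cis (v (x - t)) over v and exchanging the integrals exposes the transform of
  f.\<close>

lemma slepian_op_eq_band_integral:
  assumes f: "set_integrable lborel {-1..1} f" and w: "w \<ge> 0"
  shows "slepian_op w (\<lambda>t. complex_of_real (f t)) x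
     = complex_of_real (1 / (2 * pi)) * (LINT v:{-w..w}|lborel. band_transform f v * cis (v * x))"
proof -
  define F where "F t = indicator {-1..1} t *\<^sub>R complex_of_real (f t)" for t :: real
  define W where "W v = indicator {-w..w} v *\<^sub>R (1::complex)" for v :: real
  have iF: "integrable lborel F" unfolding F_def by (rule integrable_set_complex_of_real[OF f])
  have iW: "integrable lborel W" unfolding W_def by (rule integrable_indicator_interval)
  have int: "integrable (lborel \<Otimes>\<^sub>M lborel) (\<lambda>(t,v). F t * W v * cis (v * (x - t)))"
    using integrable_pair_mult_bounded[OF iF iW, of "\<lambda>(t,v). cis (v * (x - t))"] by (auto simp: split_beta)
  have "slepian_op w (\<lambda>t. complex_of_real (f t)) x
      = (LINT t|lborel. F t * complex_of_real (sin (w * (x - t)) / (pi * (x - t))))"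
    unfolding slepian_op_def set_lebesgue_integral_def F_def by (simp only: mult_scaleR_left)
  also have "\<dots> = (LINT t|lborel. F t * (complex_of_real (1 / (2*pi)) * (LINT v|lborel. W v * cis (v * (x - t)))))"
  proof (rule integral_cong_AE)
    have [measurable]: "F \<in> borel_measurable lborel" "W \<in> borel_measurable lborel" using iF iW by auto
    show "(\<lambda>t. F t * complex_of_real (sin (w * (x - t)) / (pi * (x - t)))) \<in> borel_measurable lborel" by measurable
    show "(\<lambda>t. F t * (complex_of_real (1 / (2*pi)) * (LINT v|lborel. W v * cis (v * (x - t))))) \<in> borel_measurable lborel"
      by measurable
    \<comment> \<open>At t = x the division makes the kernel 0, while the band integral gives w /
      pi; the point is a null set.\<close>
    have "AE t in lborel. t \<noteq> x" by (rule AE_lborel_singleton)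
    then show "AE t in lborel. F t * complex_of_real (sin (w * (x - t)) / (pi * (x - t)))
        = F t * (complex_of_real (1 / (2*pi)) * (LINT v|lborel. W v * cis (v * (x - t))))"
    proof (rule AE_mp, intro AE_I2 impI)
      fix t assume "t \<noteq> x"
      then have "(LINT v|lborel. W v * cis (v * (x - t))) = complex_of_real (2 * sin (w * (x - t)) / (x - t))"
        using band_integral_cis[OF w, of "x - t"] unfolding W_def set_lebesgue_integral_def by simp
      then show "F t * complex_of_real (sin (w * (x - t)) / (pi * (x - t)))
        = F t * (complex_of_real (1 / (2*pi)) * (LINT v|lborel. W v * cis (v * (x - t))))"
        by (simp add: field_simps)
    qed
  qed
  also have "\<dots> = complex_of_real (1 / (2*pi)) * (LINT t|lborel. (LINT v|lborel. F t * W v * cis (v * (x - t))))"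
    by (simp add: mult.assoc[symmetric] mult.commute[of _ "1 / (2 * _)"] flip: integral_mult_right_zero)
  also have "(LINT t|lborel. (LINT v|lborel. F t * W v * cis (v * (x - t))))
      = (LINT v|lborel. (LINT t|lborel. F t * W v * cis (v * (x - t))))"
    using lborel_pair.Fubini_integral[OF int] by simp
  also have "\<dots> = (LINT v|lborel. W v * ((LINT t|lborel. F t * cis (- (v * t))) * cis (v * x)))"
  proof (rule Bochner_Integration.integral_cong[OF refl])
    fix v
    have "F t * W v * cis (v * (x - t)) = (W v * cis (v * x)) * (F t * cis (- (v * t)))" for t
    proof -
      have "cis (v * (x - t)) = cis (v * x) * cis (- (v * t))" by (simp add: cis_mult algebra_simps)
      then show ?thesis by simp
    qed
    then show "(LINT t|lborel. F t * W v * cis (v * (x - t))) = W v * ((LINT t|lborel. F t * cis (- (v * t))) * cis (v * x))"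
      by (simp only: integral_mult_right_zero) (simp only: mult_ac)
  qed
  also have "\<dots> = (LINT v:{-w..w}|lborel. band_transform f v * cis (v * x))"
    unfolding set_lebesgue_integral_def band_transform_def F_def W_def by simp
  finally show ?thesis .
qed

text \<open>A second exchange of integrals: cis (v x) integrated against the real function g is the
  conjugate of its transform at v. For f = g the right side is the band energy over 2 pi.\<close>

lemma inner_slepian_op:
  assumes f: "set_integrable lborel {-1..1} f" and g: "set_integrable lborel {-1..1} g" and w: "w \<ge> 0"
  shows "(LINT x:{-1..1}|lborel. slepian_op w (\<lambda>t. complex_of_real (f t)) x * complex_of_real (g x))
     = complex_of_real (1 / (2 * pi)) * (LINT v:{-w..w}|lborel. band_transform f v * cnj (band_transform g v))"
proof -
  define G where "G t = indicator {-1..1} t *\<^sub>R complex_of_real (g t)" for t :: real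
  define W where "W v = indicator {-w..w} v *\<^sub>R band_transform f v" for v :: real
  have iG: "integrable lborel G" unfolding G_def by (rule integrable_set_complex_of_real[OF g])
  have iW: "integrable lborel W"
  proof (rule Bochner_Integration.integrable_bound[where f = "\<lambda>v. indicator {-w..w} v *\<^sub>R (LINT t:{-1..1}|lborel. \<bar>f t\<bar>)"])
    show "integrable lborel (\<lambda>v. indicator {-w..w} v *\<^sub>R (LINT t:{-1..1}|lborel. \<bar>f t\<bar>))"
      using integrable_indicator_interval .
    show "W \<in> borel_measurable lborel" using f unfolding W_def by measurable
    show "AE x in lborel. cmod (W x) \<le> norm (indicator {-w..w} x *\<^sub>R (LINT t:{-1..1}|lborel. \<bar>f t\<bar>))"
      using norm_band_transform_le[OF f] unfolding W_def
      by (auto simp: indicator_def intro: order_trans[OF _ abs_ge_self])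
  qed
  have int: "integrable (lborel \<Otimes>\<^sub>M lborel) (\<lambda>(x,v). G x * W v * cis (v * x))"
    using integrable_pair_mult_bounded[OF iG iW, of "\<lambda>(x,v). cis (v * x)"] by (auto simp: split_beta)
  have "(LINT x:{-1..1}|lborel. slepian_op w (\<lambda>t. complex_of_real (f t)) x * complex_of_real (g x))
     = (LINT x|lborel. complex_of_real (1 / (2 * pi)) * (LINT v|lborel. G x * W v * cis (v * x)))"
    unfolding slepian_op_eq_band_integral[OF f w] set_lebesgue_integral_def
  proof (rule Bochner_Integration.integral_cong[OF refl])
    fix x
    have "(LINT v|lborel. G x * W v * cis (v * x)) = G x * (LINT v|lborel. W v * cis (v * x))"
      by (simp add: mult.assoc)
    then show "indicator {-1..1} x *\<^sub>R (complex_of_real (1 / (2 * pi)) *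
          (LINT v|lborel. indicator {-w..w} v *\<^sub>R (band_transform f v * cis (v * x))) * complex_of_real (g x))
       = complex_of_real (1 / (2 * pi)) * (LINT v|lborel. G x * W v * cis (v * x))"
      by (simp add: G_def W_def)
  qed
  also have "\<dots> = complex_of_real (1 / (2 * pi)) * (LINT x|lborel. (LINT v|lborel. G x * W v * cis (v * x)))"
    by (rule integral_mult_right_zero)
  also have "(LINT x|lborel. (LINT v|lborel. G x * W v * cis (v * x)))
      = (LINT v|lborel. (LINT x|lborel. G x * W v * cis (v * x)))"
    using lborel_pair.Fubini_integral[OF int] by simp
  also have "\<dots> = (LINT v|lborel. W v * cnj (band_transform g v))"
  proof (rule Bochner_Integration.integral_cong[OF refl])
    fix v
    have "cnj (band_transform g v) = (LINT x|lborel. cnj (indicator {-1..1} x *\<^sub>R (complex_of_real (g x) * cis (- (v * x)))))"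
      unfolding band_transform_def set_lebesgue_integral_def by (rule Bochner_Integration.integral_cnj[symmetric])
    also have "\<dots> = (LINT x|lborel. G x * cis (v * x))"
      unfolding G_def by (intro Bochner_Integration.integral_cong) (auto simp: cis_cnj scaleR_conv_of_real)
    finally have "cnj (band_transform g v) = (LINT x|lborel. G x * cis (v * x))" .
    moreover have "G x * W v * cis (v * x) = W v * (G x * cis (v * x))" for x by simp
    ultimately show "(LINT x|lborel. G x * W v * cis (v * x)) = W v * cnj (band_transform g v)"
      by (simp only: integral_mult_right_zero)
  qed
  also have "\<dots> = (LINT v:{-w..w}|lborel. band_transform f v * cnj (band_transform g v))"
    unfolding set_lebesgue_integral_def W_def by simp
  finally show ?thesis .
qed

lemma set_integral_sum_fun:
  fixes f :: "'i \<Rightarrow> 'a \<Rightarrow> 'b::{banach, second_countable_topology}"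
  assumes "\<And>i. i \<in> S \<Longrightarrow> set_integrable M A (f i)"
  shows "set_integrable M A (\<lambda>x. \<Sum>i\<in>S. f i x)"
    and "(LINT x:A|M. (\<Sum>i\<in>S. f i x)) = (\<Sum>i\<in>S. LINT x:A|M. f i x)"
  using assms unfolding set_integrable_def set_lebesgue_integral_def
  by (auto simp: scaleR_sum_right)

section \<open>Square-integrable functions on the interval\<close>

definition sq_integrable_on_I :: "(real \<Rightarrow> real) \<Rightarrow> bool" where
  "sq_integrable_on_I f \<longleftrightarrow> f \<in> borel_measurable borel \<and> set_integrable lborel {-1..1} (\<lambda>x. (f x)\<^sup>2)"

lemma sq_integrable_on_I_mult:
  assumes "sq_integrable_on_I f" "sq_integrable_on_I g"
  shows "set_integrable lborel {-1..1} (\<lambda>x. f x * g x)"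
proof (rule set_integrable_bound[where f = "\<lambda>x. (f x)\<^sup>2 + (g x)\<^sup>2"])
  have [measurable]: "f \<in> borel_measurable borel" "g \<in> borel_measurable borel"
    using assms by (auto simp: sq_integrable_on_I_def)
  show "set_integrable lborel {-1..1} (\<lambda>x. (f x)\<^sup>2 + (g x)\<^sup>2)"
    using assms by (auto simp: sq_integrable_on_I_def)
  show "set_borel_measurable lborel {-1..1} (\<lambda>x. f x * g x)"
    unfolding set_borel_measurable_def by measurable
  have "norm (f x * g x) \<le> norm ((f x)\<^sup>2 + (g x)\<^sup>2)" for x
  proof -
    have "2 * (\<bar>f x\<bar> * \<bar>g x\<bar>) \<le> (f x)\<^sup>2 + (g x)\<^sup>2"
      using sum_squares_bound[of "\<bar>f x\<bar>" "\<bar>g x\<bar>"] by simp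
    moreover have "0 \<le> \<bar>f x\<bar> * \<bar>g x\<bar>" by (intro mult_nonneg_nonneg) auto
    ultimately have "\<bar>f x\<bar> * \<bar>g x\<bar> \<le> (f x)\<^sup>2 + (g x)\<^sup>2" by linarith
    then show ?thesis by (simp add: abs_mult)
  qed
  then show "AE x in lborel. x \<in> {-1..1} \<longrightarrow> norm (f x * g x) \<le> norm ((f x)\<^sup>2 + (g x)\<^sup>2)" by simp
qed

lemma set_integrable_const_I: "set_integrable lborel {a..b::real} (\<lambda>x. c::'b::euclidean_space)"
  unfolding set_integrable_def by (rule integrable_indicator_interval)

lemma sq_integrable_on_I_const: "sq_integrable_on_I (\<lambda>x. c)"
  unfolding sq_integrable_on_I_def using set_integrable_const_I by auto

lemma sq_integrable_on_I_integrable: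
  "sq_integrable_on_I f \<Longrightarrow> set_integrable lborel {-1..1} f"
  using sq_integrable_on_I_mult[of f "\<lambda>x. 1"] sq_integrable_on_I_const[of 1] by simp

lemma sq_integrable_on_I_cmult:
  "sq_integrable_on_I f \<Longrightarrow> sq_integrable_on_I (\<lambda>x. c * f x)"
  by (auto simp: sq_integrable_on_I_def power_mult_distrib)

lemma sq_integrable_on_I_add:
  assumes "sq_integrable_on_I f" "sq_integrable_on_I g"
  shows "sq_integrable_on_I (\<lambda>x. f x + g x)"
proof -
  have "set_integrable lborel {-1..1} (\<lambda>x. ((f x)\<^sup>2 + (g x)\<^sup>2) + 2 * (f x * g x))"
    using assms sq_integrable_on_I_mult[OF assms] by (auto simp: sq_integrable_on_I_def)
  then show ?thesis using assms by (auto simp: sq_integrable_on_I_def power2_sum mult.assoc)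
qed

lemma sq_integrable_on_I_sum:
  "(\<And>i. i \<in> S \<Longrightarrow> sq_integrable_on_I (f i)) \<Longrightarrow> sq_integrable_on_I (\<lambda>x. \<Sum>i\<in>S. f i x)"
  by (induction S rule: infinite_finite_induct)
     (auto intro: sq_integrable_on_I_add sq_integrable_on_I_const)

lemma sq_integrable_on_I_diff:
  assumes "sq_integrable_on_I f" "sq_integrable_on_I g"
  shows "sq_integrable_on_I (\<lambda>x. f x - g x)"
  using sq_integrable_on_I_add[OF assms(1) sq_integrable_on_I_cmult[OF assms(2), of "-1"]] by simp

lemma integral_const_I: "(LINT x:{-1..1::real}|lborel. (c::real)) = 2 * c"
  using set_integral_const[of "{-1..1::real}" lborel c] by simp

text \<open>Nonnegativity of the integral of (|f| - a)^2, with a the mean of |f|; the factor 2 is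
  the length of the interval.\<close>

lemma integral_abs_sq_le:
  assumes "sq_integrable_on_I f"
  shows "(LINT x:{-1..1}|lborel. \<bar>f x\<bar>)\<^sup>2 \<le> 2 * (LINT x:{-1..1}|lborel. (f x)\<^sup>2)"
proof -
  define a where "a = (LINT x:{-1..1}|lborel. \<bar>f x\<bar>) / 2"
  have i: "set_integrable lborel {-1..1} (\<lambda>x. \<bar>f x\<bar>)" "set_integrable lborel {-1..1} (\<lambda>x. (f x)\<^sup>2)"
    using set_integrable_abs[OF sq_integrable_on_I_integrable[OF assms]] assms
    by (auto simp: sq_integrable_on_I_def)
  have "0 \<le> (LINT x:{-1..1}|lborel. (\<bar>f x\<bar> - a)\<^sup>2)"
    unfolding set_lebesgue_integral_def by (intro Bochner_Integration.integral_nonneg) (auto simp: indicator_def)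
  also have "\<dots> = (LINT x:{-1..1}|lborel. (f x)\<^sup>2 - (2 * a) * \<bar>f x\<bar> + a\<^sup>2)"
    by (simp add: power2_diff algebra_simps)
  also have "\<dots> = (LINT x:{-1..1}|lborel. (f x)\<^sup>2) - (2 * a) * (2 * a) + 2 * a\<^sup>2"
    using i set_integrable_const_I[of "-1" 1 "a\<^sup>2"]
    by (simp add: set_integral_add set_integral_diff integral_const_I) (simp add: a_def)
  finally show ?thesis by (simp add: a_def power2_eq_square)
qed

lemma band_transform_add:
  assumes "set_integrable lborel {-1..1} f" "set_integrable lborel {-1..1} g"
  shows "band_transform (\<lambda>x. a * f x + b * g x) v = a * band_transform f v + b * band_transform g v"
proof -
  have *: "set_integrable lborel {-1..1} (\<lambda>t. complex_of_real (h t) * cis (- (v * t)))"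
    if "set_integrable lborel {-1..1} h" for h
  proof (rule set_integrable_bound[OF that])
    have [measurable]: "(\<lambda>x. indicator {-1..1} x *\<^sub>R h x) \<in> borel_measurable lborel"
      using that unfolding set_integrable_def by auto
    have "(\<lambda>x. complex_of_real (indicator {-1..1} x *\<^sub>R h x) * cis (- (v * x))) \<in> borel_measurable lborel"
      by measurable
    then show "set_borel_measurable lborel {-1..1} (\<lambda>t. complex_of_real (h t) * cis (- (v * t)))"
      unfolding set_borel_measurable_def by (simp add: scaleR_conv_of_real mult.assoc)
  qed (auto simp: norm_mult)
  have "band_transform (\<lambda>x. a * f x + b * g x) v = (LINT t:{-1..1}|lborel.
      complex_of_real a * (complex_of_real (f t) * cis (- (v * t))) + complex_of_real b * (complex_of_real (g t) * cis (- (v * t))))"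
    unfolding band_transform_def by (simp add: algebra_simps)
  also have "\<dots> = a * band_transform f v + b * band_transform g v"
    unfolding band_transform_def using *[OF assms(1)] *[OF assms(2)]
    by (subst set_integral_add) auto
  finally show ?thesis .
qed

lemma band_transform_sum:
  assumes "finite S" "\<And>i. i \<in> S \<Longrightarrow> sq_integrable_on_I (f i)"
  shows "band_transform (\<lambda>x. \<Sum>i\<in>S. c i * f i x) v = (\<Sum>i\<in>S. complex_of_real (c i) * band_transform (f i) v)"
  using assms
proof (induction S)
  case empty
  then show ?case by (simp add: band_transform_def set_lebesgue_integral_def)
next
  case (insert i S)
  have s: "sq_integrable_on_I (\<lambda>x. \<Sum>i\<in>S. c i * f i x)"
    using insert by (intro sq_integrable_on_I_sum sq_integrable_on_I_cmult) auto
  show ?case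
    using insert band_transform_add[of "f i" "\<lambda>x. \<Sum>i\<in>S. c i * f i x" "c i" 1 v]
      sq_integrable_on_I_integrable[OF s] sq_integrable_on_I_integrable[of "f i"] by simp
qed

lemma set_integrable_band_transform_mult:
  assumes f: "set_integrable lborel {-1..1} f" and g: "set_integrable lborel {-1..1} g"
  shows "set_integrable lborel {-w..w} (\<lambda>v. band_transform f v * cnj (band_transform g v))"
proof (rule set_integrable_bound)
  show "set_integrable lborel {-w..w} (\<lambda>v. (LINT t:{-1..1}|lborel. \<bar>f t\<bar>) * (LINT t:{-1..1}|lborel. \<bar>g t\<bar>))"
    by (rule set_integrable_const_I)
  have [measurable]: "band_transform f \<in> borel_measurable borel" "band_transform g \<in> borel_measurable borel"
    using f g by measurable
  have [measurable]: "(\<lambda>v. cnj (band_transform g v)) \<in> borel_measurable borel"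
    by (rule borel_measurable_continuous_on[OF continuous_on_cnj]) auto
  show "set_borel_measurable lborel {-w..w} (\<lambda>v. band_transform f v * cnj (band_transform g v))"
    unfolding set_borel_measurable_def by measurable
  have "0 \<le> (LINT t:{-1..1}|lborel. \<bar>f t\<bar>)" for f :: "real \<Rightarrow> real"
    unfolding set_lebesgue_integral_def by (intro Bochner_Integration.integral_nonneg) auto
  then show "AE v in lborel. v \<in> {-w..w} \<longrightarrow> norm (band_transform f v * cnj (band_transform g v))
    \<le> norm ((LINT t:{-1..1}|lborel. \<bar>f t\<bar>) * (LINT t:{-1..1}|lborel. \<bar>g t\<bar>))"
    using norm_band_transform_le[OF f] norm_band_transform_le[OF g]
    by (auto simp: norm_mult abs_mult intro!: mult_mono)
qed

lemma set_integrable_band_transform_sq: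
  assumes f: "set_integrable lborel {-1..1} f"
  shows "set_integrable lborel {-w..w} (\<lambda>v. (cmod (band_transform f v))\<^sup>2)"
proof -
  have "set_integrable lborel {-w..w} (\<lambda>v. Re (band_transform f v * cnj (band_transform f v)))"
    using integrable_Re[OF set_integrable_band_transform_mult[OF f f, unfolded set_integrable_def]]
    unfolding set_integrable_def by simp
  moreover have "Re (z * cnj z) = (cmod z)\<^sup>2" for z
    by (simp only: complex_norm_square[symmetric] Re_complex_of_real)
  ultimately show ?thesis by (simp only:)
qed

section \<open>Eigenvalues and sup norms of the prolate functions\<close>

text \<open>Young's inequality with a free weight e: the main part keeps a factor close to 1, and
  the large factor falls on a remainder that is sent to 0.\<close>

lemma cmod_add_sq_le:
  assumes "e > 0"
  shows "(cmod (a + b))\<^sup>2 \<le> (1 + e) * (cmod a)\<^sup>2 + (1 + 1/e) * (cmod b)\<^sup>2"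
proof -
  have "(cmod (a + b))\<^sup>2 \<le> (cmod a + cmod b)\<^sup>2"
    by (intro power_mono norm_triangle_ineq) auto
  also have "\<dots> \<le> (1 + e) * (cmod a)\<^sup>2 + (1 + 1/e) * (cmod b)\<^sup>2"
  proof -
    have "0 \<le> (e * cmod a - cmod b)\<^sup>2 / e" using assms by simp
    also have "\<dots> = e * (cmod a)\<^sup>2 - 2 * cmod a * cmod b + (cmod b)\<^sup>2 / e"
      using assms by (simp add: power2_eq_square field_simps)
    finally show ?thesis by (simp add: power2_eq_square algebra_simps)
  qed
  finally show ?thesis .
qed

context
  fixes w :: real and \<mu> :: "nat \<Rightarrow> real" and \<phi> :: "nat \<Rightarrow> real \<Rightarrow> real"
  assumes sb: "slepian_basis w \<mu> \<phi>" and w1: "w \<ge> 1"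
begin

lemma slepian_mu_pos: "0 < \<mu> j"
  and slepian_mu_antimono: "i \<le> j \<Longrightarrow> \<mu> j \<le> \<mu> i"
  and slepian_op_phi: "slepian_op w (\<lambda>t. complex_of_real (\<phi> j t)) x = complex_of_real (\<mu> j) * complex_of_real (\<phi> j x)"
  using sb unfolding slepian_basis_def slepian_eigenfunction_def
  by (auto simp: le_less)

lemma slepian_phi_sq_integrable: "sq_integrable_on_I (\<phi> j)"
proof -
  have "square_integrable (\<lambda>x. complex_of_real (\<phi> j x))"
    using sb unfolding slepian_basis_def slepian_eigenfunction_def PW_def by auto
  then have s: "(\<lambda>x. complex_of_real (\<phi> j x)) \<in> borel_measurable lborel" "integrable lborel (\<lambda>x. (\<phi> j x)\<^sup>2)"
    by (auto simp: square_integrable_def)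
  have "(\<lambda>x. Re (complex_of_real (\<phi> j x))) \<in> borel_measurable lborel"
    using s(1) by measurable
  moreover have "integrable lborel (\<lambda>x. indicator {-1..1} x *\<^sub>R (\<phi> j x)\<^sup>2)"
    by (intro integrable_mult_indicator s) auto
  ultimately show ?thesis unfolding sq_integrable_on_I_def set_integrable_def by simp
qed

lemma slepian_phi_orth: "(LINT x:{-1..1}|lborel. \<phi> i x * \<phi> j x) = (if i = j then 2 else 0)"
proof -
  have "(1/2) * (LINT x:{-1..1}|lborel. \<phi> i x * \<phi> j x) = (if i = j then 1 else 0)"
    using sb unfolding slepian_basis_def orthonormal_basis_u_def by blast
  then show ?thesis by (simp split: if_splits)
qed

text \<open>Double orthogonality: the transforms of the eigenfunctions are again orthogonal on the
  band. The value is 2 pi from \<open>inner_slepian_op\<close>, times the eigenvalue, times the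
  squared norm 2 on [-1,1].\<close>

lemma band_transform_phi_inner:
  "(LINT v:{-w..w}|lborel. band_transform (\<phi> i) v * cnj (band_transform (\<phi> j) v))
     = complex_of_real (if i = j then 4 * pi * \<mu> i else 0)"
proof -
  have i: "set_integrable lborel {-1..1} (\<phi> j)" for j
    using sq_integrable_on_I_integrable slepian_phi_sq_integrable by blast
  have "complex_of_real (1 / (2 * pi)) * (LINT v:{-w..w}|lborel. band_transform (\<phi> i) v * cnj (band_transform (\<phi> j) v))
     = (LINT x:{-1..1}|lborel. complex_of_real (\<mu> i * (\<phi> i x * \<phi> j x)))"
    using w1 by (subst inner_slepian_op[OF i i, symmetric]) (auto simp: slepian_op_phi mult.assoc)
  also have "\<dots> = complex_of_real (LINT x:{-1..1}|lborel. \<mu> i * (\<phi> i x * \<phi> j x))"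
    by (rule set_integral_complex_of_real)
  also have "\<dots> = complex_of_real (if i = j then 2 * \<mu> i else 0)"
    by (simp add: slepian_phi_orth)
  finally show ?thesis by (auto simp: field_simps split: if_splits)
qed

text \<open>One half of the min-max principle. On partial sums of the expansion of f the form is
  diagonal and only indices from j on occur, where the eigenvalues are at most
  \<open>\<mu> j\<close>; Bessel's inequality sums the coefficients. The form is continuous in mean
  square, which carries the bound over to f.\<close>

lemma band_energy_le:
  assumes f: "sq_integrable_on_I f" and orth: "\<And>i. i < j \<Longrightarrow> (LINT x:{-1..1}|lborel. f x * \<phi> i x) = 0"
  shows "(LINT v:{-w..w}|lborel. (cmod (band_transform f v))\<^sup>2)
     \<le> 2 * pi * \<mu> j * (LINT x:{-1..1}|lborel. (f x)\<^sup>2)"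
proof -
  define c where "c i = (1/2) * (LINT x:{-1..1}|lborel. f x * \<phi> i x)" for i
  define g where "g N x = (\<Sum>i<N. c i * \<phi> i x)" for N x
  define r where "r N x = f x - g N x" for N x
  define q where "q h = (LINT v:{-w..w}|lborel. (cmod (band_transform h v))\<^sup>2)" for h
  define T where "T = (LINT x:{-1..1}|lborel. (f x)\<^sup>2)"
  have c0: "c i = 0" if "i < j" for i using orth[OF that] by (simp add: c_def)
  have sg: "sq_integrable_on_I (g N)" for N
    unfolding g_def by (intro sq_integrable_on_I_sum sq_integrable_on_I_cmult slepian_phi_sq_integrable)
  have sr: "sq_integrable_on_I (r N)" for N
    unfolding r_def by (intro sq_integrable_on_I_diff f sg)
  have T0: "T \<ge> 0"
    unfolding T_def set_lebesgue_integral_def by (intro Bochner_Integration.integral_nonneg) auto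
  \<comment> \<open>Completeness of the basis is stated for complex functions, so f is embedded and
    the real residual is read off afterwards.\<close>
  have lim: "(\<lambda>N. LINT x:{-1..1}|lborel. (r N x)\<^sup>2) \<longlonglongrightarrow> 0"
  proof -
    have m: "set_borel_measurable lborel {-1..1} (\<lambda>x. complex_of_real (f x))"
    proof -
      have [measurable]: "f \<in> borel_measurable borel" using f by (simp add: sq_integrable_on_I_def)
      show ?thesis unfolding set_borel_measurable_def by measurable
    qed
    have ci: "complex_of_real (c i) = 1/2 * (LINT t:{-1..1}|lborel. complex_of_real (f t) * complex_of_real (\<phi> i t))" for i
      using set_integral_complex_of_real[where A = "{-1..1}" and M = lborel and f = "\<lambda>t. f t * \<phi> i t"] by (simp add: c_def)
    have "(\<lambda>N. LINT x:{-1..1}|lborel. (cmod (complex_of_real (f x) - (\<Sum>j<N.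
             (1/2) * (LINT t:{-1..1}|lborel. complex_of_real (f t) * complex_of_real (\<phi> j t))
               * complex_of_real (\<phi> j x))))\<^sup>2) \<longlonglongrightarrow> 0"
      using sb m f unfolding slepian_basis_def orthonormal_basis_u_def sq_integrable_on_I_def by auto
    moreover have "cmod (complex_of_real (f x) - (\<Sum>j<N. complex_of_real (c j) * complex_of_real (\<phi> j x))) = \<bar>r N x\<bar>" for N x
    proof -
      have "complex_of_real (f x) - (\<Sum>j<N. complex_of_real (c j) * complex_of_real (\<phi> j x)) = complex_of_real (r N x)"
        by (simp add: r_def g_def)
      then show ?thesis by (simp only: norm_of_real)
    qed
    ultimately show ?thesis by (simp only: ci[symmetric] power2_abs)
  qed
  have inner_g: "(LINT x:{-1..1}|lborel. f x * g N x) = 2 * (\<Sum>i<N. (c i)\<^sup>2)" for N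
  proof -
    have "(LINT x:{-1..1}|lborel. f x * g N x) = (LINT x:{-1..1}|lborel. (\<Sum>i<N. c i * (f x * \<phi> i x)))"
      by (simp add: g_def sum_distrib_left algebra_simps)
    also have "\<dots> = (\<Sum>i<N. LINT x:{-1..1}|lborel. c i * (f x * \<phi> i x))"
      by (intro set_integral_sum_fun set_integrable_mult_right sq_integrable_on_I_mult f slepian_phi_sq_integrable)
    also have "\<dots> = (\<Sum>i<N. 2 * (c i)\<^sup>2)"
      by (simp add: c_def power2_eq_square)
    finally show ?thesis by (simp add: sum_distrib_left)
  qed
  have inner_gg: "(LINT x:{-1..1}|lborel. (g N x)\<^sup>2) = 2 * (\<Sum>i<N. (c i)\<^sup>2)" for N
  proof -
    have "(LINT x:{-1..1}|lborel. (g N x)\<^sup>2) = (LINT x:{-1..1}|lborel. (\<Sum>i<N. \<Sum>k<N. c i * c k * (\<phi> i x * \<phi> k x)))"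
      by (simp add: g_def power2_eq_square sum_product algebra_simps)
    also have "\<dots> = (\<Sum>i<N. \<Sum>k<N. LINT x:{-1..1}|lborel. c i * c k * (\<phi> i x * \<phi> k x))"
      by (subst set_integral_sum_fun; intro sum.cong refl set_integral_sum_fun
            set_integrable_mult_right sq_integrable_on_I_mult slepian_phi_sq_integrable)
    also have "\<dots> = (\<Sum>i<N. 2 * (c i)\<^sup>2)"
      by (simp add: slepian_phi_orth power2_eq_square if_distrib mult.commute[of _ "2::real"] cong: if_cong)
    finally show ?thesis by (simp add: sum_distrib_left)
  qed
  have bessel: "2 * (\<Sum>i<N. (c i)\<^sup>2) \<le> T" for N
  proof -
    have "0 \<le> (LINT x:{-1..1}|lborel. (r N x)\<^sup>2)"
      unfolding set_lebesgue_integral_def by (intro Bochner_Integration.integral_nonneg) auto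
    also have "\<dots> = (LINT x:{-1..1}|lborel. ((f x)\<^sup>2 - 2 * (f x * g N x)) + (g N x)\<^sup>2)"
      by (simp add: r_def power2_diff algebra_simps)
    also have "\<dots> = T - 2 * (2 * (\<Sum>i<N. (c i)\<^sup>2)) + 2 * (\<Sum>i<N. (c i)\<^sup>2)"
      using f sg[of N] sq_integrable_on_I_mult[OF f sg[of N]]
      by (simp add: set_integral_add set_integral_diff sq_integrable_on_I_def inner_g inner_gg T_def)
    finally show ?thesis by simp
  qed
  have qg: "q (g N) \<le> 2 * pi * \<mu> j * T" for N
  proof -
    have i: "set_integrable lborel {-1..1} (\<phi> j)" for j
      using sq_integrable_on_I_integrable slepian_phi_sq_integrable by blast
    have "complex_of_real (q (g N)) = (LINT v:{-w..w}|lborel. complex_of_real ((cmod (band_transform (g N) v))\<^sup>2))"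
      unfolding q_def by (rule set_integral_complex_of_real[symmetric])
    also have "\<dots> = (LINT v:{-w..w}|lborel. (\<Sum>i<N. \<Sum>k<N. complex_of_real (c i * c k) *
        (band_transform (\<phi> i) v * cnj (band_transform (\<phi> k) v))))"
    proof -
      have "complex_of_real ((cmod (band_transform (g N) v))\<^sup>2) = (\<Sum>i<N. \<Sum>k<N. complex_of_real (c i * c k) *
        (band_transform (\<phi> i) v * cnj (band_transform (\<phi> k) v)))" for v
      proof -
        have "band_transform (g N) v = (\<Sum>i<N. complex_of_real (c i) * band_transform (\<phi> i) v)"
          unfolding g_def using slepian_phi_sq_integrable by (intro band_transform_sum) auto
        then show ?thesis unfolding complex_norm_square
          by (simp add: sum_product algebra_simps)
      qed
      then show ?thesis by simp
    qed
    also have "\<dots> = (\<Sum>i<N. \<Sum>k<N. LINT v:{-w..w}|lborel. complex_of_real (c i * c k) *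
        (band_transform (\<phi> i) v * cnj (band_transform (\<phi> k) v)))"
      by (subst set_integral_sum_fun; intro sum.cong refl set_integral_sum_fun
            set_integrable_mult_right set_integrable_band_transform_mult i)
    also have "\<dots> = (\<Sum>i<N. \<Sum>k<N. complex_of_real (c i * c k) * complex_of_real (if i = k then 4 * pi * \<mu> i else 0))"
      by (simp only: set_integral_mult_right band_transform_phi_inner)
    also have "\<dots> = complex_of_real (\<Sum>i<N. 4 * pi * (\<mu> i * (c i)\<^sup>2))"
    proof -
      have "(\<Sum>k<N. complex_of_real (c i * c k) * complex_of_real (if i = k then 4 * pi * \<mu> i else 0))
         = complex_of_real (4 * pi * (\<mu> i * (c i)\<^sup>2))" if "i < N" for i
      proof -
        have "(\<Sum>k<N. complex_of_real (c i * c k) * complex_of_real (if i = k then 4 * pi * \<mu> i else 0))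
          = (\<Sum>k<N. if i = k then complex_of_real (4 * pi * (\<mu> i * (c i)\<^sup>2)) else 0)"
          by (intro sum.cong) (auto simp: power2_eq_square)
        then show ?thesis using that by simp
      qed
      then show ?thesis unfolding of_real_sum by (intro sum.cong) auto
    qed
    finally have "q (g N) = (\<Sum>i<N. 4 * pi * (\<mu> i * (c i)\<^sup>2))" by (simp only: of_real_eq_iff)
    also have "\<dots> \<le> (\<Sum>i<N. 4 * pi * (\<mu> j * (c i)\<^sup>2))"
    proof (intro sum_mono mult_left_mono)
      fix i show "\<mu> i * (c i)\<^sup>2 \<le> \<mu> j * (c i)\<^sup>2"
        using c0[of i] slepian_mu_antimono[of j i] by (cases "i < j") (auto intro: mult_right_mono)
    qed auto
    also have "\<dots> = 2 * pi * \<mu> j * (2 * (\<Sum>i<N. (c i)\<^sup>2))"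
      by (simp add: sum_distrib_left algebra_simps)
    also have "\<dots> \<le> 2 * pi * \<mu> j * T"
      using bessel[of N] slepian_mu_pos[of j] by (intro mult_left_mono) auto
    finally show ?thesis .
  qed
  \<comment> \<open>A crude bound suffices for a residual that tends to 0: the squared transform is
    at most twice the integral of the square, and the band has length 2w.\<close>
  have qr: "q (r N) \<le> 4 * w * (LINT x:{-1..1}|lborel. (r N x)\<^sup>2)" for N
  proof -
    have "q (r N) \<le> (LINT v:{-w..w}|lborel. 2 * (LINT x:{-1..1}|lborel. (r N x)\<^sup>2))"
      unfolding q_def
    proof (rule set_integral_mono)
      fix v
      have "(cmod (band_transform (r N) v))\<^sup>2 \<le> (LINT t:{-1..1}|lborel. \<bar>r N t\<bar>)\<^sup>2"
        using norm_band_transform_le[OF sq_integrable_on_I_integrable[OF sr]] by (intro power_mono) auto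
      also have "\<dots> \<le> 2 * (LINT x:{-1..1}|lborel. (r N x)\<^sup>2)"
        by (rule integral_abs_sq_le[OF sr])
      finally show "(cmod (band_transform (r N) v))\<^sup>2 \<le> 2 * (LINT x:{-1..1}|lborel. (r N x)\<^sup>2)" .
    qed (auto intro!: set_integrable_band_transform_sq set_integrable_const_I sq_integrable_on_I_integrable sr)
    also have "\<dots> = 4 * w * (LINT x:{-1..1}|lborel. (r N x)\<^sup>2)"
      using w1 by (subst set_integral_const) auto
    finally show ?thesis .
  qed
  \<comment> \<open>For fixed e the residual disappears as N grows; e is sent to 0 only afterwards,
    which retains the exact factor 2 pi \<open>\<mu> j\<close>.\<close>
  have key: "q f \<le> (1 + e) * (2 * pi * \<mu> j * T)" if e: "e > 0" for e
  proof -
    have "q f \<le> (1 + e) * (2 * pi * \<mu> j * T) + (1 + 1/e) * (4 * w * (LINT x:{-1..1}|lborel. (r N x)\<^sup>2))" for N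
    proof -
      have ig: "set_integrable lborel {-1..1} (g N)" and ir: "set_integrable lborel {-1..1} (r N)"
        using sg sr sq_integrable_on_I_integrable by blast+
      have "band_transform f v = band_transform (g N) v + band_transform (r N) v" for v
        using band_transform_add[OF ig ir, of 1 1 v] by (simp add: r_def)
      then have "(cmod (band_transform f v))\<^sup>2 \<le> (1 + e) * (cmod (band_transform (g N) v))\<^sup>2
          + (1 + 1/e) * (cmod (band_transform (r N) v))\<^sup>2" for v
        using cmod_add_sq_le[OF e] by simp
      then have "q f \<le> (LINT v:{-w..w}|lborel. (1 + e) * (cmod (band_transform (g N) v))\<^sup>2
          + (1 + 1/e) * (cmod (band_transform (r N) v))\<^sup>2)"
        unfolding q_def
        by (intro set_integral_mono)
           (auto intro!: set_integrable_band_transform_sq ig ir sq_integrable_on_I_integrable f)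
      also have "\<dots> = (1 + e) * q (g N) + (1 + 1/e) * q (r N)"
        unfolding q_def
        by (subst set_integral_add) (auto intro!: set_integrable_band_transform_sq ig ir)
      also have "\<dots> \<le> (1 + e) * (2 * pi * \<mu> j * T) + (1 + 1/e) * (4 * w * (LINT x:{-1..1}|lborel. (r N x)\<^sup>2))"
        using e qg qr by (intro add_mono mult_left_mono) auto
      finally show ?thesis .
    qed
    moreover have "(\<lambda>N. (1 + e) * (2 * pi * \<mu> j * T) + (1 + 1/e) * (4 * w * (LINT x:{-1..1}|lborel. (r N x)\<^sup>2)))
       \<longlonglongrightarrow> (1 + e) * (2 * pi * \<mu> j * T) + (1 + 1/e) * (4 * w * 0)"
      by (intro tendsto_intros lim)
    ultimately show ?thesis
      using LIMSEQ_le_const by (metis (no_types, lifting) add.right_neutral mult_zero_right)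
  qed
  have "q f \<le> 2 * pi * \<mu> j * T"
  proof (rule tendsto_lowerbound)
    show "((\<lambda>e. (1 + e) * (2 * pi * \<mu> j * T)) \<longlongrightarrow> 2 * pi * \<mu> j * T) (at_right 0)"
      by (auto intro!: tendsto_eq_intros)
    show "\<forall>\<^sub>F e in at_right 0. q f \<le> (1 + e) * (2 * pi * \<mu> j * T)"
      using key by (auto simp: eventually_at_right_less intro: eventually_mono[OF eventually_at_right_less])
  qed auto
  then show ?thesis unfolding q_def T_def .
qed

end

section \<open>Step functions and the lower bound for the eigenvalues\<close>

lemma integral_cos_ge:
  fixes v h :: real
  assumes "\<bar>v\<bar> \<le> 1" "0 \<le> h" "h \<le> 2"
  shows "h / 2 \<le> (LINT s:{-h/2..h/2}|lborel. cos (v * s))"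
proof -
  have "h / 2 = (LINT s:{-h/2..h/2}|lborel. (1/2::real))"
    using assms by (subst set_integral_const) auto
  also have "\<dots> \<le> (LINT s:{-h/2..h/2}|lborel. cos (v * s))"
  proof (rule set_integral_mono)
    show "set_integrable lborel {-h/2..h/2} (\<lambda>s. cos (v * s))"
      by (intro borel_integrable_atLeastAtMost') (intro continuous_intros)
    fix s assume s: "s \<in> {-h/2..h/2}"
    have "\<bar>v * s\<bar> \<le> 1 * 1" unfolding abs_mult using s assms by (intro mult_mono) auto
    then show "1/2 \<le> cos (v * s)" using cos_ge_half[of "v * s"] by simp
  qed (rule set_integrable_const_I)
  finally show ?thesis .
qed

text \<open>Centring at the midpoint leaves a pulse transform that does not depend on a, so for
  pulses of equal width it factors out of a whole step function.\<close>

lemma integral_cis_Ico: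
  fixes a h v :: real
  assumes "h \<ge> 0"
  shows "(LINT t|lborel. complex_of_real (indicator {a..<a+h} t) * cis (- (v * t)))
    = cis (- (v * (a + h/2))) * (LINT s:{-h/2..h/2}|lborel. cis (- (v * s)))"
proof -
  define m where "m = a + h / 2"
  have "(LINT t|lborel. complex_of_real (indicator {a..<a+h} t) * cis (- (v * t)))
     = (LINT t|lborel. complex_of_real (indicator {a..a+h} t) * cis (- (v * t)))"
  proof (rule integral_cong_AE)
    have "AE t in lborel. t \<noteq> a + h" by (rule AE_lborel_singleton)
    then show "AE t in lborel. complex_of_real (indicator {a..<a+h} t) * cis (- (v * t))
       = complex_of_real (indicator {a..a+h} t) * cis (- (v * t))"
      by (rule AE_mp) (auto simp: indicator_def)
  qed auto
  also have "\<dots> = (LINT s|lborel. complex_of_real (indicator {a..a+h} (m + 1 * s)) * cis (- (v * (m + 1 * s))))"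
    using lborel_integral_real_affine[of 1 "\<lambda>t. complex_of_real (indicator {a..a+h} t) * cis (- (v * t))" m] by simp
  also have "\<dots> = (LINT s|lborel. cis (- (v * m)) * (complex_of_real (indicator {-h/2..h/2} s) * cis (- (v * s))))"
  proof (rule Bochner_Integration.integral_cong[OF refl])
    fix s
    have "indicator {a..a+h} (m + 1 * s) = (indicator {-h/2..h/2} s :: real)"
      by (auto simp: indicator_def m_def field_simps)
    moreover have "cis (- (v * (m + 1 * s))) = cis (- (v * m)) * cis (- (v * s))"
      by (simp add: cis_mult algebra_simps)
    ultimately show "complex_of_real (indicator {a..a+h} (m + 1 * s)) * cis (- (v * (m + 1 * s)))
        = cis (- (v * m)) * (complex_of_real (indicator {-h/2..h/2} s) * cis (- (v * s)))"
      by (simp only: mult_ac)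
  qed
  finally show ?thesis by (simp add: set_lebesgue_integral_def scaleR_conv_of_real m_def)
qed

lemma sq_integrable_on_I_indicator: "sq_integrable_on_I (indicator {a..<b})"
proof -
  have "set_integrable lborel {-1..1} (\<lambda>x. (indicator {a..<b} x :: real))"
    by (rule set_integrable_bound[OF set_integrable_const_I[of "-1" 1 "1::real"]])
       (auto simp: set_borel_measurable_def indicator_def)
  moreover have "(indicator {a..<b} x)\<^sup>2 = (indicator {a..<b} x :: real)" for x by (auto simp: indicator_def)
  ultimately show ?thesis unfolding sq_integrable_on_I_def by auto
qed

text \<open>The half-open pieces tile [-1,1] up to an endpoint, so products of distinct indicators
  vanish exactly. The transform of f is a unimodular factor times a pulse transform times a
  polynomial in cis (- (v h)) with coefficients c; for |v| \<le> 1 the pulse transform has modulus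
  at least h/2, because the phases within a pulse stay below 1. Interpolation at the frequencies -1
  + l h + t, integrated over t in [0,h], covers [-1,1] once. Of h^3/4, the part h^2/4 comes from the
  pulse and h from the integration over t.\<close>

lemma step_function_band_lower_bound:
  fixes c :: "nat \<Rightarrow> real" and j :: nat
  defines "h \<equiv> 2 / real (Suc j)"
  defines "I \<equiv> \<lambda>k. {-1 + real k * h..<-1 + real k * h + h}"
  defines "f \<equiv> \<lambda>t. \<Sum>k\<le>j. c k * indicator (I k) t"
  assumes w: "w \<ge> 1"
  shows "sq_integrable_on_I f"
    and "(LINT t:{-1..1}|lborel. (f t)\<^sup>2) = h * (\<Sum>k\<le>j. (c k)\<^sup>2)"
    and "h ^ 3 / 4 * (\<Sum>k\<le>j. (c k)\<^sup>2) \<le> ((2 * (real (Suc j))\<^sup>2) ^ j / fact j)\<^sup>2 *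
       (LINT v:{-w..w}|lborel. (cmod (band_transform f v))\<^sup>2)"
proof -
  have h: "0 < h" "h \<le> 2" "real (Suc j) * h = 2" by (auto simp: h_def field_simps)
  have I1: "I k \<subseteq> {-1..1}" if "k \<le> j" for k
  proof -
    have "real k * h + h \<le> 2" using h that mult_right_mono[of "real (Suc k)" "real (Suc j)" h]
      by (simp add: algebra_simps)
    moreover have "0 \<le> real k * h" using h by simp
    ultimately have b: "-1 \<le> x" "x \<le> 1" if "-1 + real k * h \<le> x" "x < -1 + real k * h + h" for x
      using that by linarith+
    show ?thesis unfolding I_def using b by (intro subsetI) simp
  qed
  have disj: "indicator (I k) t * indicator (I l) t = (if k = l then indicator (I k) t else 0 :: real)" for k l t
  proof (cases "k = l")
    case False
    have False if "t \<in> I k" "t \<in> I l" "k < l" for k l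
    proof -
      have "real (Suc k) * h \<le> real l * h" using h that by (intro mult_right_mono) auto
      then show False using that by (auto simp: I_def algebra_simps)
    qed
    then have "\<not> (t \<in> I k \<and> t \<in> I l)" using False by (metis nat_neq_iff)
    then show ?thesis using False by (auto simp: indicator_def)
  qed (auto simp: indicator_def)
  have si: "sq_integrable_on_I (indicator (I k))" for k
    unfolding I_def by (rule sq_integrable_on_I_indicator)
  then show sf: "sq_integrable_on_I f"
    unfolding f_def by (intro sq_integrable_on_I_sum sq_integrable_on_I_cmult) 
  have ind: "(LINT t:{-1..1}|lborel. (indicator (I k) t :: real)) = h" if "k \<le> j" for k
  proof -
    have "(LINT t:{-1..1}|lborel. (indicator (I k) t :: real)) = (LINT t|lborel. indicator (I k) t)"
      unfolding set_lebesgue_integral_def using I1[OF that]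
      by (intro Bochner_Integration.integral_cong) (auto simp: indicator_def)
    also have "\<dots> = h" using h by (simp add: I_def)
    finally show ?thesis .
  qed
  have fsq: "(f t)\<^sup>2 = (\<Sum>k\<le>j. (c k)\<^sup>2 * indicator (I k) t)" for t
  proof -
    have "(f t)\<^sup>2 = (\<Sum>k\<le>j. \<Sum>l\<le>j. c k * c l * (indicator (I k) t * indicator (I l) t))"
      unfolding f_def power2_eq_square sum_product by (simp add: mult_ac)
    also have "\<dots> = (\<Sum>k\<le>j. \<Sum>l\<le>j. if k = l then (c k)\<^sup>2 * indicator (I k) t else 0)"
      unfolding disj by (intro sum.cong refl) (auto simp: power2_eq_square)
    finally show ?thesis by simp
  qed
  show "(LINT t:{-1..1}|lborel. (f t)\<^sup>2) = h * (\<Sum>k\<le>j. (c k)\<^sup>2)"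
  proof -
    have "(LINT t:{-1..1}|lborel. (f t)\<^sup>2) = (\<Sum>k\<le>j. LINT t:{-1..1}|lborel. (c k)\<^sup>2 * indicator (I k) t)"
      unfolding fsq by (intro set_integral_sum_fun set_integrable_mult_right sq_integrable_on_I_integrable si)
    also have "\<dots> = (\<Sum>k\<le>j. (c k)\<^sup>2 * h)" using ind by simp
    finally show ?thesis by (simp add: sum_distrib_left mult.commute)
  qed
  define F where "F v = (cmod (\<Sum>k\<le>j. complex_of_real (c k) * cis (- (v * h)) ^ k))\<^sup>2" for v
  have bt: "F v * (h\<^sup>2 / 4) \<le> (cmod (band_transform f v))\<^sup>2" if v: "\<bar>v\<bar> \<le> 1" for v
  proof -
    define S where "S = (LINT s:{-h/2..h/2}|lborel. cis (- (v * s)))"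
    have Sre: "h / 2 \<le> cmod S"
    proof -
      have i: "set_integrable lborel {-h/2..h/2} (\<lambda>s. cis (- (v * s)))"
        by (intro borel_integrable_atLeastAtMost') (intro continuous_intros)
      have "Re S = (LINT s:{-h/2..h/2}|lborel. cos (v * s))"
        unfolding S_def set_lebesgue_integral_def
        using integral_Re[OF i[unfolded set_integrable_def]] by simp
      then show ?thesis using integral_cos_ge[of v h] v h complex_Re_le_cmod[of S] by simp
    qed
    have "band_transform f v = (\<Sum>k\<le>j. complex_of_real (c k) * band_transform (indicator (I k)) v)"
      unfolding f_def using si by (intro band_transform_sum) auto
    also have "\<dots> = (\<Sum>k\<le>j. complex_of_real (c k) * (cis (- (v * h)) ^ k * cis (v - v * h / 2) * S))"
    proof (intro sum.cong refl)
      fix k assume "k \<in> {..j}"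
      then have k: "k \<le> j" by simp
      have "band_transform (indicator (I k)) v = (LINT t|lborel. complex_of_real (indicator (I k) t) * cis (- (v * t)))"
        unfolding band_transform_def set_lebesgue_integral_def using I1[OF k]
        by (intro Bochner_Integration.integral_cong) (auto simp: indicator_def)
      also have "\<dots> = cis (- (v * (- 1 + real k * h + h/2))) * S"
        unfolding I_def S_def using h by (intro integral_cis_Ico) simp
      also have "cis (- (v * (- 1 + real k * h + h/2))) = cis (- (v * h)) ^ k * cis (v - v * h / 2)"
      proof -
        have "- (v * (- 1 + real k * h + h/2)) = real k * (- (v * h)) + (v - v * h / 2)"
          by (simp add: algebra_simps)
        then show ?thesis by (simp only: Complex.DeMoivre cis_mult)
      qed
      finally show "complex_of_real (c k) * band_transform (indicator (I k)) v
         = complex_of_real (c k) * (cis (- (v * h)) ^ k * cis (v - v * h / 2) * S)" by simp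
    qed
    also have "\<dots> = (\<Sum>k\<le>j. complex_of_real (c k) * cis (- (v * h)) ^ k) * (cis (v - v * h / 2) * S)"
      by (simp only: sum_distrib_right mult.assoc)
    finally have eq: "(cmod (band_transform f v))\<^sup>2 = F v * (cmod S)\<^sup>2"
      by (simp add: F_def norm_mult power_mult_distrib)
    have "h\<^sup>2 / 4 \<le> (cmod S)\<^sup>2" using power_mono[OF Sre, of 2] h by (simp add: power_divide)
    from mult_left_mono[OF this, of "F v"] show ?thesis unfolding eq by (simp only: F_def zero_le_power2 simp_thms)
  qed
  have cF: "continuous_on A F" for A unfolding F_def by (intro continuous_intros)
  define A where "A = ((2 * (real (Suc j))\<^sup>2) ^ j / fact j)\<^sup>2"
  have A0: "A \<ge> 0" by (simp add: A_def)
  have pts: "(\<Sum>k\<le>j. (c k)\<^sup>2) \<le> A * (\<Sum>l\<le>j. F (-1 + real l * h + t))" for t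
  proof -
    \<comment> \<open>The angle of cis (- (v h)) falls as v grows. Nodes are therefore counted from
      the largest frequency -1 + j h + t, and the index is reversed at the end; a frequency step h
      changes the angle by h^2 = 4/(j+1)^2.\<close>
    define B where "B = -((-1 + real j * h + t) * h)"
    have "(\<Sum>k\<le>j. (c k)\<^sup>2) = (\<Sum>k\<le>j. (cmod (complex_of_real (c k)))\<^sup>2)" by simp
    also have "\<dots> \<le> A * (\<Sum>l\<le>j. (cmod (\<Sum>k\<le>j. complex_of_real (c k) * cis (B + real l * 4 / (real (Suc j))\<^sup>2) ^ k))\<^sup>2)"
      unfolding A_def by (rule sum_norm_sq_le_values_equidistant)
    also have "(\<Sum>l\<le>j. (cmod (\<Sum>k\<le>j. complex_of_real (c k) * cis (B + real l * 4 / (real (Suc j))\<^sup>2) ^ k))\<^sup>2)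
       = (\<Sum>l\<le>j. F (-1 + real (j - l) * h + t))"
    proof (intro sum.cong refl)
      fix l assume "l \<in> {..j}"
      then have eqB: "B + real l * 4 / (real (Suc j))\<^sup>2 = - ((-1 + real (j - l) * h + t) * h)"
      proof -
        have "real l * 4 / (real (Suc j))\<^sup>2 = real l * (h * h)"
          unfolding h_def power2_eq_square by simp
        moreover have "real (j - l) = real j - real l" using \<open>l \<in> {..j}\<close> by simp
        ultimately show ?thesis unfolding B_def by (simp only:) (simp add: algebra_simps)
      qed
      then show "(cmod (\<Sum>k\<le>j. complex_of_real (c k) * cis (B + real l * 4 / (real (Suc j))\<^sup>2) ^ k))\<^sup>2
         = F (-1 + real (j - l) * h + t)" unfolding F_def by simp
    qed
    also have "\<dots> = (\<Sum>l\<le>j. F (-1 + real l * h + t))"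
      by (rule sum.reindex_bij_witness[of _ "\<lambda>l. j - l" "\<lambda>l. j - l"]) auto
    finally show ?thesis .
  qed
  have int1: "h * (\<Sum>k\<le>j. (c k)\<^sup>2) \<le> A * integral {-1..1} F"
  proof -
    have "h * (\<Sum>k\<le>j. (c k)\<^sup>2) = integral {0..h} (\<lambda>t. \<Sum>k\<le>j. (c k)\<^sup>2)" using h by simp
    also have "\<dots> \<le> integral {0..h} (\<lambda>t. A * (\<Sum>l\<le>j. F (-1 + real l * h + t)))"
      by (intro integral_le integrable_continuous_real pts continuous_intros continuous_on_compose2[OF cF[of UNIV]]) auto
    also have "\<dots> = A * integral {0..h} (\<lambda>t. \<Sum>l<Suc j. F (-1 + real l * h + t))"
      by (simp only: integral_mult_right lessThan_Suc_atMost)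
    also have "integral {0..h} (\<lambda>t. \<Sum>l<Suc j. F (-1 + real l * h + t)) = integral {-1..-1 + real (Suc j) * h} F"
      using h by (intro integral_split_equidistant[symmetric] cF) auto
    finally show ?thesis using h by simp
  qed
  have i1: "set_integrable lborel {-1..1} F" by (intro borel_integrable_atLeastAtMost' cF)
  have "h\<^sup>2 / 4 * integral {-1..1} F = (LINT v:{-1..1}|lborel. F v * (h\<^sup>2 / 4))"
    using set_borel_integral_eq_integral(2)[OF i1] by simp
  also have "\<dots> \<le> (LINT v:{-1..1}|lborel. (cmod (band_transform f v))\<^sup>2)"
  proof (rule set_integral_mono)
    show "set_integrable lborel {-1..1} (\<lambda>v. F v * (h\<^sup>2 / 4))" by (intro set_integrable_mult_left i1)
    show "set_integrable lborel {-1..1} (\<lambda>v. (cmod (band_transform f v))\<^sup>2)"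
      by (rule set_integrable_band_transform_sq[OF sq_integrable_on_I_integrable[OF sf]])
    show "F v * (h\<^sup>2 / 4) \<le> (cmod (band_transform f v))\<^sup>2" if "v \<in> {-1..1}" for v
      using that by (intro bt) auto
  qed
  \<comment> \<open>Here w \<ge> 1 enters: the band contains [-1,1].\<close>
  also have "\<dots> \<le> (LINT v:{-w..w}|lborel. (cmod (band_transform f v))\<^sup>2)"
    unfolding set_lebesgue_integral_def
  proof (rule integral_mono)
    show "integrable lborel (\<lambda>v. indicator {-1..1} v *\<^sub>R (cmod (band_transform f v))\<^sup>2)"
      "integrable lborel (\<lambda>v. indicator {-w..w} v *\<^sub>R (cmod (band_transform f v))\<^sup>2)"
      using set_integrable_band_transform_sq[OF sq_integrable_on_I_integrable[OF sf]]
      unfolding set_integrable_def by blast+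
  qed (use w in \<open>auto simp: indicator_def\<close>)
  finally have "A * (h\<^sup>2 / 4 * integral {-1..1} F) \<le> A * (LINT v:{-w..w}|lborel. (cmod (band_transform f v))\<^sup>2)"
    using A0 by (rule mult_left_mono)
  moreover have "h\<^sup>2 / 4 * (h * (\<Sum>k\<le>j. (c k)\<^sup>2)) \<le> h\<^sup>2 / 4 * (A * integral {-1..1} F)"
    by (intro mult_left_mono int1) auto
  ultimately show "h ^ 3 / 4 * (\<Sum>k\<le>j. (c k)\<^sup>2) \<le> ((2 * (real (Suc j))\<^sup>2) ^ j / fact j)\<^sup>2 *
       (LINT v:{-w..w}|lborel. (cmod (band_transform f v))\<^sup>2)"
    unfolding A_def[symmetric] by (simp add: power2_eq_square power3_eq_cube algebra_simps)
qed

text \<open>Against j + 1 pulses there are only j orthogonality conditions, so some nonzero step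
  function is orthogonal to the first j eigenfunctions. \<open>band_energy_le\<close> bounds its
  energy from above and \<open>step_function_band_lower_bound\<close> from below. The factor (j+1)^2
  in the result is the reciprocal of h^2/4.\<close>

lemma slepian_mu_lower_bound:
  assumes sb: "slepian_basis w \<mu> \<phi>" and w: "w \<ge> 1"
  shows "1 \<le> 2 * pi * \<mu> j * (real (Suc j) * ((2 * (real (Suc j))\<^sup>2) ^ j / fact j))\<^sup>2"
proof -
  define h where "h = 2 / real (Suc j)"
  define I where "I k = {-1 + real k * h..<-1 + real k * h + h}" for k
  define A where "A = ((2 * (real (Suc j))\<^sup>2) ^ j / fact j)\<^sup>2"
  define a where "a i k = (LINT t:{-1..1}|lborel. indicator (I k) t * \<phi> i t)" for i k
  obtain c where c: "\<exists>k\<in>{..j}. c k \<noteq> 0" "\<forall>i\<in>{..<j}. (\<Sum>k\<in>{..j}. c k * a i k) = 0"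
    using homogeneous_system_nontrivial[of "{..<j}" "{..j}" a] by auto
  define f where "f t = (\<Sum>k\<le>j. c k * indicator (I k) t)" for t
  note st = step_function_band_lower_bound[where j = j and c = c, OF w, folded h_def, folded I_def, folded f_def]
  define S where "S = (\<Sum>k\<le>j. (c k)\<^sup>2)"
  have S: "S > 0" unfolding S_def using c(1) by (auto intro!: sum_pos2)
  have h0: "h > 0" by (simp add: h_def)
  have A0: "A > 0" by (simp add: A_def)
  have si: "sq_integrable_on_I (indicator (I k))" for k
    unfolding I_def by (rule sq_integrable_on_I_indicator)
  have orth: "(LINT x:{-1..1}|lborel. f x * \<phi> i x) = 0" if "i < j" for i
  proof -
    have "(LINT x:{-1..1}|lborel. f x * \<phi> i x) = (LINT x:{-1..1}|lborel. (\<Sum>k\<le>j. c k * (indicator (I k) x * \<phi> i x)))"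
      by (simp only: f_def sum_distrib_right mult.assoc)
    also have "\<dots> = (\<Sum>k\<le>j. LINT x:{-1..1}|lborel. c k * (indicator (I k) x * \<phi> i x))"
      by (intro set_integral_sum_fun set_integrable_mult_right sq_integrable_on_I_mult si slepian_phi_sq_integrable[OF sb w])
    also have "\<dots> = 0" using c(2) that by (simp add: a_def)
    finally show ?thesis .
  qed
  have "h ^ 3 / 4 * S \<le> A * (LINT v:{-w..w}|lborel. (cmod (band_transform f v))\<^sup>2)"
    using st(3) unfolding A_def S_def by simp
  also have "\<dots> \<le> A * (2 * pi * \<mu> j * (h * S))"
    using band_energy_le[OF sb w st(1) orth, of j] A0 unfolding st(2) S_def
    by (intro mult_left_mono) auto
  finally have "h * S * (h\<^sup>2 / 4) \<le> h * S * (A * (2 * pi * \<mu> j))"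
    by (simp add: power2_eq_square power3_eq_cube algebra_simps)
  then have "h\<^sup>2 / 4 \<le> A * (2 * pi * \<mu> j)"
    using S h0 mult_le_cancel_left_pos[of "h * S"] by simp
  moreover have "h\<^sup>2 / 4 * (real (Suc j))\<^sup>2 = 1" by (simp add: h_def power_divide)
  ultimately have "1 \<le> A * (2 * pi * \<mu> j) * (real (Suc j))\<^sup>2"
    by (metis mult_right_mono zero_le_power2)
  then show ?thesis unfolding A_def power_mult_distrib[of "real (Suc j)"] by (simp only: mult_ac)
qed

lemma power_self_le_exp_fact: "real n ^ n \<le> exp 1 ^ n * fact n"
proof -
  have "real n ^ n / fact n = (\<Sum>k\<in>{n}. real n ^ k / fact k)" by simp
  also have "\<dots> \<le> (\<Sum>k. real n ^ k / fact k)"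
    using summable_exp[of "real n"] by (intro sum_le_suminf) (auto simp: field_simps)
  also have "\<dots> = exp (real n)"
    unfolding exp_def by (simp add: field_simps)
  also have "\<dots> = exp 1 ^ n" by (simp flip: exp_of_nat_mult)
  finally show ?thesis by (simp add: field_simps)
qed

section \<open>Band-limited representation and pointwise bounds of the eigenfunctions\<close>

context
  fixes w :: real and \<mu> :: "nat \<Rightarrow> real" and \<phi> :: "nat \<Rightarrow> real \<Rightarrow> real"
  assumes sb: "slepian_basis w \<mu> \<phi>" and w1: "w \<ge> 1"
begin

lemma slepian_phi_integrable: "set_integrable lborel {-1..1} (\<phi> j)"
  using sq_integrable_on_I_integrable slepian_phi_sq_integrable[OF sb w1] by blast

text \<open>The eigenvalue equation solved for \<open>\<phi> j\<close>, at every real x. The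
  division by \<open>\<mu> j\<close> is the reason for wanting a lower bound on the
  eigenvalues.\<close>

lemma slepian_phi_eq_band_integral:
  "complex_of_real (\<phi> j x) = complex_of_real (1 / (2 * pi * \<mu> j)) * (LINT v:{-w..w}|lborel. band_transform (\<phi> j) v * cis (v * x))"
proof -
  have "complex_of_real (\<mu> j) * complex_of_real (\<phi> j x)
     = complex_of_real (1 / (2 * pi)) * (LINT v:{-w..w}|lborel. band_transform (\<phi> j) v * cis (v * x))"
    using slepian_op_eq_band_integral[OF slepian_phi_integrable, of w j x] slepian_op_phi[OF sb w1, of j x] w1 by simp
  then show ?thesis using slepian_mu_pos[OF sb w1, of j] by (simp add: field_simps)
qed

lemma band_transform_phi_energy:
  "(LINT v:{-w..w}|lborel. (cmod (band_transform (\<phi> j) v))\<^sup>2) = 4 * pi * \<mu> j"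
proof -
  have "complex_of_real (LINT v:{-w..w}|lborel. (cmod (band_transform (\<phi> j) v))\<^sup>2)
      = (LINT v:{-w..w}|lborel. band_transform (\<phi> j) v * cnj (band_transform (\<phi> j) v))"
    unfolding complex_norm_square[symmetric] by (rule set_integral_complex_of_real[symmetric])
  also have "\<dots> = complex_of_real (4 * pi * \<mu> j)"
    using band_transform_phi_inner[OF sb w1, of j j] by simp
  finally show ?thesis by (simp only: of_real_eq_iff)
qed

lemma set_integrable_band_transform_mult_continuous:
  assumes k: "continuous_on UNIV k"
  shows "set_integrable lborel {-w..w} (\<lambda>v. band_transform (\<phi> j) v * k v)"
proof -
  have "compact (k ` {-w..w})" by (intro compact_continuous_image continuous_on_subset[OF k]) auto
  then obtain B where B: "\<And>v. v \<in> {-w..w} \<Longrightarrow> cmod (k v) \<le> B"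
    using compact_imp_bounded bounded_iff by (metis imageI)
  have [measurable]: "band_transform (\<phi> j) \<in> borel_measurable borel" "k \<in> borel_measurable borel"
    using slepian_phi_integrable k by (measurable, intro borel_measurable_continuous_onI)
  have "0 \<le> B" using B[of 0] w1 norm_ge_zero[of "k 0"] by (simp del: norm_ge_zero)
  then show ?thesis
    using norm_band_transform_le[OF slepian_phi_integrable] B
    by (intro set_integrable_bound[OF set_integrable_const_I[of "-w" w "(LINT t:{-1..1}|lborel. \<bar>\<phi> j t\<bar>) * B"]])
       (auto simp: set_borel_measurable_def norm_mult intro!: mult_mono order_trans[OF _ abs_ge_self]
         order_trans[OF norm_ge_zero])
qed

text \<open>Cauchy-Schwarz on the band, where the transform of \<open>\<phi> j\<close> has energy 4
  pi \<open>\<mu> j\<close>: this absorbs one of the two factors 1 / \<open>\<mu> j\<close>. With k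
  an exponential, a difference of exponentials or a Taylor remainder, it yields in turn a sup bound,
  Lipschitz continuity and polynomial approximation.\<close>

lemma slepian_band_pairing_bound:
  assumes k: "continuous_on UNIV k" and K: "(LINT v:{-w..w}|lborel. (cmod (k v))\<^sup>2) \<le> K" "K > 0"
  shows "(cmod (complex_of_real (1 / (2 * pi * \<mu> j)) * (LINT v:{-w..w}|lborel. band_transform (\<phi> j) v * k v)))\<^sup>2 \<le> K / (pi * \<mu> j)"
proof -
  define E where "E = 4 * pi * \<mu> j"
  have E: "E > 0" using slepian_mu_pos[OF sb w1, of j] by (simp add: E_def)
  \<comment> \<open>The weight that balances the two terms of the arithmetic-geometric mean
    inequality; with the bound K inserted, each is s E / 2.\<close>
  define s where "s = sqrt (K / E)"
  have s: "s > 0" "s * s = K / E" using K E by (simp_all add: s_def)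
  have ik: "set_integrable lborel {-w..w} (\<lambda>v. (cmod (k v))\<^sup>2)"
    by (intro borel_integrable_atLeastAtMost' continuous_intros continuous_on_subset[OF k]) auto
  have ib: "set_integrable lborel {-w..w} (\<lambda>v. (cmod (band_transform (\<phi> j) v))\<^sup>2)"
    by (rule set_integrable_band_transform_sq[OF slepian_phi_integrable])
  have "cmod (LINT v:{-w..w}|lborel. band_transform (\<phi> j) v * k v)
     \<le> (LINT v:{-w..w}|lborel. cmod (band_transform (\<phi> j) v * k v))"
    unfolding set_lebesgue_integral_def
    by (rule order_trans[OF integral_norm_bound]) (simp add: indicator_def norm_mult)
  also have "\<dots> \<le> (LINT v:{-w..w}|lborel. s / 2 * (cmod (band_transform (\<phi> j) v))\<^sup>2 + 1 / (2 * s) * (cmod (k v))\<^sup>2)"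
  proof (rule set_integral_mono)
    show "set_integrable lborel {-w..w} (\<lambda>v. cmod (band_transform (\<phi> j) v * k v))"
      by (rule set_integrable_norm[OF set_integrable_band_transform_mult_continuous[OF k]])
    show "set_integrable lborel {-w..w} (\<lambda>v. s / 2 * (cmod (band_transform (\<phi> j) v))\<^sup>2 + 1 / (2 * s) * (cmod (k v))\<^sup>2)"
      using ik ib by auto
    fix v
    have "0 \<le> (s * cmod (band_transform (\<phi> j) v) - cmod (k v))\<^sup>2 / (2 * s)" using s by simp
    also have "\<dots> = s / 2 * (cmod (band_transform (\<phi> j) v))\<^sup>2 + 1 / (2 * s) * (cmod (k v))\<^sup>2
         - cmod (band_transform (\<phi> j) v * k v)"
      using s by (simp add: norm_mult power2_eq_square field_simps)
    finally show "cmod (band_transform (\<phi> j) v * k v)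
      \<le> s / 2 * (cmod (band_transform (\<phi> j) v))\<^sup>2 + 1 / (2 * s) * (cmod (k v))\<^sup>2" by simp
  qed
  also have "\<dots> = s / 2 * E + 1 / (2 * s) * (LINT v:{-w..w}|lborel. (cmod (k v))\<^sup>2)"
    using ik ib by (simp add: set_integral_add band_transform_phi_energy E_def)
  also have "\<dots> \<le> s / 2 * E + 1 / (2 * s) * K"
    using K s by (intro add_left_mono mult_left_mono) auto
  also have "\<dots> = s * E"
  proof -
    have "K = s * s * E" using s E by simp
    then have "1 / (2 * s) * K = s / 2 * E" using s(1) by simp
    then show ?thesis by simp
  qed
  finally have le: "cmod (LINT v:{-w..w}|lborel. band_transform (\<phi> j) v * k v) \<le> s * E" .
  have "cmod (complex_of_real (1 / (2 * pi * \<mu> j)) * (LINT v:{-w..w}|lborel. band_transform (\<phi> j) v * k v)) \<le> 2 / E * (s * E)"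
    unfolding norm_mult norm_of_real using E le by (intro mult_mono) (auto simp: E_def)
  from power_mono[OF this norm_ge_zero, of 2]
  have "(cmod (complex_of_real (1 / (2 * pi * \<mu> j)) * (LINT v:{-w..w}|lborel. band_transform (\<phi> j) v * k v)))\<^sup>2 \<le> (2 / E * (s * E))\<^sup>2" .
  also have "(2 / E * (s * E))\<^sup>2 = 4 * (s * s)" using E by (simp add: power2_eq_square)
  also have "\<dots> = K / (pi * \<mu> j)" unfolding s(2) by (simp add: E_def)
  finally show ?thesis .
qed

text \<open>At j = 0 the eigenvalue bound reads 1 \<le> 2 pi \<open>\<mu> 0\<close>, so pairing with
  a single exponential costs only the first power of w. More could not be absorbed here, since
  (j+1)^p is 1.\<close>

lemma slepian_phi_0_sq_le: "(\<phi> 0 x)\<^sup>2 \<le> 4 * w"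
proof -
  have c: "continuous_on UNIV (\<lambda>v. cis (v * x))" by (intro continuous_intros)
  have "(LINT v:{-w..w}|lborel. (cmod (cis (v * x)))\<^sup>2) \<le> 2 * w"
    using w1 by (simp add: set_integral_const)
  from slepian_band_pairing_bound[OF c this, of 0] w1
  have "(cmod (complex_of_real (\<phi> 0 x)))\<^sup>2 \<le> 2 * w / (pi * \<mu> 0)"
    unfolding slepian_phi_eq_band_integral[of 0 x] by simp
  also have "\<dots> \<le> 4 * w"
  proof -
    have "1 \<le> 2 * (pi * \<mu> 0)" using slepian_mu_lower_bound[OF sb w1, of 0] by simp
    then have "2 * w * 1 \<le> 2 * w * (2 * (pi * \<mu> 0))" using w1 by (intro mult_left_mono) auto
    then show ?thesis using slepian_mu_pos[OF sb w1, of 0] by (simp add: divide_le_eq)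
  qed
  finally show ?thesis by simp
qed

text \<open>The exponentials for x and y differ by at most w |x - y| on the band, which gives a
  Lipschitz bound. Continuity is what lets an essential supremum control values at sample
  points.\<close>

lemma slepian_phi_continuous: "continuous_on UNIV (\<phi> j)"
proof -
  define L where "L = sqrt (2 * w ^ 3 / (pi * \<mu> j))"
  have L: "L \<ge> 0" "L\<^sup>2 = 2 * w ^ 3 / (pi * \<mu> j)"
    using slepian_mu_pos[OF sb w1, of j] w1 by (simp_all add: L_def)
  have "L-lipschitz_on UNIV (\<phi> j)"
  proof (rule lipschitz_onI[OF _ L(1)])
    fix x y :: real
    show "dist (\<phi> j x) (\<phi> j y) \<le> L * dist x y"
    proof (cases "x = y")
      case False
      define k where "k v = cis (v * x) - cis (v * y)" for v
      have ck: "continuous_on UNIV k" unfolding k_def by (intro continuous_intros)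
      have i: "set_integrable lborel {-w..w} (\<lambda>v. (cmod (k v))\<^sup>2)"
        by (intro borel_integrable_atLeastAtMost' continuous_intros continuous_on_subset[OF ck]) auto
      have "(LINT v:{-w..w}|lborel. (cmod (k v))\<^sup>2) \<le> (LINT v:{-w..w}|lborel. (w * \<bar>x - y\<bar>)\<^sup>2)"
      proof (rule set_integral_mono[OF i set_integrable_const_I])
        fix v assume v: "v \<in> {-w..w}"
        have "cmod (k v) = 2 * \<bar>sin ((v * x - v * y) / 2)\<bar>" unfolding k_def by (rule norm_cis_diff)
        also have "\<dots> \<le> \<bar>v * x - v * y\<bar>" using abs_sin_x_le_abs_x[of "(v * x - v * y) / 2"] by simp
        also have "\<dots> = \<bar>v\<bar> * \<bar>x - y\<bar>" by (simp add: abs_mult[symmetric] right_diff_distrib)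
        also have "\<dots> \<le> w * \<bar>x - y\<bar>" using v by (intro mult_right_mono) auto
        finally show "(cmod (k v))\<^sup>2 \<le> (w * \<bar>x - y\<bar>)\<^sup>2" by (intro power_mono) auto
      qed
      also have "\<dots> = 2 * w ^ 3 * (x - y)\<^sup>2"
        using w1 by (simp add: set_integral_const power_mult_distrib power2_eq_square power3_eq_cube)
      finally have K: "(LINT v:{-w..w}|lborel. (cmod (k v))\<^sup>2) \<le> 2 * w ^ 3 * (x - y)\<^sup>2" .
      have i2: "set_integrable lborel {-w..w} (\<lambda>v. band_transform (\<phi> j) v * cis (v * x))" for x
        by (intro set_integrable_band_transform_mult_continuous continuous_intros)
      have "complex_of_real (1 / (2 * pi * \<mu> j)) * (LINT v:{-w..w}|lborel. band_transform (\<phi> j) v * k v)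
          = complex_of_real (\<phi> j x - \<phi> j y)"
        unfolding k_def right_diff_distrib of_real_diff slepian_phi_eq_band_integral[of j]
          set_integral_diff(2)[OF i2 i2] ..
      then have "(cmod (complex_of_real (\<phi> j x - \<phi> j y)))\<^sup>2 \<le> 2 * w ^ 3 * (x - y)\<^sup>2 / (pi * \<mu> j)"
        using slepian_band_pairing_bound[OF ck K, of j] False w1 by simp
      also have "\<dots> = (L * \<bar>x - y\<bar>)\<^sup>2" by (simp add: power_mult_distrib L)
      finally have "(\<phi> j x - \<phi> j y)\<^sup>2 \<le> (L * \<bar>x - y\<bar>)\<^sup>2"
        by (simp only: norm_of_real power2_abs)
      then have "\<bar>\<phi> j x - \<phi> j y\<bar> \<le> \<bar>L * \<bar>x - y\<bar>\<bar>" by (simp only: abs_le_square_iff)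
      then show ?thesis using L(1) by (simp add: dist_real_def abs_mult)
    qed simp
  qed
  then show ?thesis by (rule lipschitz_on_continuous_on)
qed

text \<open>The exponential under the band integral is expanded rather than \<open>\<phi> j\<close>.
  Its remainder is at most |v|^D / D! for |x| \<le> 1, with square integral 2w/(2D+1) times (w^D /
  D!)^2 over the band. Taking real parts of the coefficients is harmless because
  \<open>\<phi> j\<close> and x are real.\<close>

lemma slepian_taylor_error:
  fixes j D :: nat
  assumes D: "D \<ge> 1" and x: "x \<in> {-1..1}"
  defines "a \<equiv> \<lambda>m. Re (complex_of_real (1 / (2 * pi * \<mu> j)) * (LINT v:{-w..w}|lborel. band_transform (\<phi> j) v * ((\<i> * v) ^ m / fact m)))"
  shows "(\<phi> j x - (\<Sum>m<D. a m * x ^ m))\<^sup>2 \<le> 2 * w / ((2 * real D + 1) * (pi * \<mu> j)) * (w ^ D / fact D)\<^sup>2"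
proof -
  define C where "C = complex_of_real (1 / (2 * pi * \<mu> j))"
  define k where "k v = cis (v * x) - (\<Sum>m<D. (\<i> * complex_of_real v) ^ m / fact m * complex_of_real (x ^ m))" for v
  have ck: "continuous_on UNIV k" unfolding k_def by (intro continuous_intros) auto
  have kb: "cmod (k v) \<le> \<bar>v\<bar> ^ D / fact D" for v
  proof -
    obtain n where n: "D = Suc n" using D by (cases D) auto
    have "cmod (iexp (v * x) - (\<Sum>m \<le> n. (\<i> * (v * x)) ^ m / fact m)) \<le> \<bar>v * x\<bar> ^ Suc n / fact (Suc n)"
      by (rule iexp_approx1)
    also have "iexp (v * x) - (\<Sum>m \<le> n. (\<i> * (v * x)) ^ m / fact m) = k v"
      unfolding k_def n lessThan_Suc_atMost by (simp add: cis_conv_exp power_mult_distrib mult_ac)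
    also have "\<bar>v * x\<bar> ^ Suc n / fact (Suc n) \<le> \<bar>v\<bar> ^ D / fact D"
      unfolding n abs_mult power_mult_distrib using x
      by (intro divide_right_mono mult_left_le power_le_one) auto
    finally show ?thesis .
  qed
  have hi: "((\<lambda>v. (v ^ D / fact D)\<^sup>2) has_integral (w ^ (2*D+1) / ((2*real D+1) * (fact D)\<^sup>2) - (-w) ^ (2*D+1) / ((2*real D+1) * (fact D)\<^sup>2))) {-w..w}"
  proof (rule fundamental_theorem_of_calculus)
    fix v
    have "((\<lambda>v. v ^ (2*D+1) / ((2*real D+1) * (fact D)\<^sup>2)) has_real_derivative
       (real (2*D+1) * v ^ (2*D+1 - Suc 0)) / ((2*real D+1) * (fact D)\<^sup>2)) (at v within {-w..w})"
      by (rule DERIV_cdivide[OF DERIV_pow])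
    also have "real (2*D+1) * v ^ (2*D+1 - Suc 0) / ((2*real D+1) * (fact D)\<^sup>2) = (v ^ D / fact D)\<^sup>2"
    proof -
      have "real (2*D+1) = 2 * real D + 1" "2 * real D + 1 \<noteq> 0" by auto
      moreover have "v ^ (2*D+1 - Suc 0) = (v ^ D)\<^sup>2" by (simp add: power_mult[symmetric] mult.commute)
      ultimately show ?thesis by (simp only: power_divide) simp
    qed
    finally show "((\<lambda>v. v ^ (2*D+1) / ((2*real D+1) * (fact D)\<^sup>2)) has_vector_derivative (v ^ D / fact D)\<^sup>2) (at v within {-w..w})"
      by (simp add: has_real_derivative_iff_has_vector_derivative)
  qed (use w1 in auto)
  have ip: "set_integrable lborel {-w..w} (\<lambda>v. (v ^ D / fact D)\<^sup>2)"
    by (intro borel_integrable_atLeastAtMost' continuous_intros) auto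
  define K where "K = 2 * w / (2 * real D + 1) * (w ^ D / fact D)\<^sup>2"
  have K0: "K > 0" unfolding K_def using w1 by (intro mult_pos_pos divide_pos_pos zero_less_power) auto
  have "(LINT v:{-w..w}|lborel. (cmod (k v))\<^sup>2) \<le> (LINT v:{-w..w}|lborel. (v ^ D / fact D)\<^sup>2)"
  proof (rule set_integral_mono[OF _ ip])
    show "set_integrable lborel {-w..w} (\<lambda>v. (cmod (k v))\<^sup>2)"
      by (intro borel_integrable_atLeastAtMost' continuous_intros continuous_on_subset[OF ck]) auto
    fix v
    have "(cmod (k v))\<^sup>2 \<le> (\<bar>v\<bar> ^ D / fact D)\<^sup>2" using kb by (intro power_mono) auto
    then show "(cmod (k v))\<^sup>2 \<le> (v ^ D / fact D)\<^sup>2" by (simp add: power_divide power_even_abs flip: power_abs)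
  qed
  also have "\<dots> = w ^ (2*D+1) / ((2*real D+1) * (fact D)\<^sup>2) - (-w) ^ (2*D+1) / ((2*real D+1) * (fact D)\<^sup>2)"
    using set_borel_integral_eq_integral(2)[OF ip] integral_unique[OF hi] by simp
  also have "\<dots> = K"
  proof -
    have "w ^ (2*D+1) = w * (w ^ D)\<^sup>2" "(-w) ^ (2*D+1) = - (w * (w ^ D)\<^sup>2)"
      by (simp_all add: power_mult[symmetric] mult.commute)
    then show ?thesis unfolding K_def by (simp only: power_divide) (simp add: mult_ac)
  qed
  finally have Kle: "(LINT v:{-w..w}|lborel. (cmod (k v))\<^sup>2) \<le> K" .
  define T where "T m v = band_transform (\<phi> j) v * ((\<i> * complex_of_real v) ^ m / fact m)" for m v
  have iT: "set_integrable lborel {-w..w} (T m)" for m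
    unfolding T_def[abs_def] by (intro set_integrable_band_transform_mult_continuous continuous_intros) auto
  have re: "Re (complex_of_real r * z) = Re z * r" for r z by simp
  have "(LINT v:{-w..w}|lborel. band_transform (\<phi> j) v * k v)
     = (LINT v:{-w..w}|lborel. band_transform (\<phi> j) v * cis (v * x) - (\<Sum>m<D. complex_of_real (x ^ m) * T m v))"
    unfolding k_def T_def by (simp add: right_diff_distrib sum_distrib_left mult_ac)
  also have "\<dots> = (LINT v:{-w..w}|lborel. band_transform (\<phi> j) v * cis (v * x))
     - (LINT v:{-w..w}|lborel. (\<Sum>m<D. complex_of_real (x ^ m) * T m v))"
    by (intro set_integral_diff set_integrable_band_transform_mult_continuous set_integral_sum_fun set_integrable_mult_right iT)
       (intro continuous_intros)
  also have "(LINT v:{-w..w}|lborel. (\<Sum>m<D. complex_of_real (x ^ m) * T m v))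
     = (\<Sum>m<D. LINT v:{-w..w}|lborel. complex_of_real (x ^ m) * T m v)"
    by (intro set_integral_sum_fun set_integrable_mult_right iT)
  finally have "C * (LINT v:{-w..w}|lborel. band_transform (\<phi> j) v * k v) = complex_of_real (\<phi> j x)
      - (\<Sum>m<D. complex_of_real (x ^ m) * (C * (LINT v:{-w..w}|lborel. T m v)))"
    unfolding slepian_phi_eq_band_integral[of j x] C_def[symmetric]
    by (simp add: right_diff_distrib sum_distrib_left mult_ac)
  then have "Re (C * (LINT v:{-w..w}|lborel. band_transform (\<phi> j) v * k v)) = \<phi> j x - (\<Sum>m<D. a m * x ^ m)"
    unfolding a_def C_def[symmetric] T_def[symmetric]
    by (simp only: minus_complex.sel Re_complex_of_real Re_sum re)
  then have "(\<phi> j x - (\<Sum>m<D. a m * x ^ m))\<^sup>2 \<le> (cmod (C * (LINT v:{-w..w}|lborel. band_transform (\<phi> j) v * k v)))\<^sup>2"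
    by (metis abs_Re_le_cmod abs_ge_zero power2_abs power_mono)
  also have "\<dots> \<le> K / (pi * \<mu> j)" unfolding C_def by (rule slepian_band_pairing_bound[OF ck Kle K0])
  finally show ?thesis by (simp add: K_def mult_ac)
qed

text \<open>By n^n \<le> 3^n n! the eigenvalue factor is at most (6J)^J / 2 and the Taylor factor at
  most (3w/D)^D \<le> (3/(4J))^(4J). The degree 4wJ thus sets J^(-4J) against J^J, and 6J (3/(4J))^4
  \<le> 1/4 for J \<ge> 2.\<close>

lemma taylor_tail_bound:
  fixes j D :: nat
  defines "J \<equiv> real (Suc j)"
  assumes j: "j \<ge> 1" and D: "4 * w * J \<le> real D"
  shows "J * ((2 * J\<^sup>2) ^ j / fact j) * (w ^ D / fact D) \<le> 1 / 8"
proof -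
  have J: "J \<ge> 2" using j by (simp add: J_def)
  have e3: "exp 1 \<le> (3::real)" by (rule exp_le)
  have ef: "real n ^ n \<le> 3 ^ n * fact n" for n
  proof -
    have "real n ^ n \<le> exp 1 ^ n * fact n" by (rule power_self_le_exp_fact)
    also have "\<dots> \<le> 3 ^ n * fact n" by (intro mult_right_mono power_mono e3) auto
    finally show ?thesis .
  qed
  have "J * ((2 * J\<^sup>2) ^ j / fact j) = (2 * J\<^sup>2) ^ Suc j / (2 * fact (Suc j))"
    using J by (simp add: J_def power2_eq_square del: of_nat_Suc)
  also have "\<dots> = (2 * J) ^ Suc j / 2 * (J ^ Suc j / fact (Suc j))"
    by (simp add: power2_eq_square power_mult_distrib)
  also have "\<dots> \<le> (2 * J) ^ Suc j / 2 * 3 ^ Suc j"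
    using ef[of "Suc j"] J unfolding J_def[symmetric]
    by (intro mult_left_mono) (auto simp: divide_le_eq)
  also have "\<dots> = (6 * J) ^ Suc j / 2"
  proof -
    have "6 * J = 2 * J * 3" by simp
    then show ?thesis by (simp only: power_mult_distrib) simp
  qed
  finally have 1: "J * ((2 * J\<^sup>2) ^ j / fact j) \<le> (6 * J) ^ Suc j / 2" .
  have D0: "real D > 0" using D J w1 by (smt (verit) mult_pos_pos)
  have "w ^ D / fact D \<le> (3 * w / real D) ^ D"
  proof -
    have "w ^ D / fact D = w ^ D * (real D ^ D / fact D) / real D ^ D" using D0 by simp
    also have "\<dots> \<le> w ^ D * 3 ^ D / real D ^ D"
      using ef[of D] w1 by (intro divide_right_mono mult_left_mono) (auto simp: divide_le_eq)
    also have "\<dots> = (3 * w / real D) ^ D" by (simp add: power_mult_distrib power_divide mult.commute)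
    finally show ?thesis .
  qed
  also have "\<dots> \<le> (3 / (4 * J)) ^ D"
  proof (rule power_mono)
    have "3 * w * (4 * J) \<le> 3 * real D" using D by (simp add: mult_ac)
    then show "3 * w / real D \<le> 3 / (4 * J)" using D0 J by (simp add: divide_simps mult_ac)
  qed (use w1 in auto)
  also have "\<dots> \<le> (3 / (4 * J)) ^ (4 * Suc j)"
  proof (rule power_decreasing)
    have "4 * 1 * J \<le> 4 * w * J" using w1 J by (intro mult_right_mono mult_left_mono) auto
    then have "real (4 * Suc j) \<le> real D" using D by (simp add: J_def)
    then show "4 * Suc j \<le> D" by (simp only: of_nat_le_iff)
  qed (use J in auto)
  finally have 2: "w ^ D / fact D \<le> ((3 / (4 * J)) ^ 4) ^ Suc j" by (simp only: power_mult)
  have "J * ((2 * J\<^sup>2) ^ j / fact j) * (w ^ D / fact D) \<le> (6 * J) ^ Suc j / 2 * ((3 / (4 * J)) ^ 4) ^ Suc j"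
    using 1 2 w1 J by (intro mult_mono) auto
  also have "\<dots> = (6 * J * (3 / (4 * J)) ^ 4) ^ Suc j / 2"
    by (simp only: power_mult_distrib[of "6 * J"] times_divide_eq_left)
  also have "\<dots> \<le> (1 / 4) ^ Suc j / 2"
  proof (intro divide_right_mono power_mono)
    have "2 ^ 3 \<le> J ^ 3" using J by (intro power_mono) auto
    then show "6 * J * (3 / (4 * J)) ^ 4 \<le> 1 / 4"
      using J by (simp add: divide_simps power_divide power_mult_distrib power4_eq_xxxx power3_eq_cube)
  qed (use J in auto)
  also have "\<dots> \<le> (1 / 4) ^ 1 / 2"
    by (intro divide_right_mono power_decreasing) auto
  finally show ?thesis by simp
qed

lemma sum_squares_Suc: "(\<Sum>k<D. (real (Suc k))\<^sup>2) = real D * (real D + 1) * (2 * real D + 1) / 6"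
  by (induction D) (simp_all add: power2_eq_square field_simps)

text \<open>A polynomial p with about 4w(j+1) coefficients is within 1/10 of \<open>\<phi> j\<close>
  on [-1,1], so the integral of p^2 is at most 2.42. \<open>poly_Nikolskii\<close> then gives p^2
  \<le> 58 y^3 with y = w(j+1), and the passage back to \<open>\<phi> j\<close> raises 58 to
  72.\<close>

lemma slepian_phi_sq_le:
  assumes j: "j \<ge> 1" and x: "x \<in> {-1..1}"
  shows "(\<phi> j x)\<^sup>2 \<le> 72 * (w * real (Suc j)) ^ 3"
proof -
  define J where "J = real (Suc j)"
  define y where "y = w * J"
  define D where "D = nat \<lceil>4 * y\<rceil>"
  define A where "A = (2 * J\<^sup>2) ^ j / fact j"
  have J: "J \<ge> 2" using j by (simp add: J_def)
  have y: "y \<ge> 2" unfolding y_def using w1 J mult_mono[of 1 w 2 J] by simp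
  have D: "4 * y \<le> real D" "real D \<le> 4 * y + 1" using y unfolding D_def by linarith+
  have D1: "D \<ge> 1" using D y by linarith
  define m where "m = pi * \<mu> j"
  have m: "m > 0" using slepian_mu_pos[OF sb w1, of j] by (simp add: m_def)
  have mA: "1 \<le> 2 * m * (J * A)\<^sup>2"
    using slepian_mu_lower_bound[OF sb w1, of j] unfolding m_def A_def J_def by (simp add: mult_ac)
  obtain a where a: "\<And>x. x \<in> {-1..1} \<Longrightarrow> (\<phi> j x - (\<Sum>m<D. a m * x ^ m))\<^sup>2 \<le> 2 * w / ((2 * real D + 1) * m) * (w ^ D / fact D)\<^sup>2"
  proof -
    have "\<exists>a. \<forall>x\<in>{-1..1}. (\<phi> j x - (\<Sum>m<D. a m * x ^ m))\<^sup>2 \<le> 2 * w / ((2 * real D + 1) * m) * (w ^ D / fact D)\<^sup>2"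
      unfolding m_def by (intro exI ballI, rule slepian_taylor_error[OF D1])
    then show ?thesis using that by blast
  qed
  define p where "p x = (\<Sum>m<D. a m * x ^ m)" for x
  \<comment> \<open>The eigenvalue bound gives 1/m \<le> 2 (J A)^2, the inequality 2D + 1 \<ge> 16w
    removes the factor w, and \<open>taylor_tail_bound\<close> leaves (1/8)^2 / 4.\<close>
  have bd: "2 * w / ((2 * real D + 1) * m) * (w ^ D / fact D)\<^sup>2 \<le> 1 / 100"
  proof -
    have "2 * w / ((2 * real D + 1) * m) \<le> (J * A)\<^sup>2 / 4"
    proof -
      have "2 * w * 1 \<le> 2 * w * (2 * m * (J * A)\<^sup>2)" using mA w1 by (intro mult_left_mono) auto
      also have "\<dots> = 16 * w * (m * (J * A)\<^sup>2 / 4)" by simp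
      also have "\<dots> \<le> (2 * real D + 1) * (m * (J * A)\<^sup>2 / 4)"
      proof (rule mult_right_mono)
        have "w * 2 \<le> y" unfolding y_def using w1 J by (intro mult_left_mono) auto
        then show "16 * w \<le> 2 * real D + 1" using D by linarith
      qed (use m in auto)
      finally show ?thesis using m by (simp add: divide_le_eq mult_ac)
    qed
    then have "2 * w / ((2 * real D + 1) * m) * (w ^ D / fact D)\<^sup>2 \<le> (J * A)\<^sup>2 / 4 * (w ^ D / fact D)\<^sup>2"
      by (intro mult_right_mono) auto
    also have "\<dots> = (J * A * (w ^ D / fact D))\<^sup>2 / 4"
      by (simp only: power_mult_distrib[of "J * A"] times_divide_eq_left)
    also have "\<dots> \<le> (1 / 8)\<^sup>2 / 4"
    proof (intro divide_right_mono power_mono)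
      have "4 * w * real (Suc j) \<le> real D" using D(1) by (simp add: y_def J_def mult_ac)
      from taylor_tail_bound[OF j this] show "J * A * (w ^ D / fact D) \<le> 1 / 8"
        unfolding A_def J_def .
    qed (use J w1 in \<open>auto simp: A_def\<close>)
    also have "\<dots> \<le> 1 / 100" by (simp add: power2_eq_square)
    finally show ?thesis .
  qed
  have err: "(\<phi> j x - p x)\<^sup>2 \<le> 1 / 100" if "x \<in> {-1..1}" for x
    using a[OF that] bd unfolding p_def by linarith
  have split: "(b + c)\<^sup>2 \<le> 11/10 * b\<^sup>2 + 11 * c\<^sup>2" for b c :: real
  proof -
    have "0 \<le> (b - 10 * c)\<^sup>2 / 10" by simp
    then show ?thesis by (simp add: power2_eq_square algebra_simps)
  qed
  have cp: "continuous_on {-1..1} (\<lambda>x. (p x)\<^sup>2)" unfolding p_def by (intro continuous_intros)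
  have ip: "set_integrable lborel {-1..1} (\<lambda>x. (p x)\<^sup>2)" by (rule borel_integrable_atLeastAtMost'[OF cp])
  have i2: "set_integrable lborel {-1..1} (\<lambda>x. (\<phi> j x)\<^sup>2)"
    using slepian_phi_sq_integrable[OF sb w1] by (simp add: sq_integrable_on_I_def)
  have "integral {-1..1} (\<lambda>x. (p x)\<^sup>2) = (LINT x:{-1..1}|lborel. (p x)\<^sup>2)"
    by (rule set_borel_integral_eq_integral(2)[OF ip, symmetric])
  also have "\<dots> \<le> (LINT x:{-1..1}|lborel. 11/10 * (\<phi> j x)\<^sup>2 + 11/100)"
  proof (rule set_integral_mono[OF ip])
    show "set_integrable lborel {-1..1} (\<lambda>x. 11/10 * (\<phi> j x)\<^sup>2 + 11/100)"
      using i2 set_integrable_const_I[of "-1" 1 "11/100::real"] by (intro set_integral_add) auto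
    fix x :: real assume "x \<in> {-1..1}"
    then have "(p x - \<phi> j x)\<^sup>2 \<le> 1 / 100" using err[of x] by (simp add: power2_commute)
    then show "(p x)\<^sup>2 \<le> 11/10 * (\<phi> j x)\<^sup>2 + 11/100" using split[of "\<phi> j x" "p x - \<phi> j x"] by simp
  qed
  also have "\<dots> = 11/10 * (LINT x:{-1..1}|lborel. (\<phi> j x)\<^sup>2) + 2 * (11/100)"
    using i2 set_integrable_const_I[of "-1" 1 "11/100::real"]
    by (subst set_integral_add) (auto simp: integral_const_I)
  also have "(LINT x:{-1..1}|lborel. (\<phi> j x)\<^sup>2) = 2"
    using slepian_phi_orth[OF sb w1, of j j] by (simp add: power2_eq_square)
  finally have P: "integral {-1..1} (\<lambda>x. (p x)\<^sup>2) \<le> 242 / 100" by simp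
  have "(p x)\<^sup>2 \<le> 2 / pi * (\<Sum>k<D. (real (Suc k))\<^sup>2) * integral {-1..1} (\<lambda>x. (p x)\<^sup>2)"
    unfolding p_def by (rule poly_Nikolskii[OF x])
  also have "\<dots> \<le> 2 / 3 * (\<Sum>k<D. (real (Suc k))\<^sup>2) * (242 / 100)"
    using P pi_gt3 by (intro mult_mono divide_left_mono integral_nonneg integrable_continuous_real cp sum_nonneg mult_nonneg_nonneg) auto
  \<comment> \<open>Since D \<le> 4y + 1 and y \<ge> 2, the factors D, D + 1 and 2D + 1 are at most
    9y/2, 5y and 19y/2.\<close>
  also have "(\<Sum>k<D. (real (Suc k))\<^sup>2) \<le> (9/2 * y) * (5 * y) * (19/2 * y) / 6"
    unfolding sum_squares_Suc using D y by (intro divide_right_mono mult_mono) auto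
  finally have "(p x)\<^sup>2 \<le> 2 / 3 * ((9/2 * y) * (5 * y) * (19/2 * y) / 6) * (242 / 100)" by simp
  also have "\<dots> = 2299 / 40 * y ^ 3" by (simp add: power3_eq_cube)
  also have "\<dots> \<le> 58 * y ^ 3" using y by (intro mult_right_mono) auto
  finally have px: "(p x)\<^sup>2 \<le> 58 * y ^ 3" .
  have "(\<phi> j x)\<^sup>2 \<le> 11/10 * (p x)\<^sup>2 + 11 * (\<phi> j x - p x)\<^sup>2" using split[of "p x" "\<phi> j x - p x"] by simp
  also have "\<dots> \<le> 11/10 * (58 * y ^ 3) + 11 * (1/100)"
    using px err[OF x] by (intro add_mono mult_left_mono) auto
  also have "\<dots> \<le> 72 * y ^ 3"
  proof -
    have "(2::real) ^ 3 \<le> y ^ 3" using y by (intro power_mono) auto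
    then show ?thesis by simp
  qed
  finally show ?thesis by (simp add: y_def J_def)
qed

end

section \<open>Sampling from the cube\<close>

text \<open>For u = -v < 0 this comes from (1 - v + v^2)(1 + v) = 1 + v^3 \<ge> 1 and 1 + v \<le>
  exp v.\<close>

lemma exp_le_quadratic:
  fixes u :: real
  assumes "\<bar>u\<bar> \<le> 1"
  shows "exp u \<le> 1 + u + u\<^sup>2"
proof (cases "u \<ge> 0")
  case True
  then show ?thesis using assms exp_bound[of u] by simp
next
  case False
  define v where "v = - u"
  have v: "0 \<le> v" using False by (simp add: v_def)
  have "1 \<le> (1 - v + v\<^sup>2) * (1 + v)"
  proof -
    have "(1 - v + v\<^sup>2) * (1 + v) = 1 + v ^ 3" by (simp add: power2_eq_square power3_eq_cube algebra_simps)
    then show ?thesis using v by simp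
  qed
  also have "\<dots> \<le> (1 - v + v\<^sup>2) * exp v"
  proof (rule mult_left_mono[OF exp_ge_add_one_self])
    have "v \<le> 1" using assms False by (simp add: v_def)
    then show "0 \<le> 1 - v + v\<^sup>2" by (simp add: add_nonneg_nonneg)
  qed
  finally have "exp (- v) \<le> 1 - v + v\<^sup>2" by (simp add: exp_minus field_simps)
  then show ?thesis by (simp add: v_def)
qed

text \<open>Exponential moments at s = t/(2b), the minimiser of s^2 b - s t; t \<le> 2 ensures |s X|
  \<le> 1, as \<open>exp_le_quadratic\<close> requires. One b bounds both the variables and their
  second moments, as is natural for products of two bounded orthonormal functions.\<close>

lemma (in prob_space) bernstein_upper_tail:
  fixes X :: "nat \<Rightarrow> 'a \<Rightarrow> real"
  assumes ind: "indep_vars (\<lambda>_. borel) X {..<m}"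
    and bd: "\<And>i \<omega>. i < m \<Longrightarrow> \<omega> \<in> space M \<Longrightarrow> \<bar>X i \<omega>\<bar> \<le> b"
    and mean: "\<And>i. i < m \<Longrightarrow> expectation (X i) = p"
    and second: "\<And>i. i < m \<Longrightarrow> expectation (\<lambda>\<omega>. (X i \<omega>)\<^sup>2) \<le> b"
    and b: "b > 0" and t: "0 < t" "t \<le> 2"
  shows "prob {\<omega>\<in>space M. (\<Sum>i<m. X i \<omega>) \<ge> real m * (p + t)} \<le> exp (- real m * t\<^sup>2 / (4 * b))"
proof -
  define s where "s = t / (2 * b)"
  have s: "s > 0" using b t by (simp add: s_def)
  have rv [measurable]: "X i \<in> borel_measurable M" if "i < m" for i
    using ind that by (auto simp: indep_vars_def)
  have sX: "\<bar>s * X i \<omega>\<bar> \<le> 1" if "i < m" "\<omega> \<in> space M" for i \<omega>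
  proof -
    have "\<bar>s * X i \<omega>\<bar> \<le> s * b" unfolding abs_mult using bd[OF that] s by (simp add: mult_left_mono)
    also have "\<dots> \<le> 1" using b t by (simp add: s_def)
    finally show ?thesis .
  qed
  have int: "integrable M (X i)" "integrable M (\<lambda>\<omega>. (X i \<omega>)\<^sup>2)" "integrable M (\<lambda>\<omega>. exp (s * X i \<omega>))"
    if i: "i < m" for i
  proof -
    note [measurable] = rv[OF i]
    show "integrable M (X i)" by (rule integrable_const_bound[of _ b]) (use bd[OF i] in auto)
    show "integrable M (\<lambda>\<omega>. (X i \<omega>)\<^sup>2)"
    proof (rule integrable_const_bound[of _ "b\<^sup>2"])
      have "(X i \<omega>)\<^sup>2 \<le> b\<^sup>2" if "\<omega> \<in> space M" for \<omega>
        using bd[OF i that] b by (metis abs_le_square_iff abs_of_pos)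
      then show "AE \<omega> in M. norm ((X i \<omega>)\<^sup>2) \<le> b\<^sup>2" by simp
    qed measurable
    show "integrable M (\<lambda>\<omega>. exp (s * X i \<omega>))"
    proof (rule integrable_const_bound[of _ "exp 1"])
      have "s * X i \<omega> \<le> 1" if "\<omega> \<in> space M" for \<omega> using sX[OF i that] by linarith
      then show "AE \<omega> in M. norm (exp (s * X i \<omega>)) \<le> exp 1" by simp
    qed measurable
  qed
  have mgf: "expectation (\<lambda>\<omega>. exp (s * X i \<omega>)) \<le> exp (s * p + s\<^sup>2 * b)" if i: "i < m" for i
  proof -
    have "expectation (\<lambda>\<omega>. exp (s * X i \<omega>)) \<le> expectation (\<lambda>\<omega>. 1 + s * X i \<omega> + s\<^sup>2 * (X i \<omega>)\<^sup>2)"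
      using int[OF i] exp_le_quadratic[OF sX[OF i]]
      by (intro integral_mono) (auto simp: power_mult_distrib)
    also have "\<dots> = 1 + s * p + s\<^sup>2 * expectation (\<lambda>\<omega>. (X i \<omega>)\<^sup>2)"
      using int[OF i] mean[OF i] by (simp add: prob_space)
    also have "\<dots> \<le> 1 + (s * p + s\<^sup>2 * b)" using second[OF i] by (simp add: mult_left_mono)
    also have "\<dots> \<le> exp (s * p + s\<^sup>2 * b)" by (rule exp_ge_add_one_self)
    finally show ?thesis .
  qed
  have ind_exp: "indep_vars (\<lambda>_. borel) (\<lambda>i \<omega>. exp (s * X i \<omega>)) {..<m}"
    by (rule indep_vars_compose2[OF ind, of "\<lambda>_ x. exp (s * x)"]) measurable
  have eq: "exp (s * (\<Sum>i<m. X i \<omega>)) = (\<Prod>i<m. exp (s * X i \<omega>))" for \<omega>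
    by (simp add: sum_distrib_left exp_sum)
  have E: "integrable M (\<lambda>\<omega>. exp (s * (\<Sum>i<m. X i \<omega>)))"
    "expectation (\<lambda>\<omega>. exp (s * (\<Sum>i<m. X i \<omega>))) = (\<Prod>i<m. expectation (\<lambda>\<omega>. exp (s * X i \<omega>)))"
    unfolding eq using int(3)
    by (auto intro!: indep_vars_integrable[OF _ ind_exp] indep_vars_lebesgue_integral[OF _ ind_exp])
  have "prob {\<omega>\<in>space M. (\<Sum>i<m. X i \<omega>) \<ge> real m * (p + t)}
      \<le> exp (- s * (real m * (p + t))) * expectation (\<lambda>\<omega>. exp (s * (\<Sum>i<m. X i \<omega>)))"
  proof -
    have si: "set_integrable M (space M) (\<lambda>\<omega>. exp (s * (\<Sum>i<m. X i \<omega>)))"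
      unfolding set_integrable_def by (rule integrable_mult_indicator[OF sets.top E(1)])
    show ?thesis
      using Chernoff_ineq_ge[OF s si, of "real m * (p + t)"] set_integral_space[OF E(1)] by simp
  qed
  also have "\<dots> \<le> exp (- s * (real m * (p + t))) * (\<Prod>i<m. exp (s * p + s\<^sup>2 * b))"
    unfolding E(2) by (intro mult_left_mono prod_mono conjI mgf integral_nonneg) auto
  also have "\<dots> = exp (real m * (s\<^sup>2 * b - s * t))"
    by (simp add: exp_of_nat_mult[symmetric] exp_add[symmetric] algebra_simps)
  also have "s\<^sup>2 * b - s * t = - t\<^sup>2 / (4 * b)"
    using b by (simp add: s_def power2_eq_square field_simps)
  finally show ?thesis by simp
qed

section \<open>Product integrals and the uniform measure on the cube\<close>

text \<open>Lebesgue measure on vectors is an image of the product measure indexed by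
  \<open>Basis\<close>; the bijection from coordinates to unit vectors moves the product formula to
  coordinates.\<close>

lemma integral_lborel_vec_prod:
  fixes f :: "'d::finite \<Rightarrow> real \<Rightarrow> real"
  assumes f: "\<And>k. integrable lborel (f k)"
  shows "(LINT x|(lborel :: (real ^ 'd) measure). (\<Prod>k\<in>UNIV. f k (x $ k))) = (\<Prod>k\<in>UNIV. LINT t|lborel. f k t)"
proof -
  define e where "e k = (axis k 1 :: real ^ 'd)" for k
  have inj: "inj e" unfolding e_def by (auto simp: inj_on_def axis_eq_axis)
  have B: "(Basis :: (real ^ 'd) set) = range e" by (auto simp: Basis_vec_def e_def)
  have [measurable]: "f k \<in> borel_measurable borel" for k using f[of k] by auto
  have comp: "(\<Sum>b\<in>Basis. g b *\<^sub>R b) $ k = g (e k)" for g and k :: 'd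
  proof -
    have "(\<Sum>b\<in>Basis. g b *\<^sub>R b) $ k = (\<Sum>b\<in>Basis. g b *\<^sub>R b) \<bullet> e k"
      by (simp add: cart_eq_inner_axis e_def)
    also have "\<dots> = g (e k)" by (rule inner_sum_left_Basis) (simp add: B)
    finally show ?thesis .
  qed
  interpret product_sigma_finite "\<lambda>_ :: real ^ 'd. lborel :: real measure" ..
  have "(LINT x|(lborel :: (real ^ 'd) measure). (\<Prod>k\<in>UNIV. f k (x $ k)))
     = (LINT g|(\<Pi>\<^sub>M b\<in>(Basis :: (real ^ 'd) set). lborel). (\<Prod>k\<in>UNIV. f k ((\<Sum>b\<in>Basis. g b *\<^sub>R b) $ k)))"
    by (subst lborel_eq, subst integral_distr) (auto simp: comp)
  also have "\<dots> = (LINT g|(\<Pi>\<^sub>M b\<in>(Basis :: (real ^ 'd) set). lborel). (\<Prod>b\<in>Basis. f (inv e b) (g b)))"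
    unfolding comp by (subst B, subst prod.reindex[OF inj]) (simp add: inj)
  also have "\<dots> = (\<Prod>b\<in>Basis. LINT t|lborel. f (inv e b) t)"
    by (rule product_integral_prod) (auto intro: f)
  also have "\<dots> = (\<Prod>k\<in>UNIV. LINT t|lborel. f k t)"
    by (subst B, subst prod.reindex[OF inj]) (simp add: inj)
  finally show ?thesis .
qed

lemma mem_cube_iff: "x \<in> cube \<longleftrightarrow> (\<forall>k. x $ k \<in> {-1..1})"
  by (auto simp: cube_def mem_box_cart)

lemma indicator_cube: "indicator cube x = (\<Prod>k\<in>UNIV. indicator {-1..1} (x $ k) :: real)"
proof (cases "x \<in> cube")
  case True
  then show ?thesis by (simp add: mem_cube_iff)
next
  case False
  then obtain k where "x $ k \<notin> {-1..1}" by (auto simp: mem_cube_iff)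
  then have "(\<Prod>k\<in>UNIV. indicator {-1..1} (x $ k) :: real) = 0"
    by (intro prod_zero) (auto intro: exI[of _ k])
  then show ?thesis using False by simp
qed

lemma cube_measurable [measurable]: "cube \<in> sets borel"
  by (simp add: cube_def)

lemma emeasure_cube: "emeasure lborel (cube :: (real ^ 'd) set) = ennreal (2 ^ CARD('d))"
proof -
  have "emeasure lborel (cube :: (real ^ 'd) set) = (\<Prod>b\<in>(Basis :: (real ^ 'd) set). ((\<chi> i. 1) - (\<chi> i. -1)) \<bullet> b)"
    unfolding cube_def by (intro emeasure_lborel_cbox) (auto simp: Basis_vec_def inner_axis)
  also have "(\<Prod>b\<in>(Basis :: (real ^ 'd) set). ((\<chi> i. 1) - (\<chi> i. -1)) \<bullet> b) = (\<Prod>b\<in>(Basis :: (real ^ 'd) set). 2)"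
    by (intro prod.cong) (auto simp: Basis_vec_def inner_axis)
  also have "\<dots> = 2 ^ CARD('d)" by (simp add: DIM_cart)
  finally show ?thesis .
qed

lemma prob_space_unif: "prob_space unif"
  unfolding unif_def by (intro prob_space_uniform_measure) (auto simp: emeasure_cube)

lemma sets_unif [measurable_cong, simp]: "sets unif = sets borel"
  by (simp add: unif_def)

lemma AE_unif_cube: "AE x in unif. x \<in> cube"
  unfolding unif_def by (intro AE_uniform_measureI) auto

lemma integral_unif:
  fixes F :: "real ^ 'd \<Rightarrow> real"
  assumes "F \<in> borel_measurable borel"
  shows "(LINT x|unif. F x) = (LINT x:cube|lborel. F x) / 2 ^ CARD('d)"
proof -
  have d: "unif = density lborel (\<lambda>x :: real ^ 'd. ennreal (indicator cube x / 2 ^ CARD('d)))"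
    unfolding unif_def uniform_measure_def emeasure_cube
    by (intro arg_cong[where f = "density lborel"] ext) (auto simp: indicator_def divide_ennreal ennreal_1[symmetric] simp del: ennreal_1)
  have "(LINT x|unif. F x) = (LINT x|lborel. (indicator cube x / 2 ^ CARD('d)) *\<^sub>R F x)"
    unfolding d using assms by (subst integral_density) auto
  then show ?thesis by (simp add: set_lebesgue_integral_def)
qed

section \<open>Concentration of the sampled Gram matrix\<close>

lemma cmod_sum_sq:
  "(cmod (\<Sum>i\<in>L. c i * complex_of_real (r i)))\<^sup>2 = (\<Sum>i\<in>L. \<Sum>k\<in>L. Re (c i * cnj (c k)) * (r i * r k))"
proof -
  have "complex_of_real ((cmod (\<Sum>i\<in>L. c i * complex_of_real (r i)))\<^sup>2)
      = (\<Sum>i\<in>L. \<Sum>k\<in>L. (c i * cnj (c k)) * complex_of_real (r i * r k))"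
    unfolding complex_norm_square by (simp add: sum_product mult_ac)
  from arg_cong[OF this, of Re] show ?thesis
    unfolding Re_complex_of_real Re_sum by simp
qed

text \<open>An error t in every entry costs t times the square of the sum of all |c i|, and by
  Cauchy-Schwarz that square is at most \<open>card L\<close> times the sum of squares. On the
  diagonal an excess only helps, so one side is bounded there.\<close>

lemma gram_quadratic_form_ge:
  fixes c :: "'i \<Rightarrow> complex" and G :: "'i \<Rightarrow> 'i \<Rightarrow> real"
  assumes L: "finite L" and t: "t \<ge> 0"
    and diag: "\<And>i. i \<in> L \<Longrightarrow> 1 - t \<le> G i i"
    and off: "\<And>i k. i \<in> L \<Longrightarrow> k \<in> L \<Longrightarrow> i \<noteq> k \<Longrightarrow> \<bar>G i k\<bar> \<le> t"
  shows "(1 - t * real (card L)) * (\<Sum>i\<in>L. (cmod (c i))\<^sup>2) \<le> (\<Sum>i\<in>L. \<Sum>k\<in>L. Re (c i * cnj (c k)) * G i k)"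
proof -
  define a where "a i = cmod (c i)" for i
  have a0: "a i \<ge> 0" for i by (simp add: a_def)
  have "(\<Sum>i\<in>L. a i)\<^sup>2 \<le> (\<Sum>i\<in>L. (a i)\<^sup>2) * real (card L)"
    using Cauchy_Schwarz_ineq_sum[of a "\<lambda>_. 1" L] by simp
  then have "(1 - t * real (card L)) * (\<Sum>i\<in>L. (a i)\<^sup>2) \<le> (\<Sum>i\<in>L. (a i)\<^sup>2) - t * (\<Sum>i\<in>L. a i)\<^sup>2"
    using mult_left_mono[OF _ t] by (fastforce simp: algebra_simps)
  also have "\<dots> = (\<Sum>i\<in>L. \<Sum>k\<in>L. (if i = k then (a i)\<^sup>2 else 0) - t * (a i * a k))"
  proof -
    have "(\<Sum>i\<in>L. a i)\<^sup>2 = (\<Sum>i\<in>L. \<Sum>k\<in>L. a i * a k)"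
      unfolding power2_eq_square sum_product ..
    then show ?thesis using L by (simp add: sum_subtractf sum_distrib_left)
  qed
  also have "\<dots> \<le> (\<Sum>i\<in>L. \<Sum>k\<in>L. Re (c i * cnj (c k)) * G i k)"
  proof (intro sum_mono)
    fix i k assume ik: "i \<in> L" "k \<in> L"
    show "(if i = k then (a i)\<^sup>2 else 0) - t * (a i * a k) \<le> Re (c i * cnj (c k)) * G i k"
    proof (cases "i = k")
      case True
      have "Re (c k * cnj (c k)) = (a k)\<^sup>2"
        unfolding a_def complex_norm_square[symmetric] by (rule Re_complex_of_real)
      moreover have "(a k)\<^sup>2 * (1 - t) \<le> (a k)\<^sup>2 * G k k" using diag[OF ik(2)] by (intro mult_left_mono) auto
      ultimately show ?thesis using True by (simp add: power2_eq_square algebra_simps)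
    next
      case False
      have "\<bar>Re (c i * cnj (c k)) * G i k\<bar> \<le> (a i * a k) * t"
        unfolding abs_mult using off[OF ik False] abs_Re_le_cmod[of "c i * cnj (c k)"]
        by (intro mult_mono) (auto simp: norm_mult a_def)
      then show ?thesis using False by (simp add: algebra_simps abs_le_iff)
    qed
  qed
  finally show ?thesis unfolding a_def .
qed

text \<open>A product of two of the functions is bounded by b and has second moment at most b, one
  factor being bounded and the other normalised, so \<open>bernstein_upper_tail\<close> treats all
  entries with the same constant. The bad events concern matrix entries alone; outside them the
  inequality holds for all coefficient vectors c at once.\<close>

lemma (in prob_space) gram_concentration:
  fixes u :: "'i \<Rightarrow> 'b::topological_space \<Rightarrow> real" and Y :: "nat \<Rightarrow> 'a \<Rightarrow> 'b"
  assumes L: "finite L"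
    and u [measurable]: "\<And>i. u i \<in> borel_measurable borel"
    and bd: "\<And>i x. i \<in> L \<Longrightarrow> (u i x)\<^sup>2 \<le> b"
    and U: "prob_space U" "sets U = sets borel"
    and orth: "\<And>i k. i \<in> L \<Longrightarrow> k \<in> L \<Longrightarrow> (LINT x|U. u i x * u k x) = (if i = k then 1 else 0)"
    and ind: "indep_vars (\<lambda>_. borel) Y {..<m}"
    and Y: "\<And>j. j < m \<Longrightarrow> distr M borel (Y j) = U"
    and t: "0 < t" "t \<le> 2" and b: "b > 0" and m: "m > 0"
  shows "\<exists>E\<in>events. prob E \<ge> 1 - (real (card L))\<^sup>2 * exp (- real m * t\<^sup>2 / (4 * b)) \<and>
    (\<forall>\<omega>\<in>E. \<forall>c. (1 - t * real (card L)) * (\<Sum>i\<in>L. (cmod (c i))\<^sup>2)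
       \<le> (1 / real m) * (\<Sum>j<m. (cmod (\<Sum>i\<in>L. c i * complex_of_real (u i (Y j \<omega>))))\<^sup>2))"
proof -
  interpret U: prob_space U by (rule U(1))
  note U(2) [measurable_cong]
  have rv [measurable]: "Y j \<in> borel_measurable M" if "j < m" for j
    using ind that by (auto simp: indep_vars_def)
  have expY: "expectation (\<lambda>\<omega>. F (Y j \<omega>)) = (LINT x|U. F x)"
    if j: "j < m" and F [measurable]: "F \<in> borel_measurable borel" for j and F :: "'b \<Rightarrow> real"
    using integral_distr[OF rv[OF j] F] Y[OF j] by simp
  obtain e :: "'i \<Rightarrow> nat" where e: "inj_on e L"
    using finite_imp_inj_to_nat_seg[OF L] by blast
  text \<open>The diagonal needs only the lower tail, so one event per ordered pair suffices: both signs
    occur off the diagonal.\<close>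
  define sg where "sg i k = (if e i < e k then 1 else -1 :: real)" for i k
  define X where "X i k j \<omega> = sg i k * (u i (Y j \<omega>) * u k (Y j \<omega>))" for i k j \<omega>
  define p where "p i k = sg i k * (if i = k then 1 else 0)" for i k
  define Bad where "Bad i k = {\<omega>\<in>space M. (\<Sum>j<m. X i k j \<omega>) \<ge> real m * (p i k + t)}" for i k
  have sg2: "sg i k * sg i k = 1" "\<bar>sg i k\<bar> = 1" for i k by (auto simp: sg_def)
  have rvX [measurable]: "X i k j \<in> borel_measurable M" if "j < m" for i k j
    unfolding X_def using rv[OF that] by measurable
  have ub: "\<bar>u i x\<bar> \<le> sqrt b" if "i \<in> L" for i x using bd[OF that, of x] by (simp add: real_le_rsqrt)
  have uu: "\<bar>u i x * u k x\<bar> \<le> b" if "i \<in> L" "k \<in> L" for i k x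
  proof -
    have "\<bar>u i x * u k x\<bar> \<le> sqrt b * sqrt b"
      unfolding abs_mult using ub that b by (intro mult_mono) auto
    then show ?thesis using b by simp
  qed
  have iu2: "integrable U (\<lambda>x. u k x * u k x)" if "k \<in> L" for k
    by (rule U.integrable_const_bound[of _ b]) (use uu[OF that that] in auto)
  have badm [measurable]: "Bad i k \<in> events" for i k unfolding Bad_def by measurable
  have badp: "prob (Bad i k) \<le> exp (- real m * t\<^sup>2 / (4 * b))" if ik: "i \<in> L" "k \<in> L" for i k
    unfolding Bad_def
  proof (rule bernstein_upper_tail)
    have "indep_vars (\<lambda>_. borel) (\<lambda>j \<omega>. sg i k * (u i (Y j \<omega>) * u k (Y j \<omega>))) {..<m}"
      by (rule indep_vars_compose2[OF ind, of "\<lambda>_ y. sg i k * (u i y * u k y)"]) measurable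
    then show "indep_vars (\<lambda>_. borel) (X i k) {..<m}" by (simp add: X_def[abs_def])
    show "\<bar>X i k j \<omega>\<bar> \<le> b" for j \<omega>
      using uu[OF ik, of "Y j \<omega>"] sg2(2)[of i k] by (simp add: X_def abs_mult)
    show "expectation (X i k j) = p i k" if "j < m" for j
      using expY[OF that, of "\<lambda>x. u i x * u k x"] orth[OF ik] by (simp add: X_def[abs_def] p_def)
    show "expectation (\<lambda>\<omega>. (X i k j \<omega>)\<^sup>2) \<le> b" if "j < m" for j
    proof -
      have "(X i k j \<omega>)\<^sup>2 = (sg i k * sg i k) * (u i (Y j \<omega>) * u k (Y j \<omega>))\<^sup>2" for \<omega>
        by (simp add: X_def power2_eq_square)
      then have "expectation (\<lambda>\<omega>. (X i k j \<omega>)\<^sup>2) = (LINT x|U. (u i x * u k x)\<^sup>2)"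
        using expY[OF that, of "\<lambda>x. (u i x * u k x)\<^sup>2"] by (simp add: sg2)
      also have "\<dots> \<le> (LINT x|U. b * (u k x * u k x))"
      proof (rule integral_mono')
        show "integrable U (\<lambda>x. b * (u k x * u k x))" using iu2[OF ik(2)] by simp
        show "(u i x * u k x)\<^sup>2 \<le> b * (u k x * u k x)" for x
        proof -
          have "(u i x)\<^sup>2 * (u k x)\<^sup>2 \<le> b * (u k x)\<^sup>2" using bd[OF ik(1)] by (intro mult_right_mono) auto
          then show ?thesis by (simp add: power_mult_distrib power2_eq_square mult_ac)
        qed
      qed (use b in auto)
      also have "\<dots> = b" using orth[OF ik(2) ik(2)] by simp
      finally show ?thesis .
    qed
  qed (use b t in auto)
  define E where "E = space M - (\<Union>(i, k)\<in>L \<times> L. Bad i k)"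
  have Em: "(\<Union>(i, k)\<in>L \<times> L. Bad i k) \<in> events" using L by (intro sets.finite_UN) auto
  have "prob (\<Union>(i, k)\<in>L \<times> L. Bad i k) \<le> (\<Sum>(i, k)\<in>L \<times> L. prob (Bad i k))"
    using finite_measure_subadditive_finite[of "L \<times> L" "\<lambda>(i, k). Bad i k"] L
    by (auto simp: case_prod_beta image_subset_iff)
  also have "\<dots> \<le> (\<Sum>(i, k)\<in>L \<times> L. exp (- real m * t\<^sup>2 / (4 * b)))"
    using badp by (intro sum_mono) auto
  also have "\<dots> = (real (card L))\<^sup>2 * exp (- real m * t\<^sup>2 / (4 * b))"
    by (simp add: card_cartesian_product power2_eq_square case_prod_beta)
  finally have "1 - (real (card L))\<^sup>2 * exp (- real m * t\<^sup>2 / (4 * b)) \<le> prob E"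
    unfolding E_def using prob_compl[OF Em] by simp
  moreover have "E \<in> events" unfolding E_def using Em by auto
  moreover have "(1 - t * real (card L)) * (\<Sum>i\<in>L. (cmod (c i))\<^sup>2)
       \<le> (1 / real m) * (\<Sum>j<m. (cmod (\<Sum>i\<in>L. c i * complex_of_real (u i (Y j \<omega>))))\<^sup>2)"
    if \<omega>: "\<omega> \<in> E" for \<omega> c
  proof -
    define G where "G i k = (1 / real m) * (\<Sum>j<m. u i (Y j \<omega>) * u k (Y j \<omega>))" for i k
    have good: "sg i k * G i k < p i k + t" if "i \<in> L" "k \<in> L" for i k
    proof -
      have "\<omega> \<notin> Bad i k" "\<omega> \<in> space M" using \<omega> that by (auto simp: E_def)
      then have "(\<Sum>j<m. X i k j \<omega>) < real m * (p i k + t)" by (auto simp: Bad_def)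
      moreover have "(\<Sum>j<m. X i k j \<omega>) = real m * (sg i k * G i k)"
        using m by (simp add: X_def G_def sum_distrib_left)
      ultimately show ?thesis using m by simp
    qed
    have sym: "G i k = G k i" for i k by (simp add: G_def mult.commute)
    have "(1 - t * real (card L)) * (\<Sum>i\<in>L. (cmod (c i))\<^sup>2) \<le> (\<Sum>i\<in>L. \<Sum>k\<in>L. Re (c i * cnj (c k)) * G i k)"
    proof (rule gram_quadratic_form_ge[OF L])
      show "1 - t \<le> G i i" if "i \<in> L" for i
        using good[OF that that] by (simp add: sg_def p_def)
      show "\<bar>G i k\<bar> \<le> t" if ik: "i \<in> L" "k \<in> L" "i \<noteq> k" for i k
      proof -
        have "e i \<noteq> e k" using e ik by (auto simp: inj_on_def)
        then consider "e i < e k" | "e k < e i" by linarith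
        then show ?thesis
          using good[OF ik(1,2)] good[OF ik(2,1)] ik(3) sym[of i k]
          by cases (auto simp: sg_def p_def abs_le_iff)
      qed
    qed (use t in auto)
    also have "\<dots> = (1 / real m) * (\<Sum>i\<in>L. \<Sum>k\<in>L. \<Sum>j<m. Re (c i * cnj (c k)) * (u i (Y j \<omega>) * u k (Y j \<omega>)))"
      unfolding G_def sum_distrib_left by (intro sum.cong refl) (simp only: mult.left_commute)
    also have "(\<Sum>i\<in>L. \<Sum>k\<in>L. \<Sum>j<m. Re (c i * cnj (c k)) * (u i (Y j \<omega>) * u k (Y j \<omega>)))
       = (\<Sum>i\<in>L. \<Sum>j<m. \<Sum>k\<in>L. Re (c i * cnj (c k)) * (u i (Y j \<omega>) * u k (Y j \<omega>)))"
      by (intro sum.cong refl sum.swap)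
    also have "\<dots> = (\<Sum>j<m. \<Sum>i\<in>L. \<Sum>k\<in>L. Re (c i * cnj (c k)) * (u i (Y j \<omega>) * u k (Y j \<omega>)))"
      by (rule sum.swap)
    finally show ?thesis unfolding cmod_sum_sq .
  qed
  ultimately show ?thesis by blast
qed

section \<open>Least squares\<close>

text \<open>Functions \<open>nat \<Rightarrow> complex\<close>, of which only the values below \<open>m\<close> matter, play the role of
  \<open>\<complex>\<^sup>m\<close>.\<close>

definition cdot :: "nat \<Rightarrow> (nat \<Rightarrow> complex) \<Rightarrow> (nat \<Rightarrow> complex) \<Rightarrow> complex" where
  "cdot m a b = (\<Sum>j<m. a j * cnj (b j))"

lemma cdot_diff_left: "cdot m (\<lambda>j. a j - b j) c = cdot m a c - cdot m b c"
  and cdot_add_left: "cdot m (\<lambda>j. a j + b j) c = cdot m a c + cdot m b c"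
  and cdot_add_right: "cdot m c (\<lambda>j. a j + b j) = cdot m c a + cdot m c b"
  and cdot_mult_left: "cdot m (\<lambda>j. k * a j) c = k * cdot m a c"
  by (simp_all add: cdot_def sum_subtractf sum.distrib sum_distrib_left algebra_simps)

lemma cdot_sum_right: "cdot m c (\<lambda>j. \<Sum>i\<in>S. k i * a i j) = (\<Sum>i\<in>S. cnj (k i) * cdot m c (a i))"
proof -
  have "cdot m c (\<lambda>j. \<Sum>i\<in>S. k i * a i j) = (\<Sum>j<m. \<Sum>i\<in>S. cnj (k i) * (c j * cnj (a i j)))"
    by (simp add: cdot_def sum_distrib_left mult_ac)
  also have "\<dots> = (\<Sum>i\<in>S. \<Sum>j<m. cnj (k i) * (c j * cnj (a i j)))" by (rule sum.swap)
  finally show ?thesis by (simp add: cdot_def sum_distrib_left)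
qed

lemma cdot_self_eq_0: "cdot m a a = 0 \<Longrightarrow> j < m \<Longrightarrow> a j = 0"
proof -
  assume 0: "cdot m a a = 0" and j: "j < m"
  have "cdot m a a = complex_of_real (\<Sum>j<m. (cmod (a j))\<^sup>2)"
    unfolding of_real_sum complex_norm_square cdot_def ..
  with 0 have "(\<Sum>j<m. (cmod (a j))\<^sup>2) = 0" by (metis of_real_eq_0_iff)
  then show "a j = 0" using j by (simp add: sum_nonneg_eq_0_iff)
qed

text \<open>Adding a vector \<open>a\<^sub>i\<close> to the family: its residual \<open>r\<close> is orthogonal to the old ones, so
  the projection onto \<open>r\<close> can be added to the old solution.\<close>

lemma normal_equations_solvable:
  assumes "finite S"
  shows "\<exists>c. \<forall>i\<in>S. cdot m (\<lambda>j. b j - (\<Sum>k\<in>S. c k * a k j)) (a i) = 0"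
  using assms
proof (induction S arbitrary: b)
  case empty
  then show ?case by simp
next
  case (insert i S)
  obtain u where u: "\<And>k. k \<in> S \<Longrightarrow> cdot m (\<lambda>j. b j - (\<Sum>k\<in>S. u k * a k j)) (a k) = 0"
    using insert.IH[of b] by blast
  obtain v where v: "\<And>k. k \<in> S \<Longrightarrow> cdot m (\<lambda>j. a i j - (\<Sum>k\<in>S. v k * a k j)) (a k) = 0"
    using insert.IH[of "a i"] by blast
  define r where "r j = a i j - (\<Sum>k\<in>S. v k * a k j)" for j
  define d where "d j = b j - (\<Sum>k\<in>S. u k * a k j)" for j
  \<comment> \<open>If r vanishes at all indices below m, the new vector depends there on the old
    ones, and the value 0 is as good as any.\<close>
  define q where "q = (if cdot m r r = 0 then 0 else cdot m d r / cdot m r r)"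
  have ai: "a i = (\<lambda>j. r j + (\<Sum>k\<in>S. v k * a k j))" by (simp add: r_def)
  define c where "c k = (if k = i then q else u k - q * v k)" for k
  have eq: "b j - (\<Sum>k\<in>insert i S. c k * a k j) = d j - q * r j" for j
  proof -
    have "(\<Sum>k\<in>insert i S. c k * a k j) = q * a i j + (\<Sum>k\<in>S. c k * a k j)"
      using insert.hyps by (simp add: c_def)
    also have "(\<Sum>k\<in>S. c k * a k j) = (\<Sum>k\<in>S. (u k - q * v k) * a k j)"
      using insert.hyps by (intro sum.cong) (auto simp: c_def)
    also have "\<dots> = (\<Sum>k\<in>S. u k * a k j) - q * (\<Sum>k\<in>S. v k * a k j)"
      by (simp add: sum_subtractf sum_distrib_left algebra_simps)
    finally show ?thesis by (simp add: d_def r_def algebra_simps)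
  qed
  have orthS: "cdot m (\<lambda>j. d j - q * r j) (a k) = 0" if "k \<in> S" for k
    using u[OF that] v[OF that] unfolding cdot_diff_left cdot_mult_left d_def[symmetric] r_def[symmetric] by simp
  have orthr: "cdot m (\<lambda>j. d j - q * r j) r = 0"
  proof (cases "cdot m r r = 0")
    case True
    then have "r j = 0" if "j < m" for j using cdot_self_eq_0 that by blast
    then show ?thesis by (simp add: cdot_def)
  next
    case False
    then show ?thesis unfolding cdot_diff_left cdot_mult_left by (simp add: q_def)
  qed
  have "cdot m (\<lambda>j. d j - q * r j) (a i) = cdot m (\<lambda>j. d j - q * r j) r
     + cdot m (\<lambda>j. d j - q * r j) (\<lambda>j. \<Sum>k\<in>S. v k * a k j)"
    by (subst ai) (rule cdot_add_right)
  also have "\<dots> = 0" unfolding cdot_sum_right using orthS orthr by simp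
  finally have "\<forall>k\<in>insert i S. cdot m (\<lambda>j. b j - (\<Sum>k\<in>insert i S. c k * a k j)) (a k) = 0"
    unfolding eq using orthS by simp
  then show ?case by blast
qed

lemma pythagoras_cdot:
  assumes "cdot m a b = 0"
  shows "(\<Sum>j<m. (cmod (a j + b j))\<^sup>2) = (\<Sum>j<m. (cmod (a j))\<^sup>2) + (\<Sum>j<m. (cmod (b j))\<^sup>2)"
proof -
  have "(\<Sum>j<m. (cmod (a j + b j))\<^sup>2) = (\<Sum>j<m. (cmod (a j))\<^sup>2 + (cmod (b j))\<^sup>2 + 2 * Re (a j * cnj (b j)))"
  proof (intro sum.cong refl)
    fix j show "(cmod (a j + b j))\<^sup>2 = (cmod (a j))\<^sup>2 + (cmod (b j))\<^sup>2 + 2 * Re (a j * cnj (b j))"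
      unfolding cmod_power2 by (simp add: power2_eq_square algebra_simps)
  qed
  also have "\<dots> = (\<Sum>j<m. (cmod (a j))\<^sup>2) + (\<Sum>j<m. (cmod (b j))\<^sup>2) + 2 * Re (cdot m a b)"
    by (simp add: sum.distrib sum_distrib_left cdot_def)
  finally show ?thesis using assms by simp
qed

lemma span_fun_diff:
  assumes "g \<in> span_fun \<phi> L" "h \<in> span_fun \<phi> L"
  shows "(\<lambda>x. g x - h x) \<in> span_fun \<phi> L"
proof -
  obtain c d where "g = (\<lambda>x. \<Sum>\<nu>\<in>L. c \<nu> * tensor_fun \<phi> \<nu> x)" "h = (\<lambda>x. \<Sum>\<nu>\<in>L. d \<nu> * tensor_fun \<phi> \<nu> x)"
    using assms by (auto simp: span_fun_def)
  then show ?thesis unfolding span_fun_def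
    by (auto intro!: exI[of _ "\<lambda>\<nu>. c \<nu> - d \<nu>"] simp: left_diff_distrib sum_subtractf)
qed

text \<open>The normal equations make the residual \<open>R\<close> orthogonal to the span on the
  samples, and Pythagoras splits the objective of any g into that of h and the sampled distance from
  g to h. Minimality follows, and uniqueness because \<open>inj\<close> turns agreement at the
  samples into equality of functions. The last conjunct says that projection onto the span does not
  increase the sampled norm.\<close>

lemma least_squares_solution:
  assumes L: "finite L" and m: "m > 0"
    and inj: "\<And>g. g \<in> span_fun \<phi> L \<Longrightarrow> (\<Sum>j<m. (cmod (g (y j)))\<^sup>2) = 0 \<Longrightarrow> g = (\<lambda>x. 0)"
  shows "\<exists>h \<in> span_fun \<phi> L. (\<forall>g. is_arg_min (ls_objective m y f \<eta>) (\<lambda>g. g \<in> span_fun \<phi> L) g \<longleftrightarrow> g = h) \<and>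
    (\<forall>g \<in> span_fun \<phi> L. (\<Sum>j<m. (cmod (g (y j) - h (y j)))\<^sup>2) \<le> (\<Sum>j<m. (cmod (g (y j) - f (y j) - \<eta> j))\<^sup>2))"
proof -
  obtain c where c: "\<And>\<nu>. \<nu> \<in> L \<Longrightarrow> cdot m (\<lambda>j. (f (y j) + \<eta> j) - (\<Sum>k\<in>L. c k * tensor_fun \<phi> k (y j))) (\<lambda>j. tensor_fun \<phi> \<nu> (y j)) = 0"
    using normal_equations_solvable[OF L, of m "\<lambda>j. f (y j) + \<eta> j" "\<lambda>k j. tensor_fun \<phi> k (y j)"] by blast
  define h where "h x = (\<Sum>k\<in>L. c k * tensor_fun \<phi> k x)" for x
  have hS: "h \<in> span_fun \<phi> L" by (auto simp: span_fun_def h_def[abs_def])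
  define R where "R j = h (y j) - f (y j) - \<eta> j" for j
  have orth: "cdot m R (\<lambda>j. g (y j)) = 0" if g: "g \<in> span_fun \<phi> L" for g
  proof -
    obtain d where d: "g = (\<lambda>x. \<Sum>\<nu>\<in>L. d \<nu> * tensor_fun \<phi> \<nu> x)" using g by (auto simp: span_fun_def)
    have "cdot m R (\<lambda>j. tensor_fun \<phi> \<nu> (y j)) = 0" if "\<nu> \<in> L" for \<nu>
    proof -
      have "cdot m R (\<lambda>j. tensor_fun \<phi> \<nu> (y j)) = cdot m (\<lambda>j. (-1) * ((f (y j) + \<eta> j) - h (y j))) (\<lambda>j. tensor_fun \<phi> \<nu> (y j))"
        by (simp add: R_def[abs_def] algebra_simps)
      then show ?thesis unfolding cdot_mult_left using c[OF that] by (simp add: h_def)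
    qed
    then show ?thesis unfolding d cdot_sum_right by simp
  qed
  have pyth: "(\<Sum>j<m. (cmod (g (y j) - f (y j) - \<eta> j))\<^sup>2)
      = (\<Sum>j<m. (cmod (R j))\<^sup>2) + (\<Sum>j<m. (cmod (g (y j) - h (y j)))\<^sup>2)" if "g \<in> span_fun \<phi> L" for g
  proof -
    have "(\<Sum>j<m. (cmod (R j + (g (y j) - h (y j))))\<^sup>2)
       = (\<Sum>j<m. (cmod (R j))\<^sup>2) + (\<Sum>j<m. (cmod (g (y j) - h (y j)))\<^sup>2)"
      by (rule pythagoras_cdot[OF orth[OF span_fun_diff[OF that hS]]])
    moreover have "R j + (g (y j) - h (y j)) = g (y j) - f (y j) - \<eta> j" for j by (simp add: R_def)
    ultimately show ?thesis by simp
  qed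
  have obj: "ls_objective m y f \<eta> g = ls_objective m y f \<eta> h + (1 / real m) * (\<Sum>j<m. (cmod (g (y j) - h (y j)))\<^sup>2)"
    if "g \<in> span_fun \<phi> L" for g
    unfolding ls_objective_def pyth[OF that] using pyth[OF hS] by (simp add: algebra_simps)
  have nn: "0 \<le> (1 / real m) * (\<Sum>j<m. (cmod (g (y j) - h (y j)))\<^sup>2)" for g :: "real ^ 'a \<Rightarrow> complex"
    by (intro mult_nonneg_nonneg sum_nonneg) auto
  have "is_arg_min (ls_objective m y f \<eta>) (\<lambda>g. g \<in> span_fun \<phi> L) h"
    unfolding is_arg_min_def using hS obj nn by (smt (verit))
  moreover have "g = h" if "is_arg_min (ls_objective m y f \<eta>) (\<lambda>g. g \<in> span_fun \<phi> L) g" for g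
  proof -
    have g: "g \<in> span_fun \<phi> L" "\<not> ls_objective m y f \<eta> h < ls_objective m y f \<eta> g"
      using that hS by (auto simp: is_arg_min_def)
    then have "(1 / real m) * (\<Sum>j<m. (cmod (g (y j) - h (y j)))\<^sup>2) = 0"
      using obj[OF g(1)] nn[of g] by linarith
    then have "(\<Sum>j<m. (cmod (g (y j) - h (y j)))\<^sup>2) = 0" using m by simp
    from fun_cong[OF inj[OF span_fun_diff[OF g(1) hS] this]] show "g = h" by (intro ext) simp
  qed
  moreover have "(\<Sum>j<m. (cmod (g (y j) - h (y j)))\<^sup>2) \<le> (\<Sum>j<m. (cmod (g (y j) - f (y j) - \<eta> j))\<^sup>2)" if "g \<in> span_fun \<phi> L" for g
    unfolding pyth[OF that] by (simp add: sum_nonneg)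
  ultimately show ?thesis using hS by blast
qed

section \<open>Sup norm and mean square norm on the cube\<close>

text \<open>The points of the cube that satisfy the bound form a closed set. A closed set containing
  almost all of an open box contains the whole box, and the cube is its closure.\<close>

lemma AE_cube_imp_all:
  fixes q :: "real ^ 'd \<Rightarrow> complex"
  assumes q: "continuous_on cube q" and ae: "AE x in lborel. x \<in> cube \<longrightarrow> cmod (q x) \<le> C"
    and x: "x \<in> cube"
  shows "cmod (q x) \<le> C"
proof -
  define T where "T = {x \<in> cube. cmod (q x) \<le> C}"
  have "closed (cube :: (real ^ 'd) set)" unfolding cube_def by (rule closed_cbox)
  have cl: "closed T"
  proof -
    have "T = cube \<inter> (\<lambda>x. cmod (q x)) -` {..C}" by (auto simp: T_def)
    then show ?thesis
      using continuous_closed_preimage[OF continuous_on_norm[OF q] \<open>closed cube\<close>, of "{..C}"] by simp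
  qed
  have sub: "box (\<chi> i. -1) (\<chi> i. 1) \<subseteq> T"
  proof
    fix z :: "real ^ 'd" assume z: "z \<in> box (\<chi> i. -1) (\<chi> i. 1)"
    have "AE x in lebesgue. x \<in> cube \<longrightarrow> cmod (q x) \<le> C" using ae by (rule AE_completion)
    then have "AE x\<in>box (\<chi> i. -1) (\<chi> i. 1) in lebesgue. x \<in> T"
      by (rule AE_mp) (use box_subset_cbox in \<open>auto simp: T_def cube_def\<close>)
    from mem_closed_if_AE_lebesgue_open[OF open_box cl this z] show "z \<in> T" .
  qed
  have "(0 :: real ^ 'd) \<in> box (\<chi> i. -1) (\<chi> i. 1)" by (simp add: mem_box_cart)
  then have "closure (box (\<chi> i. -1) (\<chi> i. 1)) = (cube :: (real ^ 'd) set)"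
    unfolding cube_def by (intro closure_box) auto
  then have "cube \<subseteq> T" using closure_minimal[OF sub cl] by simp
  then show ?thesis using x by (auto simp: T_def)
qed

lemma le_Linf_norm_u:
  fixes q :: "real ^ 'd \<Rightarrow> complex"
  assumes q: "continuous_on cube q"
  shows "x \<in> cube \<Longrightarrow> cmod (q x) \<le> Linf_norm_u q" and "0 \<le> Linf_norm_u q"
proof -
  define S where "S = {C. 0 \<le> C \<and> (AE x in lborel. x \<in> cube \<longrightarrow> cmod (q x) \<le> C)}"
  have "compact (q ` cube)" by (intro compact_continuous_image q) (simp add: cube_def)
  from compact_imp_bounded[OF this] obtain B where B: "\<And>x. x \<in> cube \<Longrightarrow> cmod (q x) \<le> B"
    by (auto simp: bounded_iff)
  have "cmod (q x) \<le> max 0 B" if "x \<in> cube" for x using B[OF that] by simp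
  then have "max 0 B \<in> S" by (simp add: S_def)
  then have ne: "S \<noteq> {}" by blast
  show "cmod (q x) \<le> Linf_norm_u q" if "x \<in> cube"
    unfolding Linf_norm_u_def S_def[symmetric]
    using AE_cube_imp_all[OF q _ that] by (intro cInf_greatest[OF ne]) (auto simp: S_def)
  show "0 \<le> Linf_norm_u q"
    unfolding Linf_norm_u_def S_def[symmetric] by (intro cInf_greatest[OF ne]) (auto simp: S_def)
qed

text \<open>A form of Minkowski's inequality in which f enters only through a pointwise bound on the
  cube, without measurability. The squared norm is compared with the integrable majorant (A + r)^2,
  whose mixed term is controlled by nonnegativity of the variance of r.\<close>

lemma L2_norm_u_le_add:
  fixes f g h :: "real ^ 'd \<Rightarrow> complex"
  assumes A: "\<And>x. x \<in> cube \<Longrightarrow> cmod (f x - g x) \<le> A" and A0: "A \<ge> 0"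
    and q: "continuous_on UNIV (\<lambda>x. g x - h x)"
  shows "L2_norm_u (\<lambda>x. f x - h x) \<le> A + L2_norm_u (\<lambda>x. g x - h x)"
proof -
  interpret U: prob_space "unif :: (real ^ 'd) measure" by (rule prob_space_unif)
  define r where "r x = indicator cube x * cmod (g x - h x)" for x
  have "compact ((\<lambda>x. g x - h x) ` cube)"
    by (intro compact_continuous_image continuous_on_subset[OF q]) (auto simp: cube_def)
  from compact_imp_bounded[OF this] obtain B where B: "\<And>x. x \<in> cube \<Longrightarrow> cmod (g x - h x) \<le> B"
    by (auto simp: bounded_iff)
  have [measurable]: "(\<lambda>x. g x - h x) \<in> borel_measurable borel" by (rule borel_measurable_continuous_onI[OF q])
  have [measurable]: "r \<in> borel_measurable borel" unfolding r_def by measurable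
  have r: "0 \<le> r x" "r x \<le> max 0 B" for x using B[of x] by (auto simp: r_def indicator_def)
  have ir: "integrable unif r" by (rule U.integrable_const_bound[of _ "max 0 B"]) (use r in auto)
  have ir2: "integrable unif (\<lambda>x. (r x)\<^sup>2)"
    by (rule U.integrable_const_bound[of _ "(max 0 B)\<^sup>2"]) (use r in \<open>auto intro: power_mono\<close>)
  define R where "R = (LINT x|unif. (r x)\<^sup>2)"
  have L: "L2_norm_u (\<lambda>x. g x - h x) = sqrt R"
    unfolding L2_norm_u_def R_def set_lebesgue_integral_def r_def
    by (intro arg_cong[where f = sqrt] Bochner_Integration.integral_cong) (auto simp: indicator_def)
  have R0: "R \<ge> 0" unfolding R_def by (intro Bochner_Integration.integral_nonneg) auto
  have jensen: "(LINT x|unif. r x) \<le> sqrt R"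
  proof -
    have "0 \<le> R - (LINT x|unif. r x)\<^sup>2"
      using U.variance_eq[OF ir ir2] U.variance_positive[of r] by (simp add: R_def)
    then show ?thesis by (intro real_le_rsqrt) simp
  qed
  have "(LINT x:cube|unif. (cmod (f x - h x))\<^sup>2) \<le> (LINT x|unif. A\<^sup>2 + 2 * A * r x + (r x)\<^sup>2)"
    unfolding set_lebesgue_integral_def
  proof (rule integral_mono')
    show "integrable unif (\<lambda>x. A\<^sup>2 + 2 * A * r x + (r x)\<^sup>2)" using ir ir2 by auto
    fix x :: "real ^ 'd"
    show nn: "0 \<le> A\<^sup>2 + 2 * A * r x + (r x)\<^sup>2" using A0 r(1)[of x] by simp
    show "indicator cube x *\<^sub>R (cmod (f x - h x))\<^sup>2 \<le> A\<^sup>2 + 2 * A * r x + (r x)\<^sup>2"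
    proof (cases "x \<in> cube")
      case True
      have "cmod (f x - h x) \<le> A + r x"
        using norm_triangle_ineq[of "f x - g x" "g x - h x"] A[OF True] True by (simp add: r_def)
      then have "(cmod (f x - h x))\<^sup>2 \<le> (A + r x)\<^sup>2" by (intro power_mono) auto
      then show ?thesis using True by (simp add: power2_eq_square algebra_simps)
    qed (use nn in simp)
  qed
  also have "\<dots> = A\<^sup>2 + 2 * A * (LINT x|unif. r x) + R"
    using ir ir2 U.prob_space by (simp add: R_def)
  also have "\<dots> \<le> A\<^sup>2 + 2 * A * sqrt R + R"
    using jensen A0 by (intro add_mono mult_left_mono) auto
  also have "\<dots> = (A + sqrt R)\<^sup>2" using R0 by (simp add: power2_eq_square algebra_simps)
  finally show ?thesis
    unfolding L using A0 R0 by (subst L2_norm_u_def) (rule real_le_lsqrt, auto)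
qed

lemma tensor_fun_continuous:
  assumes "\<And>j. continuous_on UNIV (\<phi> j)"
  shows "continuous_on UNIV (tensor_fun \<phi> \<nu>)"
  unfolding tensor_fun_def[abs_def]
  by (intro continuous_on_prod continuous_on_of_real continuous_on_compose2[OF assms continuous_on_component]) auto

lemma span_fun_continuous:
  assumes "\<And>j. continuous_on UNIV (\<phi> j)" "g \<in> span_fun \<phi> L"
  shows "continuous_on UNIV g"
  using assms(2) unfolding span_fun_def
  by (auto intro!: continuous_intros tensor_fun_continuous[OF assms(1)])

text \<open>For g in the span, so is g - h, and stability bounds its norm by s = 1/sqrt(1 -
  \<delta>) times the sampled norm of g - f - \<eta>. That norm is at most A + e, where A is the sup
  norm of f - g and e the noise norm; adding A for f - g gives the factor 1 + s.\<close>

lemma least_squares_error: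
  fixes f :: "real ^ 'd \<Rightarrow> complex" and \<phi> :: "nat \<Rightarrow> real \<Rightarrow> real" and \<delta> :: real
  assumes cont: "\<And>j. continuous_on UNIV (\<phi> j)" and L: "finite L" and \<delta>: "\<delta> < 1" and m: "m > 0"
    and y: "\<And>j. j < m \<Longrightarrow> y j \<in> cube"
    and stable: "\<And>g. g \<in> span_fun \<phi> L \<Longrightarrow> (1 - \<delta>) * (L2_norm_u g)\<^sup>2 \<le> (1 / real m) * (\<Sum>j<m. (cmod (g (y j)))\<^sup>2)"
    and inj: "\<And>g. g \<in> span_fun \<phi> L \<Longrightarrow> (\<Sum>j<m. (cmod (g (y j)))\<^sup>2) = 0 \<Longrightarrow> g = (\<lambda>x. 0)"
    and f: "continuous_on cube f"
  shows "(\<exists>!h. is_arg_min (ls_objective m y f \<eta>) (\<lambda>g. g \<in> span_fun \<phi> L) h) \<and>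
      (\<forall>h. is_arg_min (ls_objective m y f \<eta>) (\<lambda>g. g \<in> span_fun \<phi> L) h \<longrightarrow>
         L2_norm_u (\<lambda>x. f x - h x)
           \<le> (1 + 1 / sqrt (1 - \<delta>)) * (INF g \<in> span_fun \<phi> L. Linf_norm_u (\<lambda>x. f x - g x))
             + 1 / sqrt (1 - \<delta>)
               * L2_set (\<lambda>j. cmod (complex_of_real (1 / sqrt (real m)) * \<eta> j)) {..<m})"
proof -
  obtain h where hS: "h \<in> span_fun \<phi> L"
    and H: "(\<forall>g. is_arg_min (ls_objective m y f \<eta>) (\<lambda>g. g \<in> span_fun \<phi> L) g \<longleftrightarrow> g = h) \<and>
    (\<forall>g \<in> span_fun \<phi> L. (\<Sum>j<m. (cmod (g (y j) - h (y j)))\<^sup>2) \<le> (\<Sum>j<m. (cmod (g (y j) - f (y j) - \<eta> j))\<^sup>2))"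
  proof -
    have "\<exists>h \<in> span_fun \<phi> L. (\<forall>g. is_arg_min (ls_objective m y f \<eta>) (\<lambda>g. g \<in> span_fun \<phi> L) g \<longleftrightarrow> g = h) \<and>
    (\<forall>g \<in> span_fun \<phi> L. (\<Sum>j<m. (cmod (g (y j) - h (y j)))\<^sup>2) \<le> (\<Sum>j<m. (cmod (g (y j) - f (y j) - \<eta> j))\<^sup>2))"
      by (rule least_squares_solution[OF L m], rule inj)
    then show ?thesis using that by (elim bexE)
  qed
  note h = conjunct1[OF H, THEN spec] and le = conjunct2[OF H, THEN bspec]
  define s where "s = 1 / sqrt (1 - \<delta>)"
  have s: "s > 0" using \<delta> by (simp add: s_def)
  define e where "e = L2_set (\<lambda>j. cmod (complex_of_real (1 / sqrt (real m)) * \<eta> j)) {..<m}"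
  have e: "e = L2_set (\<lambda>j. cmod (\<eta> j) / sqrt (real m)) {..<m}"
    unfolding e_def by (simp add: norm_mult norm_divide)
  have bound: "L2_norm_u (\<lambda>x. f x - h x) \<le> (1 + s) * Linf_norm_u (\<lambda>x. f x - g x) + s * e"
    if g: "g \<in> span_fun \<phi> L" for g
  proof -
    define A where "A = Linf_norm_u (\<lambda>x. f x - g x)"
    have cg: "continuous_on UNIV g" "continuous_on UNIV h" using span_fun_continuous[where \<phi> = \<phi> and L = L, OF cont] g hS by auto
    have cq: "continuous_on cube (\<lambda>x. f x - g x)"
      by (intro continuous_intros f continuous_on_subset[OF cg(1)]) auto
    have A: "cmod (f x - g x) \<le> A" if "x \<in> cube" for x
      unfolding A_def using le_Linf_norm_u(1)[OF cq that] .
    have A0: "A \<ge> 0" unfolding A_def by (rule le_Linf_norm_u(2)[OF cq])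
    have "(L2_norm_u (\<lambda>x. g x - h x))\<^sup>2 = (s * sqrt ((1 - \<delta>) * (L2_norm_u (\<lambda>x. g x - h x))\<^sup>2))\<^sup>2"
      using \<delta> by (simp add: s_def power_mult_distrib power_divide)
    also have "\<dots> \<le> (s * sqrt ((1 / real m) * (\<Sum>j<m. (cmod (g (y j) - f (y j) - \<eta> j))\<^sup>2)))\<^sup>2"
    proof (intro power_mono mult_left_mono real_sqrt_le_mono)
      have "(1 - \<delta>) * (L2_norm_u (\<lambda>x. g x - h x))\<^sup>2 \<le> (1 / real m) * (\<Sum>j<m. (cmod (g (y j) - h (y j)))\<^sup>2)"
        by (rule stable[OF span_fun_diff[OF g hS]])
      also have "\<dots> \<le> (1 / real m) * (\<Sum>j<m. (cmod (g (y j) - f (y j) - \<eta> j))\<^sup>2)"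
        by (intro mult_left_mono le g) auto
      finally show "(1 - \<delta>) * (L2_norm_u (\<lambda>x. g x - h x))\<^sup>2 \<le> (1 / real m) * (\<Sum>j<m. (cmod (g (y j) - f (y j) - \<eta> j))\<^sup>2)" .
    qed (use s \<delta> in auto)
    finally have "L2_norm_u (\<lambda>x. g x - h x) \<le> s * sqrt ((1 / real m) * (\<Sum>j<m. (cmod (g (y j) - f (y j) - \<eta> j))\<^sup>2))"
      by (rule power2_le_imp_le) (use s in \<open>auto intro!: mult_nonneg_nonneg sum_nonneg divide_nonneg_nonneg\<close>)
    also have "sqrt ((1 / real m) * (\<Sum>j<m. (cmod (g (y j) - f (y j) - \<eta> j))\<^sup>2))
        = L2_set (\<lambda>j. cmod (g (y j) - f (y j) - \<eta> j) / sqrt (real m)) {..<m}"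
      unfolding L2_set_def by (simp add: power_divide sum_divide_distrib)
    also have "\<dots> \<le> L2_set (\<lambda>j. A / sqrt (real m) + cmod (\<eta> j) / sqrt (real m)) {..<m}"
    proof (rule L2_set_mono)
      fix j assume "j \<in> {..<m}"
      then have "cmod (g (y j) - f (y j)) \<le> A" using A[OF y, of j] by (simp add: norm_minus_commute)
      then have "cmod (g (y j) - f (y j) - \<eta> j) \<le> A + cmod (\<eta> j)"
        using norm_triangle_ineq4[of "g (y j) - f (y j)" "\<eta> j"] by linarith
      then show "cmod (g (y j) - f (y j) - \<eta> j) / sqrt (real m) \<le> A / sqrt (real m) + cmod (\<eta> j) / sqrt (real m)"
        by (simp add: add_divide_distrib[symmetric] divide_right_mono)
    qed auto
    also have "\<dots> \<le> L2_set (\<lambda>j. A / sqrt (real m)) {..<m} + e"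
      unfolding e by (rule L2_set_triangle_ineq)
    also have "L2_set (\<lambda>j. A / sqrt (real m)) {..<m} = A"
      unfolding L2_set_def using A0 m by (simp add: power_divide)
    finally have "L2_norm_u (\<lambda>x. g x - h x) \<le> s * (A + e)" using s by (simp add: mult_left_mono)
    then have "L2_norm_u (\<lambda>x. f x - h x) \<le> A + s * (A + e)"
      using L2_norm_u_le_add[where f = f and g = g and h = h and A = A] A A0
        continuous_on_diff[OF cg] by fastforce
    then show ?thesis by (simp add: A_def algebra_simps)
  qed
  \<comment> \<open>Since h does not depend on g, solving for the sup norm leaves a left side free
    of g, and the bound passes to the infimum.\<close>
  have "(L2_norm_u (\<lambda>x. f x - h x) - s * e) / (1 + s) \<le> (INF g \<in> span_fun \<phi> L. Linf_norm_u (\<lambda>x. f x - g x))"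
  proof (rule cINF_greatest)
    fix g assume "g \<in> span_fun \<phi> L"
    from bound[OF this] show "(L2_norm_u (\<lambda>x. f x - h x) - s * e) / (1 + s) \<le> Linf_norm_u (\<lambda>x. f x - g x)"
      using s by (simp add: divide_le_eq mult.commute)
  qed (use hS in auto)
  then have "L2_norm_u (\<lambda>x. f x - h x) \<le> (1 + s) * (INF g \<in> span_fun \<phi> L. Linf_norm_u (\<lambda>x. f x - g x)) + s * e"
    using s by (simp add: divide_le_eq mult.commute)
  then show ?thesis unfolding s_def e_def using h by auto
qed

section \<open>Hyperbolic crosses and the sampling budget\<close>

lemma hyperbolic_cross_less:
  assumes "\<nu> \<in> hyperbolic_cross n"
  shows "\<nu> k < n"
proof -
  have "\<nu> k + 1 dvd (\<Prod>k\<in>UNIV. \<nu> k + 1)" by (rule dvd_prodI) auto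
  then have "\<nu> k + 1 \<le> (\<Prod>k\<in>UNIV. \<nu> k + 1)" by (rule dvd_imp_le) (simp add: prod_pos)
  then show ?thesis using assms by (simp add: hyperbolic_cross_def)
qed

lemma finite_hyperbolic_cross: "finite (hyperbolic_cross n :: ('d::finite \<Rightarrow> nat) set)"
proof (rule finite_subset)
  show "hyperbolic_cross n \<subseteq> PiE (UNIV :: 'd set) (\<lambda>_. {..<n})"
    using hyperbolic_cross_less by (auto simp: PiE_def)
qed (auto intro: finite_PiE)

definition axis_index :: "'d \<Rightarrow> nat \<Rightarrow> 'd \<Rightarrow> nat" where
  "axis_index k i = (\<lambda>l. if l = k then i else 0)"

lemma axis_index_hyperbolic_cross: "axis_index (k::'d::finite) i \<in> hyperbolic_cross n" if "i < n"
proof -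
  have "(\<Prod>l\<in>UNIV. axis_index k i l + 1) = (\<Prod>l\<in>UNIV. if l = k then i + 1 else 1)"
    by (intro prod.cong) (auto simp: axis_index_def)
  also have "\<dots> = i + 1" by (simp add: prod.delta)
  finally show ?thesis using that by (simp add: hyperbolic_cross_def)
qed

lemma inj_axis_index: "inj (axis_index k)"
  by (rule injI) (metis axis_index_def)

lemma card_hyperbolic_cross_ge: "n \<le> card (hyperbolic_cross n :: ('d::finite \<Rightarrow> nat) set)"
proof -
  have "card (axis_index (undefined :: 'd) ` {..<n}) \<le> card (hyperbolic_cross n :: ('d \<Rightarrow> nat) set)"
    by (intro card_mono finite_hyperbolic_cross) (auto intro: axis_index_hyperbolic_cross)
  then show ?thesis by (simp add: card_image inj_on_subset[OF inj_axis_index])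
qed

text \<open>Two axes hold n and n - 1 indices, the origin being counted once, and the unit index on
  the third axis completes 2n.\<close>

lemma card_hyperbolic_cross_3_ge:
  assumes "CARD('d::finite) = 3" "n \<ge> 2"
  shows "2 * n \<le> card (hyperbolic_cross n :: ('d \<Rightarrow> nat) set)"
proof -
  obtain k1 k2 k3 :: 'd where k: "k1 \<noteq> k2" "k2 \<noteq> k3" "k1 \<noteq> k3"
    using assms(1) by (auto simp: card_3_iff)
  define S1 where "S1 = axis_index k1 ` {..<n}"
  define S2 where "S2 = axis_index k2 ` {1..<n}"
  have c: "card S1 = n" "card S2 = n - 1"
    unfolding S1_def S2_def by (simp_all add: card_image inj_on_subset[OF inj_axis_index])
  have d12: "S1 \<inter> S2 = {}"
  proof -
    have "axis_index k1 i \<noteq> axis_index k2 j" if "j \<ge> 1" for i j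
    proof
      assume "axis_index k1 i = axis_index k2 j"
      from fun_cong[OF this, of k2] show False using k that by (simp add: axis_index_def)
    qed
    then show ?thesis unfolding S1_def S2_def by auto
  qed
  have "axis_index k3 1 \<noteq> axis_index k i" if "k \<noteq> k3" for k i
  proof
    assume "axis_index k3 1 = axis_index k i"
    from fun_cong[OF this, of k3] show False using that by (simp add: axis_index_def)
  qed
  then have d3: "axis_index k3 1 \<notin> S1 \<union> S2" using k unfolding S1_def S2_def by auto
  have "2 * n = card (insert (axis_index k3 1) (S1 \<union> S2))"
    using c d12 d3 assms(2) by (simp add: card_Un_disjoint S1_def S2_def)
  also have "\<dots> \<le> card (hyperbolic_cross n :: ('d \<Rightarrow> nat) set)"
    using assms(2) by (intro card_mono finite_hyperbolic_cross)
      (auto simp: S1_def S2_def intro!: axis_index_hyperbolic_cross)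
  finally show ?thesis .
qed

section \<open>Absorbing the constants into the exponent of the sample size\<close>

lemma gamma_w_bounds:
  assumes "w \<ge> 1"
  shows "24 * w \<le> 2 ^ gamma_w w" and "gamma_w w \<ge> 5"
proof -
  have "log 2 (24 * w) \<le> real (gamma_w w)" unfolding gamma_w_def by linarith
  then have "2 powr log 2 (24 * w) \<le> 2 powr real (gamma_w w)" by (intro powr_mono) auto
  then show 1: "24 * w \<le> 2 ^ gamma_w w" using assms by (simp add: powr_realpow)
  have "(2::real) ^ 4 < 2 ^ gamma_w w" using 1 assms by simp
  then have "4 < gamma_w w" by (simp only: power_strict_increasing_iff)
  then show "gamma_w w \<ge> 5" by simp
qed

text \<open>For j \<ge> 1 and J = j + 1, the bound 72 (w J)^3 is the product of 4w, 18 w^2 and J^3.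
  Dividing (24w)^2 \<le> 2^(2\<gamma>) by 32 gives 18 w^2 \<le> 2^(2\<gamma>-5), which is at most
  J^(2\<gamma>-5).\<close>

lemma slepian_phi_uniform_bound:
  assumes sb: "slepian_basis w \<mu> \<phi>" and w: "w \<ge> 1" and x: "x \<in> {-1..1}"
  shows "(\<phi> j x)\<^sup>2 \<le> 4 * w * real (Suc j) ^ (2 * gamma_w w - 2)"
proof (cases "j = 0")
  case True
  then show ?thesis using slepian_phi_0_sq_le[OF sb w] by simp
next
  case False
  define g where "g = gamma_w w"
  define J where "J = real (Suc j)"
  have g: "24 * w \<le> 2 ^ g" "g \<ge> 5" using gamma_w_bounds[OF w] by (auto simp: g_def)
  have J: "J \<ge> 2" using False by (simp add: J_def)
  have "(24 * w)\<^sup>2 \<le> (2 ^ g)\<^sup>2" using g w by (intro power_mono) auto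
  also have "(2 ^ g)\<^sup>2 = 2 ^ (2 * g - 5) * (32 :: real)"
  proof -
    have "2 * g = (2 * g - 5) + 5" using g by simp
    then have "(2::real) ^ (2 * g) = 2 ^ (2 * g - 5) * 2 ^ 5" by (metis power_add)
    then show ?thesis by (simp add: power_mult[symmetric] mult.commute)
  qed
  also have "\<dots> \<le> J ^ (2 * g - 5) * 32" using J by (intro mult_right_mono power_mono) auto
  finally have 1: "18 * w\<^sup>2 \<le> J ^ (2 * g - 5)" by (simp add: power_mult_distrib)
  have "(\<phi> j x)\<^sup>2 \<le> 72 * (w * J) ^ 3"
    unfolding J_def using False by (intro slepian_phi_sq_le[OF sb w _ x]) simp
  also have "\<dots> = 4 * w * (18 * w\<^sup>2) * J ^ 3" by (simp add: power_mult_distrib power2_eq_square power3_eq_cube)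
  also have "\<dots> \<le> 4 * w * J ^ (2 * g - 5) * J ^ 3"
    using 1 w J by (intro mult_right_mono mult_left_mono) auto
  also have "\<dots> = 4 * w * J ^ (2 * g - 2)"
  proof -
    have "2 * g - 2 = (2 * g - 5) + 3" using g by simp
    then show ?thesis by (simp only: power_add mult.assoc)
  qed
  finally show ?thesis by (simp add: J_def g_def)
qed

lemma slepian_tensor_bound:
  assumes sb: "slepian_basis w \<mu> \<phi>" and w: "w \<ge> 1" and x: "(x :: real ^ 'd) \<in> cube"
    and \<nu>: "\<nu> \<in> hyperbolic_cross n"
  shows "(\<Prod>k\<in>UNIV. \<phi> (\<nu> k) (x $ k))\<^sup>2 \<le> (4 * w) ^ CARD('d) * real n ^ (2 * gamma_w w - 2)"
proof -
  have "(\<Prod>k\<in>UNIV. \<phi> (\<nu> k) (x $ k))\<^sup>2 = (\<Prod>k\<in>UNIV. (\<phi> (\<nu> k) (x $ k))\<^sup>2)"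
    by (simp add: prod_power_distrib)
  also have "\<dots> \<le> (\<Prod>k\<in>UNIV. 4 * w * real (Suc (\<nu> k)) ^ (2 * gamma_w w - 2))"
    using x by (intro prod_mono conjI slepian_phi_uniform_bound[OF sb w]) (auto simp: mem_cube_iff)
  also have "\<dots> = (4 * w) ^ CARD('d) * (\<Prod>k\<in>UNIV. real (Suc (\<nu> k))) ^ (2 * gamma_w w - 2)"
    by (simp add: prod.distrib prod_power_distrib del: of_nat_Suc)
  also have "(\<Prod>k\<in>UNIV. real (Suc (\<nu> k))) = real (\<Prod>k\<in>UNIV. \<nu> k + 1)" by simp
  also have "(4 * w) ^ CARD('d) * real (\<Prod>k\<in>UNIV. \<nu> k + 1) ^ (2 * gamma_w w - 2) \<le> (4 * w) ^ CARD('d) * real n ^ (2 * gamma_w w - 2)"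
  proof (intro mult_left_mono power_mono)
    show "real (\<Prod>k\<in>UNIV. \<nu> k + 1) \<le> real n"
      using \<nu> unfolding hyperbolic_cross_def of_nat_le_iff by simp
  qed (use w in \<open>auto intro!: prod_nonneg\<close>)
  finally show ?thesis .
qed

text \<open>The right side is the product of (2^\<gamma>)^2, N^(2\<gamma>-2) and N^2. The last
  factor pays for the entrywise level \<delta>/N, the middle one for n^(2\<gamma>-2), and the first,
  at least 576 w^2, for 8 (4w)^d when d \<le> 2. For d = 3 the amount 512 w^3 is paid with the extra
  2^(2\<gamma>-2) that N \<ge> 2n provides.\<close>

lemma sample_budget:
  assumes w: "w \<ge> 1" and d: "CARD('d::finite) \<in> {1, 2, 3}" and n: "n \<ge> 1"
    and n3: "CARD('d) = 3 \<longrightarrow> n \<ge> 26"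
  defines "N \<equiv> real (card (hyperbolic_cross n :: ('d \<Rightarrow> nat) set))"
  shows "8 * ((4 * w) ^ CARD('d) * real n ^ (2 * gamma_w w - 2)) * N\<^sup>2 \<le> (2 * N) ^ (2 * gamma_w w)"
proof -
  define g where "g = gamma_w w"
  have g: "24 * w \<le> 2 ^ g" "g \<ge> 5" using gamma_w_bounds[OF w] by (auto simp: g_def)
  have nN: "real n \<le> N" unfolding N_def using card_hyperbolic_cross_ge by simp
  have g2: "(24 * w)\<^sup>2 \<le> (2 ^ g)\<^sup>2" using g w by (intro power_mono) auto
  have gg: "2 * g = (2 * g - 2) + 2" using g by simp
  have split: "(2 * N) ^ (2 * g) = (2 ^ g)\<^sup>2 * N ^ (2 * g - 2) * N\<^sup>2"
  proof -
    have "(2 * N) ^ (2 * g) = 2 ^ (2 * g) * N ^ ((2 * g - 2) + 2)"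
      using gg by (metis power_mult_distrib)
    also have "(2::real) ^ (2 * g) = (2 ^ g)\<^sup>2" by (simp add: power_mult[symmetric] mult.commute)
    finally show ?thesis by (simp only: power_add mult.assoc)
  qed
  have "8 * (4 * w) ^ CARD('d) * real n ^ (2 * g - 2) \<le> (2 ^ g)\<^sup>2 * N ^ (2 * g - 2)"
  proof (cases "CARD('d) = 3")
    case True
    then have n26: "n \<ge> 26" using n3 by simp
    have nN2: "2 * real n \<le> N"
      unfolding N_def using card_hyperbolic_cross_3_ge[OF True, of n] n26 by simp
    have "8 * (4 * w) ^ 3 \<le> (2 ^ g)\<^sup>2 * 2 ^ (2 * g - 2)"
    proof -
      have "(2 ^ g)\<^sup>2 = 4 * (2::real) ^ (2 * g - 2)"
      proof -
        have "(2::real) ^ (2 * g) = 2 ^ (2 * g - 2) * 2 ^ 2" using gg by (metis power_add)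
        then show ?thesis by (simp add: power_mult[symmetric] mult.commute)
      qed
      moreover have "2048 * w ^ 3 \<le> (24 * w)\<^sup>2 * (24 * w)\<^sup>2"
      proof -
        have "w ^ 3 \<le> w ^ 4" using w by (intro power_increasing) auto
        moreover have "0 \<le> w ^ 4" by simp
        moreover have "(24 * w)\<^sup>2 * (24 * w)\<^sup>2 = 331776 * w ^ 4"
          by (simp add: power_mult_distrib power2_eq_square power4_eq_xxxx)
        ultimately show ?thesis by linarith
      qed
      moreover have "(24 * w)\<^sup>2 * (24 * w)\<^sup>2 \<le> (2 ^ g)\<^sup>2 * (2 ^ g)\<^sup>2"
        using g2 by (intro mult_mono) auto
      ultimately show ?thesis by (simp add: power_mult_distrib)
    qed
    then have "8 * (4 * w) ^ 3 * real n ^ (2 * g - 2) \<le> (2 ^ g)\<^sup>2 * 2 ^ (2 * g - 2) * real n ^ (2 * g - 2)"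
      by (intro mult_right_mono) auto
    also have "\<dots> = (2 ^ g)\<^sup>2 * (2 * real n) ^ (2 * g - 2)" by (simp only: power_mult_distrib mult.assoc)
    also have "\<dots> \<le> (2 ^ g)\<^sup>2 * N ^ (2 * g - 2)" using nN2 by (intro mult_left_mono power_mono) auto
    finally show ?thesis using True by simp
  next
    case False
    have "8 * (4 * w) ^ CARD('d) \<le> 8 * (4 * w)\<^sup>2"
      using False d w by (intro mult_left_mono power_increasing) auto
    also have "\<dots> \<le> (24 * w)\<^sup>2" by (simp add: power_mult_distrib)
    also note g2
    finally have "8 * (4 * w) ^ CARD('d) \<le> (2 ^ g)\<^sup>2" .
    then show ?thesis using nN by (intro mult_mono power_mono) auto
  qed
  then have "8 * (4 * w) ^ CARD('d) * real n ^ (2 * g - 2) * N\<^sup>2 \<le> (2 ^ g)\<^sup>2 * N ^ (2 * g - 2) * N\<^sup>2"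
    by (intro mult_right_mono) auto
  then show ?thesis unfolding split[symmetric] g_def[symmetric] by (simp only: mult.assoc)
qed

text \<open>The integral factorises; when the indices agree each coordinate contributes 2, and the
  volume 2^d normalises. The functions are cut off at the cube so that their sup bound holds at
  every point, as \<open>gram_concentration\<close> demands.\<close>

lemma slepian_tensor_orth:
  assumes sb: "slepian_basis w \<mu> \<phi>" and w: "w \<ge> 1"
  defines "v \<equiv> \<lambda>\<nu> (x :: real ^ 'd). indicator cube x * (\<Prod>k\<in>UNIV. \<phi> (\<nu> k) (x $ k))"
  shows "v \<nu> \<in> borel_measurable borel"
    and "(LINT x|unif. v \<nu> x * v \<nu>' x) = (if \<nu> = \<nu>' then 1 else 0)"
proof -
  have [measurable]: "\<phi> j \<in> borel_measurable borel" for j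
    using slepian_phi_sq_integrable[OF sb w] by (simp add: sq_integrable_on_I_def)
  show m [measurable]: "v \<nu> \<in> borel_measurable borel" for \<nu>
    unfolding v_def by measurable
  have i: "integrable lborel (\<lambda>t. indicator {-1..1} t * (\<phi> i t * \<phi> j t))" for i j
    using sq_integrable_on_I_mult[OF slepian_phi_sq_integrable[OF sb w] slepian_phi_sq_integrable[OF sb w]]
    unfolding set_integrable_def by simp
  have "(LINT x|unif. v \<nu> x * v \<nu>' x) = (LINT x:cube|lborel. v \<nu> x * v \<nu>' x) / 2 ^ CARD('d)"
    by (rule integral_unif) measurable
  also have "(LINT x:cube|lborel. v \<nu> x * v \<nu>' x)
     = (LINT x|lborel. (\<Prod>k\<in>UNIV. indicator {-1..1} (x $ k) * (\<phi> (\<nu> k) (x $ k) * \<phi> (\<nu>' k) (x $ k))))"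
    unfolding set_lebesgue_integral_def
  proof (intro Bochner_Integration.integral_cong refl)
    fix x :: "real ^ 'd"
    have "(\<Prod>k\<in>UNIV. indicator {-1..1} (x $ k) * (\<phi> (\<nu> k) (x $ k) * \<phi> (\<nu>' k) (x $ k)))
       = indicator cube x * ((\<Prod>k\<in>UNIV. \<phi> (\<nu> k) (x $ k)) * (\<Prod>k\<in>UNIV. \<phi> (\<nu>' k) (x $ k)))"
      by (simp only: prod.distrib indicator_cube)
    then show "indicator cube x *\<^sub>R (v \<nu> x * v \<nu>' x)
       = (\<Prod>k\<in>UNIV. indicator {-1..1} (x $ k) * (\<phi> (\<nu> k) (x $ k) * \<phi> (\<nu>' k) (x $ k)))"
      by (cases "x \<in> cube") (simp_all only: v_def indicator_simps, simp_all)
  qed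
  also have "\<dots> = (\<Prod>k\<in>UNIV. LINT t|lborel. indicator {-1..1} t * (\<phi> (\<nu> k) t * \<phi> (\<nu>' k) t))"
    by (rule integral_lborel_vec_prod[of "\<lambda>k t. indicator {-1..1} t * (\<phi> (\<nu> k) t * \<phi> (\<nu>' k) t)", OF i])
  also have "\<dots> = (\<Prod>k\<in>(UNIV::'d set). 2 * (if \<nu> k = \<nu>' k then 1 else 0))"
    using slepian_phi_orth[OF sb w] unfolding set_lebesgue_integral_def by (intro prod.cong) auto
  also have "\<dots> = 2 ^ CARD('d) * (\<Prod>k\<in>(UNIV::'d set). if \<nu> k = \<nu>' k then 1 else 0)"
    by (simp only: prod.distrib prod_constant)
  also have "(\<Prod>k\<in>(UNIV::'d set). if \<nu> k = \<nu>' k then 1 else 0) = (if \<nu> = \<nu>' then 1 else 0 :: real)"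
  proof (cases "\<nu> = \<nu>'")
    case False
    then obtain k where "\<nu> k \<noteq> \<nu>' k" by auto
    then have "(\<Prod>k\<in>(UNIV::'d set). if \<nu> k = \<nu>' k then 1 else 0 :: real) = 0"
      by (intro prod_zero) (auto intro!: exI[of _ k])
    then show ?thesis using False by simp
  qed simp
  finally show "(LINT x|unif. v \<nu> x * v \<nu>' x) = (if \<nu> = \<nu>' then 1 else 0)" by simp
qed

lemma L2_norm_u_span:
  assumes L: "finite L"
    and orth: "\<And>\<nu> \<nu>'. \<nu> \<in> L \<Longrightarrow> \<nu>' \<in> L \<Longrightarrow> (LINT x|unif. v \<nu> x * v \<nu>' x) = (if \<nu> = \<nu>' then 1 else 0)"
    and int: "\<And>\<nu> \<nu>'. \<nu> \<in> L \<Longrightarrow> \<nu>' \<in> L \<Longrightarrow> integrable unif (\<lambda>x. v \<nu> x * v \<nu>' x)"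
    and v: "\<And>\<nu> x. v \<nu> x = indicator cube x * (\<Prod>k\<in>UNIV. \<phi> (\<nu> k) (x $ k))"
  shows "(L2_norm_u (\<lambda>x. \<Sum>\<nu>\<in>L. c \<nu> * tensor_fun \<phi> \<nu> x))\<^sup>2 = (\<Sum>\<nu>\<in>L. (cmod (c \<nu>))\<^sup>2)"
proof -
  have "(LINT x:cube|unif. (cmod (\<Sum>\<nu>\<in>L. c \<nu> * tensor_fun \<phi> \<nu> x))\<^sup>2)
     = (LINT x|unif. (cmod (\<Sum>\<nu>\<in>L. c \<nu> * complex_of_real (v \<nu> x)))\<^sup>2)"
    unfolding set_lebesgue_integral_def
    by (intro Bochner_Integration.integral_cong refl) (simp add: v tensor_fun_def indicator_def)
  also have "\<dots> = (\<Sum>\<nu>\<in>L. \<Sum>\<nu>'\<in>L. LINT x|unif. Re (c \<nu> * cnj (c \<nu>')) * (v \<nu> x * v \<nu>' x))"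
    unfolding cmod_sum_sq
    by (subst Bochner_Integration.integral_sum; intro sum.cong refl Bochner_Integration.integral_sum
         Bochner_Integration.integrable_sum integrable_mult_right int)
  also have "\<dots> = (\<Sum>\<nu>\<in>L. \<Sum>\<nu>'\<in>L. if \<nu> = \<nu>' then (cmod (c \<nu>))\<^sup>2 else 0)"
  proof (intro sum.cong refl)
    fix \<nu> \<nu>' assume "\<nu> \<in> L" "\<nu>' \<in> L"
    moreover have "Re (c \<nu> * cnj (c \<nu>)) = (cmod (c \<nu>))\<^sup>2"
      unfolding complex_norm_square[symmetric] by (rule Re_complex_of_real)
    ultimately show "(LINT x|unif. Re (c \<nu> * cnj (c \<nu>')) * (v \<nu> x * v \<nu>' x)) = (if \<nu> = \<nu>' then (cmod (c \<nu>))\<^sup>2 else 0)"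
      using orth[of \<nu> \<nu>'] by (simp only: integral_mult_right_zero) auto
  qed
  also have "\<dots> = (\<Sum>\<nu>\<in>L. (cmod (c \<nu>))\<^sup>2)" using L by simp
  finally show ?thesis unfolding L2_norm_u_def by (simp add: sum_nonneg)
qed

text \<open>Both parts are ln x \<le> x - 1, once strictly at 1/(1 - \<delta>) and once at 1 -
  \<delta>. Positivity gives a meaning to the inverse in the sample size; the upper bound passes
  from the Chernoff rate to the \<delta>^2 of Bernstein's inequality.\<close>

lemma rate_bounds:
  fixes \<delta> :: real
  assumes "0 < \<delta>" "\<delta> < 1"
  shows "0 < (1 - \<delta>) * ln (1 - \<delta>) + \<delta>" and "(1 - \<delta>) * ln (1 - \<delta>) + \<delta> \<le> \<delta>\<^sup>2"
proof -
  define x where "x = 1 / (1 - \<delta>)"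
  have x: "x > 0" "x \<noteq> 1" "ln x = - ln (1 - \<delta>)" using assms by (auto simp: x_def ln_div)
  have "ln x < x - 1" using ln_le_minus_one[OF x(1)] ln_eq_minus_one[OF x(1)] x(2) by linarith
  then have "(1 - \<delta>) * ln x < (1 - \<delta>) * (x - 1)" using assms by (intro mult_strict_left_mono) auto
  also have "(1 - \<delta>) * (x - 1) = \<delta>" using assms by (simp add: x_def field_simps)
  finally show "0 < (1 - \<delta>) * ln (1 - \<delta>) + \<delta>" by (simp add: x(3))
  have "(1 - \<delta>) * ln (1 - \<delta>) \<le> (1 - \<delta>) * (- \<delta>)"
    using ln_le_minus_one[of "1 - \<delta>"] assms by (intro mult_left_mono) auto
  then show "(1 - \<delta>) * ln (1 - \<delta>) + \<delta> \<le> \<delta>\<^sup>2" by (simp add: power2_eq_square algebra_simps)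
qed

text \<open>The budget gives m \<ge> 8 b N^2 ln (N/\<beta>) / \<delta>^2, so the exponent is at
  least 2 ln (N/\<beta>) and the union bound is at most N^2 (\<beta>/N)^2 = \<beta>^2.\<close>

lemma failure_probability_le:
  fixes \<beta> \<delta> N b B m :: real
  assumes \<beta>: "0 < \<beta>" "\<beta> < 1" and \<delta>: "0 < \<delta>" "\<delta> < 1" and N: "N \<ge> 1" and b: "b > 0"
    and budget: "8 * b * N\<^sup>2 \<le> B"
    and m: "m \<ge> inverse ((1 - \<delta>) * ln (1 - \<delta>) + \<delta>) * B * ln (N / \<beta>)"
  shows "m > 0" and "N\<^sup>2 * exp (- m * (\<delta> / N)\<^sup>2 / (4 * b)) \<le> \<beta>"
proof -
  define c where "c = (1 - \<delta>) * ln (1 - \<delta>) + \<delta>"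
  have c: "0 < c" "c \<le> \<delta>\<^sup>2" using rate_bounds[OF \<delta>] by (auto simp: c_def)
  have NB: "N / \<beta> > 1" using N \<beta> by (simp add: divide_simps)
  then have l: "ln (N / \<beta>) > 0" by simp
  have 1: "1 / \<delta>\<^sup>2 * (8 * b * N\<^sup>2) * ln (N / \<beta>) \<le> m"
  proof -
    have "1 / \<delta>\<^sup>2 \<le> inverse c" using c by (simp add: inverse_eq_divide frac_le)
    then have "1 / \<delta>\<^sup>2 * (8 * b * N\<^sup>2) * ln (N / \<beta>) \<le> inverse c * B * ln (N / \<beta>)"
      using budget l b c by (intro mult_right_mono mult_mono) auto
    then show ?thesis using m by (simp add: c_def)
  qed
  moreover have "0 < 1 / \<delta>\<^sup>2 * (8 * b * N\<^sup>2) * ln (N / \<beta>)"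
    using l b N \<delta> by (intro mult_pos_pos) auto
  ultimately show "m > 0" by linarith
  have "2 * ln (N / \<beta>) = (1 / \<delta>\<^sup>2 * (8 * b * N\<^sup>2) * ln (N / \<beta>)) * ((\<delta> / N)\<^sup>2 / (4 * b))"
    using \<delta> N b by (simp add: power_divide)
  also have "\<dots> \<le> m * ((\<delta> / N)\<^sup>2 / (4 * b))"
    using 1 b by (intro mult_right_mono) auto
  finally have "exp (- m * (\<delta> / N)\<^sup>2 / (4 * b)) \<le> exp (- (2 * ln (N / \<beta>)))" by simp
  also have "\<dots> = (\<beta> / N)\<^sup>2"
  proof -
    have "exp (2 * ln (N / \<beta>)) = (N / \<beta>)\<^sup>2"
      using NB by (simp add: exp_double)
    then show ?thesis using N \<beta> by (simp add: exp_minus power_divide)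
  qed
  finally have "N\<^sup>2 * exp (- m * (\<delta> / N)\<^sup>2 / (4 * b)) \<le> N\<^sup>2 * (\<beta> / N)\<^sup>2"
    by (intro mult_left_mono) auto
  also have "\<dots> = \<beta> * \<beta>" using N by (simp add: power2_eq_square)
  also have "\<dots> \<le> \<beta>" using \<beta> by (simp add: mult_left_le)
  finally show "N\<^sup>2 * exp (- m * (\<delta> / N)\<^sup>2 / (4 * b)) \<le> \<beta>" .
qed

theorem theorem3p1:
  fixes \<beta> \<delta> w :: real and n m :: nat
    and \<mu> :: "nat \<Rightarrow> real" and \<phi> :: "nat \<Rightarrow> real \<Rightarrow> real"
    and \<Lambda> :: "('d::finite \<Rightarrow> nat) set"
    and M :: "'a measure" and Y :: "nat \<Rightarrow> 'a \<Rightarrow> real ^ 'd"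
  assumes "0 < \<beta>" "\<beta> < 1" and "0 < \<delta>" "\<delta> < 1"
    and "CARD('d) \<in> {1, 2, 3}"
    and "n \<ge> 1" and "CARD('d) = 3 \<longrightarrow> n \<ge> 26"
    and "\<Lambda> = hyperbolic_cross n"
    and "w \<ge> 1" and "slepian_basis w \<mu> \<phi>"
    and "prob_space M"
    and "prob_space.indep_vars M (\<lambda>_. borel) Y {..<m}"
    and "\<And>j. j < m \<Longrightarrow> distr M borel (Y j) = unif"
    and "real m \<ge> inverse ((1 - \<delta>) * ln (1 - \<delta>) + \<delta>)
            * (2 * real (card \<Lambda>)) ^ (2 * gamma_w w) * ln (real (card \<Lambda>) / \<beta>)"
  shows "\<exists>E \<in> sets M. measure M E \<ge> 1 - \<beta> \<and>
    (\<forall>\<omega> \<in> E. \<forall>(f :: real ^ 'd \<Rightarrow> complex) (\<eta> :: nat \<Rightarrow> complex). continuous_on cube f \<longrightarrow>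
      (\<exists>!h. is_arg_min (ls_objective m (\<lambda>j. Y j \<omega>) f \<eta>) (\<lambda>g. g \<in> span_fun \<phi> \<Lambda>) h) \<and>
      (\<forall>h. is_arg_min (ls_objective m (\<lambda>j. Y j \<omega>) f \<eta>) (\<lambda>g. g \<in> span_fun \<phi> \<Lambda>) h \<longrightarrow>
         L2_norm_u (\<lambda>x. f x - h x)
           \<le> (1 + 1 / sqrt (1 - \<delta>)) * (INF g \<in> span_fun \<phi> \<Lambda>. Linf_norm_u (\<lambda>x. f x - g x))
             + 1 / sqrt (1 - \<delta>)
               * L2_set (\<lambda>j. cmod (complex_of_real (1 / sqrt (real m)) * \<eta> j)) {..<m}))"
proof -
  interpret prob_space M by fact
  note sb = \<open>slepian_basis w \<mu> \<phi>\<close> and w = \<open>w \<ge> 1\<close>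
  define N where "N = real (card \<Lambda>)"
  define b where "b = (4 * w) ^ CARD('d) * real n ^ (2 * gamma_w w - 2)"
  define u where "u \<nu> x = indicator cube x * (\<Prod>k\<in>UNIV. \<phi> (\<nu> k) (x $ k))" for \<nu> and x :: "real ^ 'd"
  have L: "finite \<Lambda>" using \<open>\<Lambda> = hyperbolic_cross n\<close> finite_hyperbolic_cross by simp
  have N: "N \<ge> 1"
    using card_hyperbolic_cross_ge[of n, where 'd = 'd] \<open>n \<ge> 1\<close> \<open>\<Lambda> = hyperbolic_cross n\<close>
    unfolding N_def by simp
  have b: "b > 0" unfolding b_def using w \<open>n \<ge> 1\<close> by (intro mult_pos_pos zero_less_power) auto
  have "8 * b * N\<^sup>2 \<le> (2 * N) ^ (2 * gamma_w w)"
    unfolding b_def N_def \<open>\<Lambda> = hyperbolic_cross n\<close> using assms by (intro sample_budget) auto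
  note fp = failure_probability_le[OF \<open>0 < \<beta>\<close> \<open>\<beta> < 1\<close> \<open>0 < \<delta>\<close> \<open>\<delta> < 1\<close> N b this,
      OF assms(14)[folded N_def]]
  have m: "m > 0" using fp(1) by simp
  \<comment> \<open>The entrywise level, chosen so that the loss t N of the quadratic form is
    exactly \<delta>.\<close>
  define t where "t = \<delta> / N"
  have t: "0 < t" "t \<le> 2" "t * N = \<delta>" using N \<open>0 < \<delta>\<close> \<open>\<delta> < 1\<close> by (auto simp: t_def divide_le_eq)
  have um [measurable]: "u \<nu> \<in> borel_measurable borel" for \<nu>
    unfolding u_def[abs_def] by (rule slepian_tensor_orth(1)[OF sb w])
  have orth: "(LINT x|unif. u \<nu> x * u \<nu>' x) = (if \<nu> = \<nu>' then 1 else 0)" for \<nu> \<nu>'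
    unfolding u_def[abs_def] by (rule slepian_tensor_orth(2)[OF sb w])
  have ub: "(u \<nu> x)\<^sup>2 \<le> b" if "\<nu> \<in> \<Lambda>" for \<nu> x
  proof (cases "x \<in> cube")
    case True
    then show ?thesis
      using slepian_tensor_bound[OF sb w True, of \<nu> n] that \<open>\<Lambda> = hyperbolic_cross n\<close>
      by (simp add: u_def b_def)
  qed (use b in \<open>simp add: u_def\<close>)
  have uint: "integrable unif (\<lambda>x. u \<nu> x * u \<nu>' x)" if "\<nu> \<in> \<Lambda>" "\<nu>' \<in> \<Lambda>" for \<nu> \<nu>'
  proof -
    interpret U: prob_space "unif :: (real ^ 'd) measure" by (rule prob_space_unif)
    have "\<bar>u \<nu> x * u \<nu>' x\<bar> \<le> sqrt b * sqrt b" for x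
      unfolding abs_mult using ub[OF that(1), of x] ub[OF that(2), of x] b
      by (intro mult_mono) (auto simp: real_le_rsqrt)
    then show ?thesis by (intro U.integrable_const_bound[of _ "sqrt b * sqrt b"]) auto
  qed
  have "\<exists>E\<in>events. prob E \<ge> 1 - (real (card \<Lambda>))\<^sup>2 * exp (- real m * t\<^sup>2 / (4 * b)) \<and>
    (\<forall>\<omega>\<in>E. \<forall>c. (1 - t * real (card \<Lambda>)) * (\<Sum>i\<in>\<Lambda>. (cmod (c i))\<^sup>2)
       \<le> (1 / real m) * (\<Sum>j<m. (cmod (\<Sum>i\<in>\<Lambda>. c i * complex_of_real (u i (Y j \<omega>))))\<^sup>2))"
    by (rule gram_concentration[where U = unif, OF L um ub prob_space_unif sets_unif orth assms(12) assms(13) t(1,2) b m])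
  then obtain E where E: "E \<in> events" "prob E \<ge> 1 - N\<^sup>2 * exp (- real m * t\<^sup>2 / (4 * b))"
    and gram: "\<And>\<omega> c. \<omega> \<in> E \<Longrightarrow> (1 - \<delta>) * (\<Sum>i\<in>\<Lambda>. (cmod (c i))\<^sup>2)
       \<le> (1 / real m) * (\<Sum>j<m. (cmod (\<Sum>i\<in>\<Lambda>. c i * complex_of_real (u i (Y j \<omega>))))\<^sup>2)"
    unfolding N_def[symmetric] t(3) by blast
  have rv: "Y j \<in> borel_measurable M" if "j < m" for j
    using assms(12) that by (auto simp: indep_vars_def)
  \<comment> \<open>The Gram bound concerns functions cut off at the cube. Removing the null event
    that some sample leaves the cube identifies them with \<open>tensor_fun\<close> at the
    samples.\<close>
  define F where "F = {\<omega> \<in> E. \<forall>j\<in>{..<m}. Y j \<omega> \<in> cube}"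
  have Fm: "F \<in> events"
  proof -
    have "F = E \<inter> {\<omega> \<in> space M. \<forall>j\<in>{..<m}. Y j \<omega> \<in> cube}"
      using sets.sets_into_space[OF E(1)] by (auto simp: F_def)
    moreover have "{\<omega> \<in> space M. \<forall>j\<in>{..<m}. Y j \<omega> \<in> cube} \<in> events"
    proof (rule sets.sets_Collect_finite_All)
      fix j assume "j \<in> {..<m}"
      then have [measurable]: "Y j \<in> borel_measurable M" using rv by simp
      show "{\<omega> \<in> space M. Y j \<omega> \<in> cube} \<in> events" by measurable
    qed simp
    ultimately show ?thesis using E(1) by auto
  qed
  have "AE \<omega> in M. \<forall>j\<in>{..<m}. Y j \<omega> \<in> cube"
  proof (rule AE_finite_allI)
    fix j assume "j \<in> {..<m}"
    then have j: "j < m" by simp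
    have "AE x in distr M borel (Y j). x \<in> cube" unfolding assms(13)[OF j] by (rule AE_unif_cube)
    then show "AE \<omega> in M. Y j \<omega> \<in> cube" by (rule AE_distrD[OF rv[OF j]])
  qed simp
  then have "prob F = prob E"
    by (intro finite_measure_eq_AE Fm E(1)) (auto simp: F_def)
  then have PF: "prob F \<ge> 1 - \<beta>" using E(2) fp(2) unfolding t_def by simp
  have main: "(\<exists>!h. is_arg_min (ls_objective m (\<lambda>j. Y j \<omega>) f \<eta>) (\<lambda>g. g \<in> span_fun \<phi> \<Lambda>) h) \<and>
      (\<forall>h. is_arg_min (ls_objective m (\<lambda>j. Y j \<omega>) f \<eta>) (\<lambda>g. g \<in> span_fun \<phi> \<Lambda>) h \<longrightarrow>
         L2_norm_u (\<lambda>x. f x - h x)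
           \<le> (1 + 1 / sqrt (1 - \<delta>)) * (INF g \<in> span_fun \<phi> \<Lambda>. Linf_norm_u (\<lambda>x. f x - g x))
             + 1 / sqrt (1 - \<delta>)
               * L2_set (\<lambda>j. cmod (complex_of_real (1 / sqrt (real m)) * \<eta> j)) {..<m})"
    if \<omega>: "\<omega> \<in> F" and f: "continuous_on cube f" for \<omega> f \<eta>
  proof -
    have Yc: "Y j \<omega> \<in> cube" if "j < m" for j using \<omega> that by (auto simp: F_def)
    have gram': "(1 - \<delta>) * (\<Sum>i\<in>\<Lambda>. (cmod (c i))\<^sup>2)
       \<le> (1 / real m) * (\<Sum>j<m. (cmod (\<Sum>i\<in>\<Lambda>. c i * tensor_fun \<phi> i (Y j \<omega>)))\<^sup>2)" for c
    proof -
      have "complex_of_real (u i (Y j \<omega>)) = tensor_fun \<phi> i (Y j \<omega>)" if "j < m" for i j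
        using Yc[OF that] by (simp add: u_def tensor_fun_def)
      then show ?thesis using gram[of \<omega> c] \<omega> by (simp add: F_def)
    qed
    show ?thesis
    proof (rule least_squares_error[OF slepian_phi_continuous[OF sb w] L \<open>\<delta> < 1\<close> m Yc _ _ f])
      fix g assume "g \<in> span_fun \<phi> \<Lambda>"
      then obtain c where g: "g = (\<lambda>x. \<Sum>\<nu>\<in>\<Lambda>. c \<nu> * tensor_fun \<phi> \<nu> x)" by (auto simp: span_fun_def)
      have "(L2_norm_u g)\<^sup>2 = (\<Sum>i\<in>\<Lambda>. (cmod (c i))\<^sup>2)"
        unfolding g by (rule L2_norm_u_span[where v = u, OF L orth uint u_def])
      then show "(1 - \<delta>) * (L2_norm_u g)\<^sup>2 \<le> (1 / real m) * (\<Sum>j<m. (cmod (g (Y j \<omega>)))\<^sup>2)"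
        using gram'[of c] unfolding g by (simp only:)
      \<comment> \<open>Vanishing at the samples forces all coefficients to be 0, so g is zero on
        the whole space and not merely on the cube, as uniqueness of the minimiser requires.\<close>
      assume "(\<Sum>j<m. (cmod (g (Y j \<omega>)))\<^sup>2) = 0"
      then have "(1 - \<delta>) * (\<Sum>i\<in>\<Lambda>. (cmod (c i))\<^sup>2) \<le> 0" using gram'[of c] unfolding g by simp
      then have "(\<Sum>i\<in>\<Lambda>. (cmod (c i))\<^sup>2) \<le> 0" using \<open>\<delta> < 1\<close> by (simp add: mult_le_0_iff)
      then have "(\<Sum>i\<in>\<Lambda>. (cmod (c i))\<^sup>2) = 0" by (intro antisym sum_nonneg) auto
      then have "c i = 0" if "i \<in> \<Lambda>" for i using L that by (simp add: sum_nonneg_eq_0_iff)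
      then show "g = (\<lambda>x. 0)" unfolding g by simp
    qed
  qed
  show ?thesis using Fm PF main by blast
qed

end
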